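(* Let $N\ge1$, $D\ge0$, $M\ge0$ and $T>0$. There is a constant $\sigma_0>0$, depending only on $N$, $D$, $M$, $T$ (and the fixed $f,r,H,R$), such that the following holds: whenever $0<\sigma<\sigma_0$, $u_0\in V$ with $\|u_0\|_V\le M$, $0<t_1<\dots<t_N=T$, and $z_1,\dots,z_N\in\mathbb R^q$ with $|z_i|\le D$ for all $i$, the cost functional $$J(u)=\frac12\sum_{i=1}^N\big|R^{-1/2}\big(Hy(t_i)-z_i\big)\big|^2+\frac1{2\sigma^2}\|u-u_0\|_V^2$$ has a unique global minimizer in $V$.
   Context: $\|\cdot\|$ and $\langle\cdot,\cdot\rangle$ denote the norm and inner product of $L^2(0,1)$; $V=H^1_0(0,1)$ with norm $\|u\|_V=\|u_x\|$. Standing assumptions: $f,r\in C^2(\mathbb R)$ and $\int_{-\infty}^0\frac{dy}{|r(y)|+1}=\int_0^\infty\frac{dy}{|r(y)|+1}=\infty$. For $u\in V$, $y=y(x,t)$ denotes the solution of $y_t+f(y)_x=y_{xx}+r(y)$ on $[0,1]\times(0,\infty)$ with $y(0,t)=y(1,t)=0$ and $y(\cdot,0)=u$. $H:L^2(0,1)\to\mathbb R^q$ is a fixed bounded linear operator, $R$ a fixed symmetric positive definite $q\times q$ matrix, $|\cdot|$ the Euclidean norm. *)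

theory Defs
  imports "HOL-Analysis.Analysis"
begin

text \<open>Functions on (0,1) are represented as real \<Rightarrow> real; only values on [0,1] matter
  for L^2 notions. Elements of V are normalised to vanish outside [0,1].\<close>

definition sq_int :: "(real \<Rightarrow> real) \<Rightarrow> bool" where
  "sq_int g \<longleftrightarrow> g measurable_on {0..1} \<and> (\<lambda>x. (g x)\<^sup>2) integrable_on {0..1}"

definition L2norm :: "(real \<Rightarrow> real) \<Rightarrow> real" where
  "L2norm v = sqrt (integral {0..1} (\<lambda>x. (v x)\<^sup>2))"

definition weak_deriv :: "(real \<Rightarrow> real) \<Rightarrow> (real \<Rightarrow> real) \<Rightarrow> bool" where
  "weak_deriv u g \<longleftrightarrow> sq_int g \<and> (\<forall>x\<in>{0..1}. u x = u 0 + integral {0..x} g)"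

text \<open>V = H^1_0(0,1) (continuous representatives, extended by zero).\<close>
definition H10 :: "(real \<Rightarrow> real) set" where
  "H10 = {u. (\<forall>x. x \<notin> {0..1} \<longrightarrow> u x = 0) \<and> u 0 = 0 \<and> u 1 = 0 \<and> (\<exists>g. weak_deriv u g)}"

definition Vnorm :: "(real \<Rightarrow> real) \<Rightarrow> real" where
  "Vnorm u = L2norm (SOME g. weak_deriv u g)"

definition is_solution ::
  "(real \<Rightarrow> real) \<Rightarrow> (real \<Rightarrow> real) \<Rightarrow> (real \<Rightarrow> real) \<Rightarrow> (real \<Rightarrow> real \<Rightarrow> real) \<Rightarrow> bool" where
  "is_solution f r u y \<longleftrightarrow>
     (\<forall>t x. (t < 0 \<or> x \<notin> {0..1}) \<longrightarrow> y t x = 0) \<and>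
     (\<forall>x. y 0 x = u x) \<and>
     (\<forall>t>0. y t 0 = 0 \<and> y t 1 = 0) \<and>
     (\<exists>yx yxx yt.
        continuous_on ({0<..} \<times> {0..1}) (\<lambda>(t,x). y t x) \<and>
        continuous_on ({0<..} \<times> {0..1}) (\<lambda>(t,x). yx t x) \<and>
        continuous_on ({0<..} \<times> {0..1}) (\<lambda>(t,x). yxx t x) \<and>
        continuous_on ({0<..} \<times> {0..1}) (\<lambda>(t,x). yt t x) \<and>
        (\<forall>t>0. \<forall>x\<in>{0..1}.
           (y t has_real_derivative yx t x) (at x within {0..1}) \<and>
           (yx t has_real_derivative yxx t x) (at x within {0..1}) \<and>
           ((\<lambda>s. y s x) has_real_derivative yt t x) (at t) \<and>
           yt t x + deriv f (y t x) * yx t x = yxx t x + r (y t x))) \<and>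
     ((\<lambda>t. Vnorm (\<lambda>x. y t x - u x)) \<longlongrightarrow> 0) (at_right 0)"

definition sol :: "(real \<Rightarrow> real) \<Rightarrow> (real \<Rightarrow> real) \<Rightarrow> (real \<Rightarrow> real) \<Rightarrow> real \<Rightarrow> real \<Rightarrow> real" where
  "sol f r u = (THE y. is_solution f r u y)"

text \<open>|R^{-1/2} w|^2 = w^T R^{-1} w.\<close>
definition wsq :: "real^'q^'q \<Rightarrow> real^'q \<Rightarrow> real" where
  "wsq R w = w \<bullet> (matrix_inv R *v w)"

definition cost ::
  "(real \<Rightarrow> real) \<Rightarrow> (real \<Rightarrow> real) \<Rightarrow> ((real \<Rightarrow> real) \<Rightarrow> real^'q) \<Rightarrow> real^'q^'q \<Rightarrow> real
   \<Rightarrow> (real \<Rightarrow> real) \<Rightarrow> nat \<Rightarrow> (nat \<Rightarrow> real) \<Rightarrow> (nat \<Rightarrow> real^'q) \<Rightarrow> (real \<Rightarrow> real) \<Rightarrow> real" where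
  "cost f r H R \<sigma> u0 N t z u =
     (1/2) * (\<Sum>i=1..N. wsq R (H (sol f r u (t i)) - z i))
     + (Vnorm (\<lambda>x. u x - u0 x))\<^sup>2 / (2 * \<sigma>\<^sup>2)"

definition C2 :: "(real \<Rightarrow> real) \<Rightarrow> bool" where
  "C2 g \<longleftrightarrow> (\<exists>g' g''. (\<forall>x. (g has_real_derivative g' x) (at x) \<and> (g' has_real_derivative g'' x) (at x))
                      \<and> continuous_on UNIV g'')"

end

theory Submission
  imports Defs
begin

text \<open>Everything is moved to Fourier coefficients. With \<open>c_k = \<kappa>_k (u, sqrt 2 sin (\<kappa>_k x))\<close>,
  \<open>\<kappa>_k = (k + 1) \<pi>\<close>, the space \<open>V\<close> becomes the Hilbert space of square-summable sequences, and the PDE the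
  diagonal system \<open>c_k' = - \<kappa>_k\<^sup>2 c_k + \<kappa>_k F_k(c)\<close>, where \<open>F\<close>, the sine coefficients of
  \<open>- f'(y) y_x + r(y)\<close>, is locally Lipschitz. The scalar estimate
  \<open>a(t)\<^sup>2 + \<kappa>\<^sup>2 \<integral> a\<^sup>2 \<le> a(0)\<^sup>2 + \<integral> g\<^sup>2\<close> for \<open>a' = - \<kappa>\<^sup>2 a + \<kappa> g\<close>, summed over
  \<open>k\<close>, gives local existence, Lipschitz dependence on the data and maximal regularity. Time regularity follows by
  comparing \<open>c(q t)\<close> with \<open>c(t)\<close>, space regularity by reading the equation as \<open>y_xx = y_t - F\<close>. The Osgood
  conditions and the maximum principle bound \<open>y\<close>, hence \<open>c\<close>, and make solutions global.

  In divergence form the same estimate holds one derivative lower, and there the solution map satisfies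
  \<open>\<parallel>y(m) - (y(c) + y(d)) / 2\<parallel> \<le> K \<parallel>c - d\<parallel>\<^sup>2\<close> for \<open>m = (c + d) / 2\<close>, since \<open>f\<close> and \<open>r\<close> are
  \<open>C\<^sup>2\<close>. For small \<open>\<sigma>\<close> the quadratic penalty beats this defect: the cost is midpoint strongly convex
  on a ball around \<open>u0\<close> and exceeds its value at \<open>u0\<close> outside.\<close>

section \<open>Square-summable sequences\<close>

text \<open>The weight \<open>kap k\<close> in the coefficients makes the \<open>ell2\<close> norm
  equal to the norm of V: the coordinates of \<open>c\<close> are the cosine coefficients of the
  weak derivative \<open>der c\<close>, and \<open>val c\<close> is the function itself. In these
  variables the nonlinearity maps V to L^2 and enters with a factor \<open>kap k\<close>, which
  costs one derivative; the dissipation \<open>(kap k)^2\<close> pays for exactly that one. Since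
  \<open>sol\<close> is a definite description, every datum in V needs a solution with all the
  derivatives demanded by \<open>is_solution\<close>, and that solution must be unique among all
  functions with this property. The midpoint estimate is made in L^2 and not in V: as f is only C^2,
  second differences of \<open>f1 (y) y_x\<close> need not be quadratically small, whereas those of
  \<open>f (y)\<close> are, and \<open>H\<close> is continuous on L^2. The data misfit is therefore
  midpoint convex up to a multiple of \<open>norm (c - d)^2\<close>, while the penalty gains
  \<open>norm (c - d)^2 / (8 sigma^2)\<close>.\<close>

typedef ell2 = "{a :: nat \<Rightarrow> real. summable (\<lambda>k. (a k)\<^sup>2)}"
  morphisms coord Abs_ell2
  by (rule exI[of _ "\<lambda>_. 0"]) simp

lemma summable_coord_sq: "summable (\<lambda>k. (coord x k)\<^sup>2)"
  using coord[of x] by simp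

lemma coord_Abs: "summable (\<lambda>k. (a k)\<^sup>2) \<Longrightarrow> coord (Abs_ell2 a) = a"
  by (simp add: Abs_ell2_inverse)

lemma ell2_eqI: "(\<And>k. coord x k = coord y k) \<Longrightarrow> x = y"
  using coord_inject by blast

lemma summable_mult_of_squares:
  fixes a b :: "nat \<Rightarrow> real"
  assumes "summable (\<lambda>k. (a k)\<^sup>2)" "summable (\<lambda>k. (b k)\<^sup>2)"
  shows "summable (\<lambda>k. a k * b k)"
proof (rule summable_comparison_test[OF _ summable_add[OF assms]], intro exI allI impI)
  fix n
  have "2 * (\<bar>a n\<bar> * \<bar>b n\<bar>) \<le> (a n)\<^sup>2 + (b n)\<^sup>2"
    using sum_squares_bound[of "\<bar>a n\<bar>" "\<bar>b n\<bar>"] by (simp add: mult.assoc)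
  moreover have "0 \<le> \<bar>a n\<bar> * \<bar>b n\<bar>" by simp
  ultimately have "\<bar>a n\<bar> * \<bar>b n\<bar> \<le> (a n)\<^sup>2 + (b n)\<^sup>2" by linarith
  then show "norm (a n * b n) \<le> (a n)\<^sup>2 + (b n)\<^sup>2"
    by (simp add: abs_mult)
qed

lemma summable_sq_add:
  fixes a b :: "nat \<Rightarrow> real"
  assumes "summable (\<lambda>k. (a k)\<^sup>2)" "summable (\<lambda>k. (b k)\<^sup>2)"
  shows "summable (\<lambda>k. (a k + b k)\<^sup>2)"
proof -
  have "summable (\<lambda>k. ((a k)\<^sup>2 + (b k)\<^sup>2) + 2 * (a k * b k))"
    by (intro summable_add summable_mult assms summable_mult_of_squares)
  moreover have "(\<lambda>k. ((a k)\<^sup>2 + (b k)\<^sup>2) + 2 * (a k * b k)) = (\<lambda>k. (a k + b k)\<^sup>2)"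
    by (simp add: power2_sum mult.assoc)
  ultimately show ?thesis by simp
qed

lemma summable_sq_scale:
  fixes a :: "nat \<Rightarrow> real"
  shows "summable (\<lambda>k. (a k)\<^sup>2) \<Longrightarrow> summable (\<lambda>k. (c * a k)\<^sup>2)"
  by (simp add: power_mult_distrib summable_mult)

instantiation ell2 :: real_vector
begin
definition zero_ell2 :: ell2 where "0 = Abs_ell2 (\<lambda>_. 0)"
definition plus_ell2 :: "ell2 \<Rightarrow> ell2 \<Rightarrow> ell2" where "x + y = Abs_ell2 (\<lambda>k. coord x k + coord y k)"
definition uminus_ell2 :: "ell2 \<Rightarrow> ell2" where "- x = Abs_ell2 (\<lambda>k. - coord x k)"
definition minus_ell2 :: "ell2 \<Rightarrow> ell2 \<Rightarrow> ell2" where "x - y = Abs_ell2 (\<lambda>k. coord x k - coord y k)"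
definition scaleR_ell2 :: "real \<Rightarrow> ell2 \<Rightarrow> ell2" where "c *\<^sub>R x = Abs_ell2 (\<lambda>k. c * coord x k)"

lemma coord_zero [simp]: "coord 0 k = 0"
  by (simp add: zero_ell2_def coord_Abs)

lemma coord_add [simp]: "coord (x + y) k = coord x k + coord y k"
  by (simp add: plus_ell2_def coord_Abs summable_sq_add summable_coord_sq)

lemma coord_uminus [simp]: "coord (- x) k = - coord x k"
  by (simp add: uminus_ell2_def coord_Abs summable_coord_sq)

lemma coord_diff [simp]: "coord (x - y) k = coord x k - coord y k"
  using summable_sq_add[OF summable_coord_sq[of x] summable_coord_sq[of "- y"]]
  by (simp add: minus_ell2_def coord_Abs)

lemma coord_scaleR [simp]: "coord (c *\<^sub>R x) k = c * coord x k"
  by (simp add: scaleR_ell2_def coord_Abs summable_sq_scale summable_coord_sq)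

instance
  by standard (rule ell2_eqI; simp add: algebra_simps)+
end

instantiation ell2 :: real_inner
begin
definition inner_ell2 :: "ell2 \<Rightarrow> ell2 \<Rightarrow> real" where "inner x y = (\<Sum>k. coord x k * coord y k)"
definition norm_ell2 :: "ell2 \<Rightarrow> real" where "norm (x :: ell2) = sqrt (inner x x)"
definition sgn_ell2 :: "ell2 \<Rightarrow> ell2" where "sgn (x :: ell2) = x /\<^sub>R norm x"
definition dist_ell2 :: "ell2 \<Rightarrow> ell2 \<Rightarrow> real" where "dist (x :: ell2) y = norm (x - y)"
definition uniformity_ell2 :: "(ell2 \<times> ell2) filter" where
  "uniformity_ell2 = (INF e\<in>{0 <..}. principal {(x, y). dist x y < e})"
definition open_ell2 :: "ell2 set \<Rightarrow> bool" where
  "open_ell2 S \<longleftrightarrow> (\<forall>x\<in>S. \<forall>\<^sub>F (x', y) in uniformity. x' = x \<longrightarrow> y \<in> S)"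

instance
proof
  fix x y z :: ell2 and r :: real
  have s: "summable (\<lambda>k. coord u k * coord v k)" for u v
    by (intro summable_mult_of_squares summable_coord_sq)
  show "inner x y = inner y x"
    by (simp add: inner_ell2_def mult.commute)
  show "inner (x + y) z = inner x z + inner y z"
    unfolding inner_ell2_def by (simp add: distrib_right suminf_add[OF s s])
  show "inner (r *\<^sub>R x) y = r * inner x y"
    unfolding inner_ell2_def by (simp add: mult.assoc suminf_mult[OF s])
  show "0 \<le> inner x x"
    unfolding inner_ell2_def by (intro suminf_nonneg s) simp
  show "inner x x = 0 \<longleftrightarrow> x = 0"
  proof
    assume "inner x x = 0"
    then have "\<forall>k. coord x k * coord x k = 0"
      unfolding inner_ell2_def by (subst (asm) suminf_eq_zero_iff[OF s]) auto
    then show "x = 0" by (intro ell2_eqI) simp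
  qed (simp add: inner_ell2_def)
qed (rule dist_ell2_def sgn_ell2_def uniformity_ell2_def open_ell2_def norm_ell2_def)+
end

lemma norm_ell2_sq: "(norm x)\<^sup>2 = (\<Sum>k. (coord x k)\<^sup>2)"
  unfolding power2_norm_eq_inner inner_ell2_def by (simp add: power2_eq_square)

lemma coord_sums_norm_sq: "(\<lambda>k. (coord x k)\<^sup>2) sums (norm x)\<^sup>2"
  unfolding norm_ell2_sq by (intro summable_sums summable_coord_sq)

lemma sum_coord_sq_le: "finite A \<Longrightarrow> (\<Sum>k\<in>A. (coord x k)\<^sup>2) \<le> (norm x)\<^sup>2"
  unfolding norm_ell2_sq by (intro sum_le_suminf summable_coord_sq) auto

lemma abs_coord_le_norm: "\<bar>coord x k\<bar> \<le> norm x"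
  using sum_coord_sq_le[of "{k}" x] by (simp add: abs_le_square_iff[symmetric])

lemma norm_sq_leI:
  assumes "\<And>n. (\<Sum>k<n. (coord x k)\<^sup>2) \<le> B"
  shows "(norm x)\<^sup>2 \<le> B"
  unfolding norm_ell2_sq using assms by (intro suminf_le_const summable_coord_sq)

text \<open>The energy estimates bound finite partial sums uniformly; such a bound yields membership
  in \<open>ell2\<close> and a norm bound at once.\<close>

lemma ell2_exists:
  assumes "\<And>n. (\<Sum>k<n. (a k)\<^sup>2) \<le> B"
  shows "\<exists>x. coord x = a \<and> (norm x)\<^sup>2 \<le> B"
proof -
  have "summable (\<lambda>k. (a k)\<^sup>2)"
    by (rule summableI_nonneg_bounded[of _ B]) (use assms in auto)
  then have "coord (Abs_ell2 a) = a" by (rule coord_Abs)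
  with assms norm_sq_leI[of "Abs_ell2 a" B] show ?thesis by auto
qed

lemma bounded_linear_coord: "bounded_linear (\<lambda>x. coord x k)"
  by (rule bounded_linear_intro[where K=1]) (use abs_coord_le_norm in auto)

lemmas continuous_on_coord [continuous_intros] =
  bounded_linear.continuous_on[OF bounded_linear_coord]
instance ell2 :: complete_space
proof
  fix X :: "nat \<Rightarrow> ell2"
  assume C: "Cauchy X"
  have "Cauchy (\<lambda>n. coord (X n) k)" for k
    by (rule bounded_linear.Cauchy[OF bounded_linear_coord C])
  then have "\<exists>l. (\<lambda>n. coord (X n) k) \<longlonglongrightarrow> l" for k
    by (auto simp: Cauchy_convergent_iff convergent_def)
  then obtain l where l: "\<And>k. (\<lambda>n. coord (X n) k) \<longlonglongrightarrow> l k" by metis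
  obtain B where B: "\<And>n. norm (X n) \<le> B"
    using Cauchy_Bseq[OF C] unfolding Bseq_def by auto
  have "(\<Sum>k<n. (l k)\<^sup>2) \<le> B\<^sup>2" for n
  proof (rule LIMSEQ_le_const2)
    show "(\<lambda>m. \<Sum>k<n. (coord (X m) k)\<^sup>2) \<longlonglongrightarrow> (\<Sum>k<n. (l k)\<^sup>2)"
      by (intro tendsto_intros l)
    show "\<exists>N. \<forall>m\<ge>N. (\<Sum>k<n. (coord (X m) k)\<^sup>2) \<le> B\<^sup>2"
      by (intro exI allI impI order_trans[OF sum_coord_sq_le] power_mono B) auto
  qed
  then obtain x where x: "coord x = l" using ell2_exists by blast
  have "X \<longlonglongrightarrow> x"
  proof (rule metric_LIMSEQ_I)
    fix e :: real assume "0 < e"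
    then obtain M where M: "\<And>m n. m \<ge> M \<Longrightarrow> n \<ge> M \<Longrightarrow> dist (X m) (X n) < e/2"
      using C unfolding Cauchy_def by (meson half_gt_zero)
    have "dist (X m) x < e" if "m \<ge> M" for m
    proof -
      \<comment> \<open>Coordinates converge one at a time, so the Cauchy bound passes to the limit
        inside each finite partial sum first and only then to the full norm.\<close>
      have "(norm (X m - x))\<^sup>2 \<le> (e/2)\<^sup>2"
      proof (rule norm_sq_leI, rule LIMSEQ_le_const2)
        fix n
        show "(\<lambda>j. \<Sum>k<n. (coord (X m - X j) k)\<^sup>2) \<longlonglongrightarrow> (\<Sum>k<n. (coord (X m - x) k)\<^sup>2)"
          unfolding coord_diff x by (intro tendsto_intros l)
        have "(\<Sum>k<n. (coord (X m - X j) k)\<^sup>2) \<le> (e/2)\<^sup>2" if "j \<ge> M" for j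
          using sum_coord_sq_le[of "{..<n}" "X m - X j"] M[OF \<open>m \<ge> M\<close> that] \<open>0 < e\<close>
          by (intro order_trans[OF sum_coord_sq_le] power_mono) (auto simp: dist_norm)
        then show "\<exists>N. \<forall>j\<ge>N. (\<Sum>k<n. (coord (X m - X j) k)\<^sup>2) \<le> (e/2)\<^sup>2" by blast
      qed
      then have "norm (X m - x) \<le> e/2"
        using \<open>0 < e\<close> by (simp add: power2_le_iff_abs_le)
      then show ?thesis using \<open>0 < e\<close> by (simp add: dist_norm)
    qed
    then show "\<exists>M. \<forall>m\<ge>M. dist (X m) x < e" by blast
  qed
  then show "convergent X" unfolding convergent_def by blast
qed

instance ell2 :: banach ..

section \<open>Finite sections of square-summable sequences\<close>

definition ell2_trunc :: "nat \<Rightarrow> ell2 \<Rightarrow> ell2" where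
  "ell2_trunc n x = Abs_ell2 (\<lambda>k. if k < n then coord x k else 0)"

lemma coord_ell2_trunc: "coord (ell2_trunc n x) k = (if k < n then coord x k else 0)"
proof -
  have "summable (\<lambda>k. (if k < n then coord x k else 0)\<^sup>2)"
    by (rule summable_finite[of "{..<n}"]) auto
  then show ?thesis by (simp add: ell2_trunc_def coord_Abs)
qed

definition ell2_unit :: "nat \<Rightarrow> ell2" where
  "ell2_unit j = Abs_ell2 (\<lambda>k. if k = j then 1 else 0)"

lemma coord_ell2_unit: "coord (ell2_unit j) k = (if k = j then 1 else 0)"
proof -
  have "summable (\<lambda>k. (if k = j then 1 else 0::real)\<^sup>2)"
    by (rule summable_finite[of "{j}"]) auto
  then show ?thesis by (simp add: ell2_unit_def coord_Abs)
qed

lemma coord_sum: "coord (sum f A) k = (\<Sum>i\<in>A. coord (f i) k)"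
  by (rule linear_sum) (use bounded_linear_coord bounded_linear.linear in blast)

lemma ell2_trunc_eq_sum: "ell2_trunc n x = (\<Sum>j<n. coord x j *\<^sub>R ell2_unit j)"
  by (rule ell2_eqI) (simp add: coord_ell2_trunc coord_sum coord_ell2_unit if_distrib cong: if_cong)

lemma norm_sq_trunc: "(norm (ell2_trunc n x))\<^sup>2 = (\<Sum>k<n. (coord x k)\<^sup>2)"
  unfolding norm_ell2_sq coord_ell2_trunc
  by (subst suminf_finite[of "{..<n}"]) auto

lemma norm_trunc_le: "norm (ell2_trunc n x) \<le> norm x"
  by (rule power2_le_imp_le) (simp_all add: norm_sq_trunc sum_coord_sq_le)

lemma norm_sq_trunc_compl: "(norm (x - ell2_trunc n x))\<^sup>2 = (norm x)\<^sup>2 - (\<Sum>k<n. (coord x k)\<^sup>2)"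
proof -
  have "inner (x - ell2_trunc n x) (ell2_trunc n x) = 0"
    unfolding inner_ell2_def by (simp add: coord_ell2_trunc if_distrib cong: if_cong)
  then have "inner x (ell2_trunc n x) = inner (ell2_trunc n x) (ell2_trunc n x)"
    by (simp add: inner_diff_left)
  then have "(norm (x - ell2_trunc n x))\<^sup>2 = (norm x)\<^sup>2 - (norm (ell2_trunc n x))\<^sup>2"
    by (simp add: power2_norm_eq_inner inner_diff_left inner_diff_right inner_commute)
  then show ?thesis by (simp add: norm_sq_trunc)
qed

lemma ell2_trunc_diff: "ell2_trunc n (x - y) = ell2_trunc n x - ell2_trunc n y"
  by (rule ell2_eqI) (simp add: coord_ell2_trunc)

lemma ell2_trunc_tendsto: "(\<lambda>n. ell2_trunc n x) \<longlonglongrightarrow> x"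
proof -
  have "(\<lambda>n. (norm (x - ell2_trunc n x))\<^sup>2) \<longlonglongrightarrow> (norm x)\<^sup>2 - (norm x)\<^sup>2"
    unfolding norm_sq_trunc_compl
    using coord_sums_norm_sq[of x] by (intro tendsto_intros) (simp add: sums_def)
  then have "(\<lambda>n. sqrt ((norm (x - ell2_trunc n x))\<^sup>2)) \<longlonglongrightarrow> sqrt 0"
    by (intro tendsto_real_sqrt) simp
  then have "(\<lambda>n. x - ell2_trunc n x) \<longlonglongrightarrow> 0"
    by (simp add: tendsto_norm_zero_iff)
  then have "(\<lambda>n. x - (x - ell2_trunc n x)) \<longlonglongrightarrow> x - 0"
    by (intro tendsto_intros)
  then show ?thesis by simp
qed

text \<open>The truncations are contractions, so their pointwise convergence is uniform on compact sets.\<close>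

lemma uniform_limit_ell2_trunc:
  fixes g :: "'a :: metric_space \<Rightarrow> ell2"
  assumes "compact S" "continuous_on S g"
  shows "uniform_limit S (\<lambda>n s. ell2_trunc n (g s)) g sequentially"
proof (rule uniform_limitI)
  fix e :: real assume e: "0 < e"
  have "compact (g ` S)" using assms compact_continuous_image by blast
  then obtain A where A: "finite A" "g ` S \<subseteq> (\<Union>a\<in>A. ball a (e/3))"
    using e compact_eq_totally_bounded[of "g ` S"]
    by (metis divide_pos_pos zero_less_numeral)
  have "\<forall>\<^sub>F n in sequentially. \<forall>a\<in>A. dist (ell2_trunc n a) a < e/3"
    using A(1) e by (intro eventually_ball_finite ballI tendstoD[OF ell2_trunc_tendsto]) auto
  then show "\<forall>\<^sub>F n in sequentially. \<forall>s\<in>S. dist (ell2_trunc n (g s)) (g s) < e"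
  proof eventually_elim
    case (elim n)
    show ?case
    proof
      fix s assume "s \<in> S"
      then obtain a where a: "a \<in> A" "dist a (g s) < e/3" using A(2) by auto
      have "dist (ell2_trunc n (g s)) (ell2_trunc n a) \<le> dist (g s) a"
        by (simp add: dist_norm norm_trunc_le flip: ell2_trunc_diff)
      then show "dist (ell2_trunc n (g s)) (g s) < e"
        using a elim dist_triangle[of "ell2_trunc n (g s)" "g s" "ell2_trunc n a"]
          dist_triangle[of "ell2_trunc n a" "g s" a]
        by (auto simp: dist_commute) 
    qed
  qed
qed

text \<open>Coordinatewise continuity is weaker than continuity in norm but suffices for finite
  sections. Where the sections converge uniformly, it upgrades to continuity in norm.\<close>

lemma continuous_on_ell2_trunc:
  assumes "\<And>k. continuous_on S (\<lambda>s. coord (c s) k)"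
  shows "continuous_on S (\<lambda>s. ell2_trunc n (c s))"
  unfolding ell2_trunc_eq_sum by (intro continuous_intros assms)

section \<open>Square-integrable functions on the unit interval\<close>

abbreviation I01 :: "real measure" where "I01 \<equiv> lebesgue_on {0..1}"

lemma AE_I01I: "(\<And>x. x \<in> {0..1} \<Longrightarrow> P x) \<Longrightarrow> AE x in I01. P x"
  by (rule AE_I2) simp

lemma measure_I01: "measure I01 (space I01) = 1"
  by (simp add: measure_restrict_space)

text \<open>Bridge from the gauge integral of the definitions to Lebesgue theory: for a nonnegative
  integrand gauge integrability is already absolute, so Fatou and almost-everywhere arguments become
  available.\<close>

lemma sq_int_iff: "sq_int g \<longleftrightarrow> g \<in> borel_measurable I01 \<and> integrable I01 (\<lambda>x. (g x)\<^sup>2)"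
proof -
  have "(\<lambda>x. (g x)\<^sup>2) integrable_on {0..1} \<longleftrightarrow> integrable I01 (\<lambda>x. (g x)\<^sup>2)"
    using absolutely_integrable_on_iff_nonneg[of "{0..1}" "\<lambda>x. (g x)\<^sup>2"]
      absolutely_integrable_imp_integrable[where S="{0..1}" and f="\<lambda>x. (g x)\<^sup>2"]
      integrable_on_lebesgue_on[where S="{0..1}" and f="\<lambda>x. (g x)\<^sup>2"] by auto
  then show ?thesis
    unfolding sq_int_def by (simp add: measurable_on_iff_borel_measurable)
qed

lemma sq_int_measurable [measurable_dest]: "sq_int g \<Longrightarrow> g \<in> borel_measurable I01"
  by (simp add: sq_int_iff)

lemma sq_int_integrable_sq: "sq_int g \<Longrightarrow> integrable I01 (\<lambda>x. (g x)\<^sup>2)"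
  by (simp add: sq_int_iff)

text \<open>Unconditional, because the integral of a non-integrable function defaults to 0.\<close>

lemma L2norm_nonneg [simp]: "0 \<le> L2norm v"
  unfolding L2norm_def
  by (cases "(\<lambda>x. (v x)\<^sup>2) integrable_on {0..1}")
     (auto intro!: Henstock_Kurzweil_Integration.integral_nonneg simp: not_integrable_integral)

lemma integral_I01_eq: "integrable I01 f \<Longrightarrow> integral {0..1} f = (LINT x|I01. f x)" for f :: "real \<Rightarrow> real"
  by (simp add: lebesgue_integral_eq_integral)

lemma L2norm_sq: "sq_int v \<Longrightarrow> (L2norm v)\<^sup>2 = (LINT x|I01. (v x)\<^sup>2)"
  unfolding L2norm_def
  by (simp add: integral_I01_eq[OF sq_int_integrable_sq] sq_int_integrable_sq)

lemma integrable_sq_int_mult: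
  assumes "sq_int f" "sq_int g"
  shows "integrable I01 (\<lambda>x. f x * g x)"
proof (rule Bochner_Integration.integrable_bound)
  show "integrable I01 (\<lambda>x. (f x)\<^sup>2 + (g x)\<^sup>2)"
    by (intro Bochner_Integration.integrable_add sq_int_integrable_sq assms)
  note [measurable] = assms[THEN sq_int_measurable]
  show "(\<lambda>x. f x * g x) \<in> borel_measurable I01" by measurable
  have "\<bar>f x * g x\<bar> \<le> \<bar>(f x)\<^sup>2 + (g x)\<^sup>2\<bar>" for x
  proof -
    have "2 * (\<bar>f x\<bar> * \<bar>g x\<bar>) \<le> (f x)\<^sup>2 + (g x)\<^sup>2"
      using sum_squares_bound[of "\<bar>f x\<bar>" "\<bar>g x\<bar>"] by (simp add: mult.assoc)
    moreover have "0 \<le> \<bar>f x\<bar> * \<bar>g x\<bar>" by simp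
    ultimately have "\<bar>f x\<bar> * \<bar>g x\<bar> \<le> (f x)\<^sup>2 + (g x)\<^sup>2" by linarith
    then show ?thesis by (simp add: abs_mult)
  qed
  then show "AE x in I01. norm (f x * g x) \<le> norm ((f x)\<^sup>2 + (g x)\<^sup>2)" by simp
qed

lemma sq_int_scale: "sq_int f \<Longrightarrow> sq_int (\<lambda>x. c * f x)"
  unfolding sq_int_iff by (auto simp: power_mult_distrib)

lemma sq_int_add:
  assumes "sq_int f" "sq_int g"
  shows "sq_int (\<lambda>x. f x + g x)"
proof -
  note [measurable] = assms[THEN sq_int_measurable]
  have "integrable I01 (\<lambda>x. (f x)\<^sup>2 + (g x)\<^sup>2 + 2 * (f x * g x))"
    by (intro Bochner_Integration.integrable_add integrable_mult_right integrable_sq_int_mult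
        sq_int_integrable_sq assms)
  then show ?thesis
    unfolding sq_int_iff by (simp add: power2_sum mult.assoc)
qed

lemma sq_int_diff: "sq_int f \<Longrightarrow> sq_int g \<Longrightarrow> sq_int (\<lambda>x. f x - g x)"
  using sq_int_add[of f "\<lambda>x. -1 * g x"] sq_int_scale[of g "-1"] by simp

lemma sq_int_zero [simp]: "sq_int (\<lambda>x. 0)"
  by (simp add: sq_int_iff)

lemma sq_int_sum: "finite A \<Longrightarrow> (\<And>i. i \<in> A \<Longrightarrow> sq_int (f i)) \<Longrightarrow> sq_int (\<lambda>x. \<Sum>i\<in>A. f i x)"
  by (induction A rule: finite_induct) (auto intro!: sq_int_add)

lemma continuous_borel_measurable_I01:
  "continuous_on {0..1} h \<Longrightarrow> h \<in> borel_measurable I01" for h :: "real \<Rightarrow> real"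
  by (rule continuous_imp_measurable_on_sets_lebesgue) auto

lemma sq_int_continuous: "continuous_on {0..1} g \<Longrightarrow> sq_int g"
  unfolding sq_int_iff
  by (intro conjI continuous_borel_measurable_I01 continuous_imp_integrable_real continuous_on_power)

lemma sq_int_mult_bounded:
  assumes "sq_int g" and [measurable]: "h \<in> borel_measurable I01" and "\<And>x. x \<in> {0..1} \<Longrightarrow> \<bar>h x\<bar> \<le> B"
  shows "sq_int (\<lambda>x. h x * g x)"
proof -
  note [measurable] = assms(1)[THEN sq_int_measurable]
  have "integrable I01 (\<lambda>x. (h x * g x)\<^sup>2)"
  proof (rule Bochner_Integration.integrable_bound)
    show "integrable I01 (\<lambda>x. B\<^sup>2 * (g x)\<^sup>2)"
      by (intro integrable_mult_right sq_int_integrable_sq assms)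
    have "(h x * g x)\<^sup>2 \<le> B\<^sup>2 * (g x)\<^sup>2" if "x \<in> {0..1}" for x
      unfolding power_mult_distrib
      using power_mono[OF assms(3)[OF that] abs_ge_zero, of 2] by (intro mult_right_mono) auto
    then show "AE x in I01. norm ((h x * g x)\<^sup>2) \<le> norm (B\<^sup>2 * (g x)\<^sup>2)"
      by (intro AE_I01I) simp
  qed measurable
  then show ?thesis unfolding sq_int_iff by simp
qed

lemma sq_int_mult_continuous:
  assumes "sq_int g" "continuous_on {0..1} h"
  shows "sq_int (\<lambda>x. h x * g x)"
proof -
  have "bounded (h ` {0..1})"
    using compact_continuous_image[OF assms(2)] compact_imp_bounded by blast
  then obtain B where "\<And>x. x \<in> {0..1} \<Longrightarrow> \<bar>h x\<bar> \<le> B" unfolding bounded_iff by (metis image_eqI real_norm_def)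
  then show ?thesis
    using assms continuous_borel_measurable_I01 sq_int_mult_bounded by blast
qed

lemma sq_int_integrable: "sq_int f \<Longrightarrow> integrable I01 f"
  using integrable_sq_int_mult[of f "\<lambda>_. 1"] sq_int_continuous[of "\<lambda>_. 1"] by simp

lemma L2norm_cong_AE:
  assumes "sq_int f" "sq_int g" "AE x in I01. f x = g x"
  shows "L2norm f = L2norm g"
proof -
  note [measurable] = assms(1,2)[THEN sq_int_measurable]
  have "(LINT x|I01. (f x)\<^sup>2) = (LINT x|I01. (g x)\<^sup>2)"
    using assms(3) by (intro integral_cong_AE) auto
  then have "(L2norm f)\<^sup>2 = (L2norm g)\<^sup>2" by (simp add: L2norm_sq assms)
  then show ?thesis by simp
qed

lemma L2norm_cong: "(\<And>x. x \<in> {0..1} \<Longrightarrow> f x = g x) \<Longrightarrow> L2norm f = L2norm g"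
  unfolding L2norm_def by (auto intro!: arg_cong[where f=sqrt] integral_cong)

lemma L2norm_scale: "L2norm (\<lambda>x. c * f x) = \<bar>c\<bar> * L2norm f"
  unfolding L2norm_def power_mult_distrib by (simp add: real_sqrt_mult)

text \<open>Nonnegativity of the quadratic form (s, t) -> ||s f + t g||^2.\<close>

lemma L2_Cauchy_Schwarz:
  assumes "sq_int f" "sq_int g"
  shows "\<bar>LINT x|I01. f x * g x\<bar> \<le> L2norm f * L2norm g"
proof -
  let ?a = "(L2norm f)\<^sup>2" and ?b = "(L2norm g)\<^sup>2" and ?c = "LINT x|I01. f x * g x"
  have *: "0 \<le> s\<^sup>2 * ?a + 2 * s * t * ?c + t\<^sup>2 * ?b" for s t
  proof -
    have "0 \<le> (LINT x|I01. (s * f x + t * g x)\<^sup>2)" by simp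
    also have "\<dots> = (LINT x|I01. s\<^sup>2 * (f x)\<^sup>2 + (2 * s * t) * (f x * g x) + t\<^sup>2 * (g x)\<^sup>2)"
      by (simp add: power2_sum power_mult_distrib algebra_simps)
    also have "\<dots> = s\<^sup>2 * ?a + 2 * s * t * ?c + t\<^sup>2 * ?b"
      using assms by (simp add: integrable_sq_int_mult sq_int_integrable_sq L2norm_sq)
    finally show ?thesis .
  qed
  have "?c\<^sup>2 \<le> ?a * ?b"
  proof (cases "?a = 0")
    case True
    then have **: "0 \<le> 2 * s * ?c + ?b" for s using *[of s 1] by simp
    have "?c = 0"
    proof (rule ccontr)
      assume "?c \<noteq> 0"
      \<comment> \<open>This \<open>s\<close> drives \<open>2 * s * ?c + ?b\<close> down to -1; an
        affine function of \<open>s\<close> that is bounded below must be constant.\<close>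
      then have "2 * (- (?b + 1) / (2 * ?c)) * ?c = - (?b + 1)" by (simp add: field_simps)
      then show False using **[of "- (?b + 1) / (2 * ?c)"] by linarith
    qed
    then show ?thesis by simp
  next
    case False
    \<comment> \<open>With s = \<open>?c\<close> and t = \<open>- ?a\<close> the form acquires the
      factor \<open>?a\<close>, which is positive here and can be cancelled.\<close>
    have "0 \<le> ?c\<^sup>2 * ?a + 2 * ?c * (- ?a) * ?c + (- ?a)\<^sup>2 * ?b" by (rule *)
    also have "\<dots> = ?a * (?a * ?b - ?c\<^sup>2)" by (simp add: power2_eq_square algebra_simps)
    finally show ?thesis using False
      by (simp add: zero_le_mult_iff)
  qed
  then have "?c\<^sup>2 \<le> (L2norm f * L2norm g)\<^sup>2" by (simp add: power_mult_distrib)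
  then show ?thesis by (simp add: power2_le_iff_abs_le)
qed

lemma L2norm_triangle:
  assumes "sq_int f" "sq_int g"
  shows "L2norm (\<lambda>x. f x + g x) \<le> L2norm f + L2norm g"
proof -
  have "(L2norm (\<lambda>x. f x + g x))\<^sup>2 = (LINT x|I01. (f x)\<^sup>2 + 2 * (f x * g x) + (g x)\<^sup>2)"
    using assms by (simp add: L2norm_sq sq_int_add power2_sum algebra_simps)
  also have "\<dots> = (L2norm f)\<^sup>2 + 2 * (LINT x|I01. f x * g x) + (L2norm g)\<^sup>2"
    using assms by (simp add: integrable_sq_int_mult sq_int_integrable_sq L2norm_sq)
  also have "\<dots> \<le> (L2norm f + L2norm g)\<^sup>2"
    using L2_Cauchy_Schwarz[OF assms] by (simp add: power2_sum)
  finally show ?thesis by (rule power2_le_imp_le) simp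
qed

lemma L2norm_triangle_diff:
  assumes "sq_int f" "sq_int g"
  shows "L2norm (\<lambda>x. f x - g x) \<le> L2norm f + L2norm g"
  using L2norm_triangle[OF assms(1) sq_int_scale[OF assms(2), of "-1"]] L2norm_scale[of "-1" g] by simp

lemma L2norm_mono:
  assumes "sq_int f" "sq_int g" "\<And>x. x \<in> {0..1} \<Longrightarrow> \<bar>f x\<bar> \<le> \<bar>g x\<bar>"
  shows "L2norm f \<le> L2norm g"
proof -
  have "(LINT x|I01. (f x)\<^sup>2) \<le> (LINT x|I01. (g x)\<^sup>2)"
    using assms by (intro integral_mono sq_int_integrable_sq) (auto simp: abs_le_square_iff)
  then have "(L2norm f)\<^sup>2 \<le> (L2norm g)\<^sup>2" using assms by (simp add: L2norm_sq)
  then show ?thesis by (rule power2_le_imp_le) simp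
qed

lemma L2norm_mult_bounded:
  assumes "sq_int g" "sq_int (\<lambda>x. h x * g x)" "\<And>x. x \<in> {0..1} \<Longrightarrow> \<bar>h x\<bar> \<le> B" "0 \<le> B"
  shows "L2norm (\<lambda>x. h x * g x) \<le> B * L2norm g"
proof -
  have "L2norm (\<lambda>x. h x * g x) \<le> L2norm (\<lambda>x. B * g x)"
    using assms by (intro L2norm_mono sq_int_scale) (auto simp: abs_mult intro!: mult_mono)
  then show ?thesis using assms(4) by (simp add: L2norm_scale)
qed

lemma L2norm_const: "L2norm (\<lambda>x. c) = \<bar>c\<bar>"
  unfolding L2norm_def by simp

lemma L2norm_bounded:
  assumes "sq_int g" "\<And>x. x \<in> {0..1} \<Longrightarrow> \<bar>g x\<bar> \<le> B"
  shows "L2norm g \<le> B"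
proof -
  have "\<bar>g 0\<bar> \<le> B" using assms(2)[of 0] by simp
  then have "0 \<le> B" by linarith
  have "L2norm g \<le> L2norm (\<lambda>x. B)"
    using assms \<open>0 \<le> B\<close> sq_int_continuous[of "\<lambda>_. B"] by (intro L2norm_mono) auto
  then show ?thesis using \<open>0 \<le> B\<close> by (simp add: L2norm_const)
qed

lemma integral_abs_le_L2norm:
  assumes "sq_int g"
  shows "(LINT x|I01. \<bar>g x\<bar>) \<le> L2norm g"
proof -
  have a: "sq_int (\<lambda>x. \<bar>g x\<bar>)" using assms unfolding sq_int_iff by auto
  have "(LINT x|I01. \<bar>g x\<bar>) \<le> \<bar>LINT x|I01. \<bar>g x\<bar> * 1\<bar>" by simp
  also have "\<dots> \<le> L2norm (\<lambda>x. \<bar>g x\<bar>) * L2norm (\<lambda>x. 1)"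
    by (intro L2_Cauchy_Schwarz a sq_int_continuous) simp
  finally show ?thesis by (simp add: L2norm_const L2norm_def)
qed

lemma sq_int_abs_integrable: "sq_int g \<Longrightarrow> g absolutely_integrable_on {0..1}"
  using sq_int_integrable[of g] sq_int_measurable[of g]
  by (simp add: absolutely_integrable_measurable_real)

lemma sq_int_integrable_on:
  assumes "sq_int g" "{a..b} \<subseteq> {0..1}"
  shows "g integrable_on {a..b}" "(\<lambda>x. \<bar>g x\<bar>) integrable_on {a..b}"
proof -
  have "g absolutely_integrable_on {0..1}" by (rule sq_int_abs_integrable[OF assms(1)])
  then have "g absolutely_integrable_on {a..b}"
    using assms(2) by (rule absolutely_integrable_on_subinterval)
  then show "g integrable_on {a..b}" "(\<lambda>x. \<bar>g x\<bar>) integrable_on {a..b}"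
    by (auto simp: absolutely_integrable_on_def)
qed

lemma abs_integral_le_L2norm:
  assumes "sq_int g" "{a..b} \<subseteq> {0..1}"
  shows "\<bar>integral {a..b} g\<bar> \<le> L2norm g"
proof -
  have "\<bar>integral {a..b} g\<bar> \<le> integral {a..b} (\<lambda>x. \<bar>g x\<bar>)"
    using integral_norm_bound_integral[of g "{a..b}" "\<lambda>x. \<bar>g x\<bar>"] sq_int_integrable_on[OF assms] by simp
  also have "\<dots> \<le> integral {0..1} (\<lambda>x. \<bar>g x\<bar>)"
    using sq_int_integrable_on[OF assms] sq_int_integrable_on(2)[OF assms(1), of 0 1] assms(2)
    by (intro integral_subset_le) auto
  also have "\<dots> = (LINT x|I01. \<bar>g x\<bar>)"
    by (intro integral_I01_eq integrable_abs sq_int_integrable assms)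
  also have "\<dots> \<le> L2norm g" by (rule integral_abs_le_L2norm[OF assms(1)])
  finally show ?thesis .
qed

text \<open>Riesz-Fischer: a subsequence whose increments have norm at most 2^-j converges
  absolutely almost everywhere, and Fatou's lemma makes its pointwise limit the norm limit of the
  whole sequence.\<close>

theorem L2_complete:
  assumes g: "\<And>n. sq_int (g n)"
    and C: "\<And>e. e > 0 \<Longrightarrow> \<exists>N::nat. \<forall>m\<ge>N. \<forall>n\<ge>N. L2norm (\<lambda>x. g m x - g n x) \<le> e"
  shows "\<exists>h. sq_int h \<and> (\<lambda>n. L2norm (\<lambda>x. g n x - h x)) \<longlonglongrightarrow> 0"
proof -
  note [measurable] = g[THEN sq_int_measurable]
  obtain N where N: "\<And>j m n. m \<ge> N j \<Longrightarrow> n \<ge> N j \<Longrightarrow> L2norm (\<lambda>x. g m x - g n x) \<le> (1/2)^j"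
    using C[of "(1/2)^j" for j] by (metis zero_less_divide_1_iff zero_less_numeral zero_less_power)
  \<comment> \<open>Cumulative sums dominate every \<open>N j\<close> and are monotone in
    \<open>j\<close>.\<close>
  define r where "r j = (\<Sum>i\<le>j. N i)" for j
  have r_ge: "N j \<le> r j" for j unfolding r_def by (rule member_le_sum) auto
  have r_Suc: "r j \<le> r (Suc j)" for j by (simp add: r_def)
  have r_mono: "i \<le> j \<Longrightarrow> r i \<le> r j" for i j using lift_Suc_mono_le[of r i j] r_Suc by blast
  define d where "d j x = \<bar>g (r (Suc j)) x - g (r j) x\<bar>" for j x
  have [measurable]: "d j \<in> borel_measurable I01" for j unfolding d_def by measurable
  have d_int: "integrable I01 (d j)" for j
    unfolding d_def by (intro integrable_abs sq_int_integrable sq_int_diff g)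
  have d_le: "(LINT x|I01. d j x) \<le> (1/2)^j" for j
    unfolding d_def
    by (rule order_trans[OF integral_abs_le_L2norm[OF sq_int_diff[OF g g]] N])
       (use r_ge[of j] r_Suc[of j] in linarith)+
  have "(\<integral>\<^sup>+x. (\<Sum>j. ennreal (d j x)) \<partial>I01) = (\<Sum>j. \<integral>\<^sup>+x. ennreal (d j x) \<partial>I01)"
    by (rule nn_integral_suminf) simp
  also have "\<dots> \<le> (\<Sum>j. ennreal ((1/2)^j))"
  proof (intro suminf_le allI summableI)
    fix j
    have "(\<integral>\<^sup>+x. ennreal (d j x) \<partial>I01) = ennreal (LINT x|I01. d j x)"
      by (rule nn_integral_eq_integral[OF d_int]) (simp add: d_def)
    then show "(\<integral>\<^sup>+x. ennreal (d j x) \<partial>I01) \<le> ennreal ((1/2)^j)"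
      using d_le[of j] by (simp only: ennreal_leI)
  qed
  also have "\<dots> = ennreal (\<Sum>j. (1/2)^j)"
    by (rule suminf_ennreal2) (auto intro: summable_geometric)
  finally have fin: "(\<integral>\<^sup>+x. (\<Sum>j. ennreal (d j x)) \<partial>I01) \<noteq> \<infinity>"
    using order_le_less_trans[OF _ ennreal_less_top] by (metis infinity_ennreal_def less_irrefl)
  have "AE x in I01. (\<Sum>j. ennreal (d j x)) \<noteq> \<infinity>"
    by (rule nn_integral_PInf_AE[OF _ fin]) measurable
  then have conv: "AE x in I01. convergent (\<lambda>j. g (r j) x)"
  proof eventually_elim
    case (elim x)
    have "summable (\<lambda>j. d j x)"
      by (rule summable_suminf_not_top) (use elim in \<open>auto simp: d_def\<close>)
    then have "summable (\<lambda>j. g (r (Suc j)) x - g (r j) x)"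
      unfolding d_def by (rule summable_rabs_cancel)
    then have "convergent (\<lambda>n. g (r n) x - g (r 0) x)"
      unfolding summable_iff_convergent sum_lessThan_telescope[of "\<lambda>j. g (r j) x"] .
    then show ?case by (simp add: convergent_diff_const_right_iff)
  qed
  define h where "h x = lim (\<lambda>j. g (r j) x)" for x
  have [measurable]: "h \<in> borel_measurable I01" unfolding h_def by measurable
  have lim: "AE x in I01. (\<lambda>j. g (r j) x) \<longlonglongrightarrow> h x"
    using conv by eventually_elim (simp add: h_def convergent_LIMSEQ_iff)
  \<comment> \<open>The index \<open>n\<close> stays fixed while \<open>j\<close> tends to infinity
    along the subsequence; Fatou bounds the distance from \<open>g n\<close> to \<open>h\<close> by
    the limsup of the distances to \<open>g (r j)\<close>.\<close>
  have nn: "(\<integral>\<^sup>+x. ennreal ((g n x - h x)\<^sup>2) \<partial>I01) \<le> ennreal (((1/2)^i)\<^sup>2)" if n: "n \<ge> r i" for n i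
  proof -
    have "(\<integral>\<^sup>+x. ennreal ((g n x - h x)\<^sup>2) \<partial>I01)
        = (\<integral>\<^sup>+x. liminf (\<lambda>j. ennreal ((g n x - g (r j) x)\<^sup>2)) \<partial>I01)"
    proof (rule nn_integral_cong_AE, use lim in eventually_elim)
      case (elim x)
      then have "(\<lambda>j. ennreal ((g n x - g (r j) x)\<^sup>2)) \<longlonglongrightarrow> ennreal ((g n x - h x)\<^sup>2)"
        by (intro tendsto_intros)
      then show ?case using lim_imp_Liminf[OF sequentially_bot] by metis
    qed
    also have "\<dots> \<le> liminf (\<lambda>j. \<integral>\<^sup>+x. ennreal ((g n x - g (r j) x)\<^sup>2) \<partial>I01)"
      by (rule nn_integral_liminf) measurable
    also have "\<dots> \<le> limsup (\<lambda>j. \<integral>\<^sup>+x. ennreal ((g n x - g (r j) x)\<^sup>2) \<partial>I01)"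
      by (rule Liminf_le_Limsup) simp
    also have "\<dots> \<le> ennreal (((1/2)^i)\<^sup>2)"
    proof (rule Limsup_bounded, rule eventually_sequentiallyI[of i])
      fix j assume "i \<le> j"
      have "(\<integral>\<^sup>+x. ennreal ((g n x - g (r j) x)\<^sup>2) \<partial>I01) = ennreal ((L2norm (\<lambda>x. g n x - g (r j) x))\<^sup>2)"
        by (simp add: L2norm_sq sq_int_diff g nn_integral_eq_integral sq_int_integrable_sq)
      also have "\<dots> \<le> ennreal (((1/2)^i)\<^sup>2)"
        using n r_ge[of i] r_mono[OF \<open>i \<le> j\<close>]
        by (intro ennreal_leI power_mono N L2norm_nonneg) auto
      finally show "(\<integral>\<^sup>+x. ennreal ((g n x - g (r j) x)\<^sup>2) \<partial>I01) \<le> ennreal (((1/2)^i)\<^sup>2)" .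
    qed
    finally show ?thesis .
  qed
  have sqd: "sq_int (\<lambda>x. g n x - h x)" if "n \<ge> r i" for n i
    unfolding sq_int_iff
  proof
    show "integrable I01 (\<lambda>x. (g n x - h x)\<^sup>2)"
      by (rule integrableI_bounded)
         (use order_le_less_trans[OF nn[OF that] ennreal_less_top] in auto)
  qed measurable
  have nrm: "L2norm (\<lambda>x. g n x - h x) \<le> (1/2)^i" if "n \<ge> r i" for n i
  proof -
    have "ennreal ((L2norm (\<lambda>x. g n x - h x))\<^sup>2) \<le> ennreal (((1/2)^i)\<^sup>2)"
      using nn[OF that] sqd[OF that]
      by (simp add: L2norm_sq nn_integral_eq_integral sq_int_integrable_sq)
    then have "(L2norm (\<lambda>x. g n x - h x))\<^sup>2 \<le> ((1/2)^i)\<^sup>2" by (simp add: ennreal_le_iff)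
    then show ?thesis by (rule power2_le_imp_le) simp
  qed
  have "sq_int h"
    using sq_int_diff[OF g[of "r 0"] sqd[of 0 "r 0"]] by simp
  moreover have "(\<lambda>n. L2norm (\<lambda>x. g n x - h x)) \<longlonglongrightarrow> 0"
  proof (rule metric_LIMSEQ_I)
    fix e :: real assume "0 < e"
    then obtain i where i: "(1/2::real)^i < e" using real_arch_pow_inv[of e "1/2"] by auto
    have "dist (L2norm (\<lambda>x. g n x - h x)) 0 < e" if "n \<ge> r i" for n
      using nrm[OF that] i by simp
    then show "\<exists>no. \<forall>n\<ge>no. dist (L2norm (\<lambda>x. g n x - h x)) 0 < e" by blast
  qed
  ultimately show ?thesis by blast
qed

text \<open>Integration by parts against an indefinite integral: on \<open>{a..b}\<close> the defect is at most
  \<open>2B (b - a)\<close> times the increment of the integral of \<open>\<bar>g\<bar>\<close>, so its derivative vanishes.\<close>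

theorem integral_by_parts_indefinite:
  fixes p p' g :: "real \<Rightarrow> real"
  assumes g: "sq_int g"
    and p: "\<And>x. x \<in> {0..1} \<Longrightarrow> (p has_real_derivative p' x) (at x within {0..1})"
    and p': "continuous_on {0..1} p'"
  shows "integral {0..1} (\<lambda>x. p' x * integral {0..x} g + p x * g x) = p 1 * integral {0..1} g"
proof -
  have gi: "g integrable_on {a..b}" "(\<lambda>x. \<bar>g x\<bar>) integrable_on {a..b}" if "0 \<le> a" "b \<le> 1" for a b
    using sq_int_integrable_on[OF g] that by auto
  define U where "U x = integral {0..x} g" for x
  define A where "A x = integral {0..x} (\<lambda>x. \<bar>g x\<bar>)" for x
  have contU: "continuous_on {0..1} U" and contA: "continuous_on {0..1} A"
    unfolding U_def A_def by (intro indefinite_integral_continuous_1 gi; simp)+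
  have contp: "continuous_on {0..1} p"
    by (rule DERIV_continuous_on[OF p])
  obtain B where B: "\<And>x. x \<in> {0..1} \<Longrightarrow> \<bar>p' x\<bar> \<le> B"
    using compact_imp_bounded[OF compact_continuous_image[OF p']] unfolding bounded_iff
    by (metis compact_Icc image_eqI real_norm_def)
  have "\<bar>p' 0\<bar> \<le> B" using B by simp
  then have B0: "0 \<le> B" by linarith
  have pint: "(\<lambda>x. p x * g x) integrable_on {a..b}" if "0 \<le> a" "b \<le> 1" for a b
    using sq_int_integrable_on[OF sq_int_mult_continuous[OF g contp]] that by auto
  have p'U: "(\<lambda>x. p' x * U x) integrable_on {a..b}" if "0 \<le> a" "b \<le> 1" for a b
    by (intro integrable_continuous_real continuous_on_mult continuous_on_subset[OF p']
        continuous_on_subset[OF contU]) (use that in auto)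
  define K where "K x = integral {0..x} (\<lambda>x. p' x * U x + p x * g x)" for x
  have inc: "\<bar>(p b * U b - K b) - (p a * U a - K a)\<bar> \<le> 2 * B * (b - a) * (A b - A a)"
    if ab: "0 \<le> a" "a \<le> b" "b \<le> 1" for a b
  proof -
    have sub: "{a..b} \<subseteq> {0..1}" using ab by auto
    have Udiff: "U x - U a = integral {a..x} g" if "a \<le> x" "x \<le> b" for x
      unfolding U_def using Henstock_Kurzweil_Integration.integral_combine[of 0 a x g] gi[of 0 x] that ab by auto
    have Ubd: "\<bar>U b - U x\<bar> \<le> A b - A a" if x: "x \<in> {a..b}" for x
    proof -
      have "U b - U x = integral {x..b} g"
        unfolding U_def using Henstock_Kurzweil_Integration.integral_combine[of 0 x b g] gi[of 0 b] x ab by auto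
      also have "\<bar>\<dots>\<bar> \<le> integral {x..b} (\<lambda>x. \<bar>g x\<bar>)"
        using integral_norm_bound_integral[of g "{x..b}" "\<lambda>x. \<bar>g x\<bar>"] gi[of x b] x ab by auto
      also have "\<dots> \<le> integral {a..b} (\<lambda>x. \<bar>g x\<bar>)"
        using x ab by (intro integral_subset_le gi) auto
      also have "\<dots> = A b - A a"
        unfolding A_def using Henstock_Kurzweil_Integration.integral_combine[of 0 a b "\<lambda>x. \<bar>g x\<bar>"] gi[of 0 b] ab by auto
      finally show ?thesis .
    qed
    have pab: "(p' has_integral (p b - p a)) {a..b}"
      using ab DERIV_subset[OF p sub] sub
      by (intro fundamental_theorem_of_calculus)
         (auto simp: has_real_derivative_iff_has_vector_derivative[symmetric])
    have plip: "\<bar>p a - p x\<bar> \<le> B * (b - a)" if x: "x \<in> {a..b}" for x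
    proof -
      have "\<bar>p x - p a\<bar> \<le> B * \<bar>x - a\<bar>"
        using field_differentiable_bound[of "{0..1}" p p' B x a] p B x sub ab by auto
      also have "\<dots> \<le> B * (b - a)" using x B0 by (intro mult_left_mono) auto
      finally show ?thesis by (simp add: abs_minus_commute)
    qed
    have Kd: "K b - K a = integral {a..b} (\<lambda>x. p' x * U x + p x * g x)"
      unfolding K_def
      using Henstock_Kurzweil_Integration.integral_combine[of 0 a b "\<lambda>x. p' x * U x + p x * g x"]
        Henstock_Kurzweil_Integration.integrable_add[OF p'U[of 0 b] pint[of 0 b]] ab by auto
    \<comment> \<open>Freezing \<open>U\<close> at \<open>b\<close> and \<open>p\<close> at
      \<open>a\<close> gives an integrand whose integral is exactly the increment of
      \<open>p * U\<close>; what is left is the error of the freezing.\<close>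
    have i1: "((\<lambda>x. p' x * U b + p a * g x) has_integral ((p b - p a) * U b + p a * (U b - U a))) {a..b}"
      using Udiff[of b] gi[of a b] ab
      by (intro has_integral_add has_integral_mult_left has_integral_mult_right pab)
         (auto simp: has_integral_integrable_integral)
    have i2: "(\<lambda>x. p' x * U x + p x * g x) integrable_on {a..b}"
      using ab by (intro Henstock_Kurzweil_Integration.integrable_add p'U pint) auto
    have e1: "(p b * U b - K b) - (p a * U a - K a) = ((p b - p a) * U b + p a * (U b - U a)) - (K b - K a)"
      by (simp add: algebra_simps)
    have e2: "\<dots> = integral {a..b} (\<lambda>x. (p' x * U b + p a * g x) - (p' x * U x + p x * g x))"
      using Henstock_Kurzweil_Integration.integral_diff[OF has_integral_integrable[OF i1] i2]
      unfolding Kd integral_unique[OF i1] by simp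
    have "\<bar>(p b * U b - K b) - (p a * U a - K a)\<bar> \<le> integral {a..b} (\<lambda>x. B * (A b - A a) + B * (b - a) * \<bar>g x\<bar>)"
    proof -
      have "norm (integral {a..b} (\<lambda>x. (p' x * U b + p a * g x) - (p' x * U x + p x * g x)))
         \<le> integral {a..b} (\<lambda>x. B * (A b - A a) + B * (b - a) * \<bar>g x\<bar>)"
      proof (rule integral_norm_bound_integral)
        show "(\<lambda>x. (p' x * U b + p a * g x) - (p' x * U x + p x * g x)) integrable_on {a..b}"
          by (intro Henstock_Kurzweil_Integration.integrable_diff has_integral_integrable[OF i1] i2)
        show "(\<lambda>x. B * (A b - A a) + B * (b - a) * \<bar>g x\<bar>) integrable_on {a..b}"
          using gi[of a b] ab
          by (intro Henstock_Kurzweil_Integration.integrable_add integrable_on_mult_right) auto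
        fix x assume x: "x \<in> {a..b}"
        have "(p' x * U b + p a * g x) - (p' x * U x + p x * g x) = p' x * (U b - U x) + (p a - p x) * g x"
          by (simp add: algebra_simps)
        also have "\<bar>\<dots>\<bar> \<le> \<bar>p' x\<bar> * \<bar>U b - U x\<bar> + \<bar>p a - p x\<bar> * \<bar>g x\<bar>"
          using abs_triangle_ineq[of "p' x * (U b - U x)" "(p a - p x) * g x"] by (simp add: abs_mult)
        also have "\<dots> \<le> B * (A b - A a) + B * (b - a) * \<bar>g x\<bar>"
        proof (rule add_mono)
          have "x \<in> {0..1}" using x sub by auto
          then show "\<bar>p' x\<bar> * \<bar>U b - U x\<bar> \<le> B * (A b - A a)"
            by (intro mult_mono B Ubd x B0) auto
          show "\<bar>p a - p x\<bar> * \<bar>g x\<bar> \<le> B * (b - a) * \<bar>g x\<bar>"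
            by (intro mult_right_mono plip x) simp
        qed
        finally show "norm ((p' x * U b + p a * g x) - (p' x * U x + p x * g x)) \<le> B * (A b - A a) + B * (b - a) * \<bar>g x\<bar>"
          by simp
      qed
      then show ?thesis unfolding e1 e2 by simp
    qed
    also have "\<dots> = B * (A b - A a) * (b - a) + B * (b - a) * integral {a..b} (\<lambda>x. \<bar>g x\<bar>)"
    proof (rule integral_unique)
      have "((\<lambda>x. B * (A b - A a) + B * (b - a) * \<bar>g x\<bar>) has_integral
          (b - a) *\<^sub>R (B * (A b - A a)) + B * (b - a) * integral {a..b} (\<lambda>x. \<bar>g x\<bar>)) {a..b}"
        using has_integral_const_real[of "B * (A b - A a)" a b] ab
        by (intro has_integral_add has_integral_mult_right integrable_integral gi) auto
      then show "((\<lambda>x. B * (A b - A a) + B * (b - a) * \<bar>g x\<bar>) has_integral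
          B * (A b - A a) * (b - a) + B * (b - a) * integral {a..b} (\<lambda>x. \<bar>g x\<bar>)) {a..b}"
        by (simp add: mult.commute)
    qed
    also have "integral {a..b} (\<lambda>x. \<bar>g x\<bar>) = A b - A a"
      unfolding A_def using Henstock_Kurzweil_Integration.integral_combine[of 0 a b "\<lambda>x. \<bar>g x\<bar>"] gi[of 0 b] ab by auto
    finally show ?thesis by (simp add: algebra_simps)
  qed
  define Z where "Z x = p x * U x - K x" for x
  have "(Z has_real_derivative 0) (at x within {0..1})" if x: "x \<in> {0..1}" for x
  proof -
    have "((\<lambda>y. 2 * B * \<bar>A y - A x\<bar>) \<longlongrightarrow> 2 * B * \<bar>A x - A x\<bar>) (at x within {0..1})"
      using contA x by (intro tendsto_intros) (auto simp: continuous_on_def)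
    then have lim: "((\<lambda>y. 2 * B * \<bar>A y - A x\<bar>) \<longlongrightarrow> 0) (at x within {0..1})" by simp
    have "((\<lambda>y. (Z y - Z x) / (y - x)) \<longlongrightarrow> 0) (at x within {0..1})"
    proof (rule Lim_null_comparison[OF _ lim])
      have "norm ((Z y - Z x) / (y - x)) \<le> 2 * B * \<bar>A y - A x\<bar>" if y: "y \<in> {0..1}" "y \<noteq> x" for y
      proof -
        have "\<bar>Z y - Z x\<bar> \<le> 2 * B * \<bar>y - x\<bar> * \<bar>A y - A x\<bar>"
        proof (cases "x \<le> y")
          case True
          have "2 * B * (y - x) * (A y - A x) \<le> 2 * B * (y - x) * \<bar>A y - A x\<bar>"
            using B0 True by (intro mult_left_mono) auto
          then show ?thesis using inc[of x y] x y True by (simp add: Z_def)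
        next
          case False
          have "2 * B * (x - y) * (A x - A y) \<le> 2 * B * (x - y) * \<bar>A y - A x\<bar>"
            using B0 False by (intro mult_left_mono) auto
          then show ?thesis using inc[of y x] x y False by (simp add: Z_def)
        qed
        then show ?thesis using y by (simp add: divide_le_eq mult_ac)
      qed
      then show "\<forall>\<^sub>F y in at x within {0..1}. norm ((Z y - Z x) / (y - x)) \<le> 2 * B * \<bar>A y - A x\<bar>"
        by (simp add: eventually_at_filter)
    qed
    then show ?thesis by (simp add: has_field_derivative_iff)
  qed
  then have "\<exists>c. \<forall>x\<in>{0..1}. Z x = c"
    by (intro has_field_derivative_zero_constant) auto
  then have "Z 1 = Z 0" by auto
  moreover have "U 0 = 0" "K 0 = 0" by (simp_all add: U_def K_def)
  ultimately have "K 1 = p 1 * U 1" by (simp add: Z_def)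
  then show ?thesis unfolding K_def U_def .
qed

text \<open>The integrals over all half-lines vanish, so the measures with densities the positive
  and the negative part of g agree on a generator of the Borel sets. Uniqueness of densities makes
  the two parts equal a.e., and since one of them is always 0, both vanish.\<close>

lemma AE_zero_if_indefinite_integral_zero:
  assumes g: "sq_int g" and z: "\<And>x. x \<in> {0..1} \<Longrightarrow> integral {0..x} g = 0"
  shows "AE x in I01. g x = 0"
proof -
  define h where "h x = indicator {0..1} x * g x" for x :: real
  have hi: "integrable lebesgue h"
    using sq_int_integrable[OF g] unfolding h_def by (simp add: integrable_restrict_space)
  then have hm: "h \<in> borel_measurable lebesgue" by simp
  have half: "(LINT x|lebesgue. indicator {a<..} x * h x) = 0" for a
  proof -
    have "integrable lebesgue (\<lambda>x. indicator {a<..} x * h x)"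
      using integrable_mult_indicator[of "{a<..}" lebesgue h] hi by simp
    then have "(LINT x|lebesgue. indicator {a<..} x * h x) = integral UNIV (\<lambda>x. indicator {a<..} x * h x)"
      using has_integral_integral_lebesgue integral_unique by metis
    also have "\<dots> = integral UNIV (\<lambda>x. if x \<in> {0..1} \<inter> {a<..} then g x else 0)"
      by (rule arg_cong[where f="integral UNIV"]) (auto simp: h_def indicator_def)
    also have "\<dots> = integral ({0..1} \<inter> {a<..}) g" by (rule integral_restrict_UNIV)
    also have "\<dots> = 0"
    proof -
      consider "a < 0" | "a \<in> {0..1}" | "a > 1" by (meson atLeastAtMost_iff not_le)
      then show ?thesis
      proof cases
        case 1
        then have e: "{0..1} \<inter> {a<..} = {0..1}" by auto
        show ?thesis unfolding e by (rule z) simp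
      next
        case 2
        have "x \<in> {0..1} \<inter> {a<..} \<longleftrightarrow> x \<in> {a<..1}" for x using 2 by (simp, linarith)
        then have e: "{0..1} \<inter> {a<..} = {a<..1}" by blast
        have "integral ({0..1} \<inter> {a<..}) g = integral {a..1} g"
          unfolding e by (rule integral_spike_set; rule negligible_subset[of "{a}"]) auto
        also have "\<dots> = integral {0..1} g - integral {0..a} g"
          using Henstock_Kurzweil_Integration.integral_combine[of 0 a 1 g] 2 sq_int_integrable_on[OF g, of 0 1] by simp
        finally show ?thesis using z[of 1] z[OF 2] by simp
      next
        case 3
        then have "{0..1} \<inter> {a<..} = {}" by auto
        then show ?thesis by simp
      qed
    qed
    finally show ?thesis .
  qed
  \<comment> \<open>The comparison on half-lines determines measures on the Borel sets only, hence a
    Borel representative of the Lebesgue measurable \<open>h\<close>.\<close>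
  obtain k where k: "k \<in> borel_measurable lborel" "AE x in lborel. h x = k x"
    using completion_ex_borel_measurable_real[OF hm] by auto
  note [measurable] = k(1)
  have k': "AE x in lebesgue. h x = k x" using k(2) by (rule AE_completion)
  have "integrable lebesgue k"
    using integrable_cong_AE[OF hm _ k'] hi measurable_completion[OF k(1)] by auto
  then have ki: "integrable lborel k" by (simp add: integrable_completion)
  have khalf: "(LINT x|lborel. indicator {a<..} x * k x) = 0" for a
  proof -
    have "(LINT x|lborel. indicator {a<..} x * k x) = (LINT x|lebesgue. indicator {a<..} x * k x)"
      by (rule integral_completion[symmetric]) measurable
    also have "\<dots> = (LINT x|lebesgue. indicator {a<..} x * h x)"
    proof (rule integral_cong_AE)
      have "{a<..} \<in> sets lebesgue" by simp
      then show "(\<lambda>x. indicator {a<..} x * k x) \<in> borel_measurable lebesgue"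
        "(\<lambda>x. indicator {a<..} x * h x) \<in> borel_measurable lebesgue"
        using hm measurable_completion[OF k(1)]
        by (auto intro!: borel_measurable_times borel_measurable_indicator)
      show "AE x in lebesgue. indicator {a<..} x * k x = indicator {a<..} x * h x"
        using k' by eventually_elim simp
    qed
    finally show ?thesis using half by simp
  qed
  \<comment> \<open>\<open>ennreal\<close> sends negative numbers to 0, so the two densities are the
    positive and the negative part of \<open>k\<close>.\<close>
  have eq: "density lborel (\<lambda>x. ennreal (k x)) = density lborel (\<lambda>x. ennreal (- k x))"
  proof (rule measure_eqI_lessThan)
    fix a :: real
    let ?I = "indicator {a<..} :: real \<Rightarrow> real"
    have ii: "integrable lborel (\<lambda>x. ?I x * k x)"
      using integrable_mult_indicator[of "{a<..}" lborel k] ki by simp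
    have e1: "emeasure (density lborel (\<lambda>x. ennreal (k x))) {a<..} = (\<integral>\<^sup>+x. ennreal (?I x * k x) \<partial>lborel)"
      by (subst emeasure_density) (auto intro!: nn_integral_cong split: split_indicator)
    have e2: "emeasure (density lborel (\<lambda>x. ennreal (- k x))) {a<..} = (\<integral>\<^sup>+x. ennreal (- (?I x * k x)) \<partial>lborel)"
      by (subst emeasure_density) (auto intro!: nn_integral_cong split: split_indicator)
    have f1: "(\<integral>\<^sup>+x. ennreal (?I x * k x) \<partial>lborel) < \<infinity>" "(\<integral>\<^sup>+x. ennreal (- (?I x * k x)) \<partial>lborel) < \<infinity>"
      using ii by (auto simp: real_integrable_def less_top)
    show "emeasure (density lborel (\<lambda>x. ennreal (k x))) {a<..} < \<infinity>" using e1 f1 by simp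
    have "enn2real (\<integral>\<^sup>+x. ennreal (?I x * k x) \<partial>lborel) = enn2real (\<integral>\<^sup>+x. ennreal (- (?I x * k x)) \<partial>lborel)"
      using khalf[of a] ii by (simp add: real_lebesgue_integral_def)
    then show "emeasure (density lborel (\<lambda>x. ennreal (k x))) {a<..} = emeasure (density lborel (\<lambda>x. ennreal (- k x))) {a<..}"
      using e1 e2 f1 by (metis ennreal_enn2real infinity_ennreal_def)
  qed simp_all
  have "AE x in lborel. ennreal (k x) = ennreal (- k x)"
    by (rule sigma_finite_measure.density_unique[OF sigma_finite_lborel _ _ eq]) measurable
  then have "AE x in lborel. h x = 0"
    using k(2)
  proof eventually_elim
    case (elim x)
    then have "k x = 0"
      by (metis ennreal_eq_0_iff ennreal_neg linorder_linear neg_0_le_iff_le neg_le_0_iff_le order_antisym)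
    then show ?case using elim by simp
  qed
  then have "AE x in lebesgue. h x = 0" by (rule AE_completion)
  then show ?thesis
    by (subst AE_restrict_space_iff) (auto elim!: eventually_mono simp: h_def indicator_def)
qed

section \<open>Fundamental theorem and integration by parts for the Lebesgue integral\<close>

lemma LINT_FTC:
  fixes F f :: "real \<Rightarrow> real"
  assumes "\<And>x. x \<in> {0..1} \<Longrightarrow> (F has_real_derivative f x) (at x within {0..1})"
    and "continuous_on {0..1} f"
  shows "(LINT x|I01. f x) = F 1 - F 0"
proof -
  have "(f has_integral (F 1 - F 0)) {0..1}"
    using assms(1) by (intro fundamental_theorem_of_calculus)
      (auto simp: has_real_derivative_iff_has_vector_derivative[symmetric])
  then show ?thesis
    using integral_I01_eq[OF continuous_imp_integrable_real[OF assms(2)]] by (simp add: integral_unique)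
qed

lemma LINT_by_parts:
  assumes g: "sq_int g"
    and p: "\<And>x. x \<in> {0..1} \<Longrightarrow> (p has_real_derivative p' x) (at x within {0..1})"
    and p': "continuous_on {0..1} p'"
  shows "(LINT x|I01. p' x * integral {0..x} g) = p 1 * integral {0..1} g - (LINT x|I01. p x * g x)"
proof -
  have "continuous_on {0..1} (\<lambda>x. integral {0..x} g)"
    using sq_int_integrable_on[OF g, of 0 1] by (intro indefinite_integral_continuous_1) auto
  then have 1: "integrable I01 (\<lambda>x. p' x * integral {0..x} g)"
    by (intro continuous_imp_integrable_real continuous_on_mult p')
  have 2: "integrable I01 (\<lambda>x. p x * g x)"
    by (intro integrable_sq_int_mult g sq_int_continuous DERIV_continuous_on[OF p])
  have "(LINT x|I01. p' x * integral {0..x} g + p x * g x) = p 1 * integral {0..1} g"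
    using integral_by_parts_indefinite[OF assms]
      integral_I01_eq[OF Bochner_Integration.integrable_add[OF 1 2]] by simp
  then show ?thesis using 1 2 by simp
qed

section \<open>Sine and cosine coefficients\<close>

text \<open>The squares of \<open>kap k\<close> are the Dirichlet eigenvalues of -d^2/dx^2 on (0,1).
  The shift by one starts the count at frequency pi, so \<open>cosb\<close> omits the constant mode;
  this loses nothing for derivatives of elements of V, which have mean zero.\<close>

definition kap :: "nat \<Rightarrow> real" where "kap k = real (Suc k) * pi"
definition sinb :: "nat \<Rightarrow> real \<Rightarrow> real" where "sinb k x = sqrt 2 * sin (kap k * x)"
definition cosb :: "nat \<Rightarrow> real \<Rightarrow> real" where "cosb k x = sqrt 2 * cos (kap k * x)"
definition scoef :: "(real \<Rightarrow> real) \<Rightarrow> nat \<Rightarrow> real" where "scoef f k = (LINT x|I01. f x * sinb k x)"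
definition ccoef :: "(real \<Rightarrow> real) \<Rightarrow> nat \<Rightarrow> real" where "ccoef f k = (LINT x|I01. f x * cosb k x)"

lemma kap_pos [simp]: "0 < kap k" by (simp add: kap_def)
lemma kap_nonzero [simp]: "kap k \<noteq> 0" using kap_pos[of k] by linarith

lemma kap_ge_1: "1 \<le> kap k"
proof -
  have "1 * 1 \<le> real (Suc k) * pi" using pi_ge_two by (intro mult_mono) auto
  then show ?thesis by (simp add: kap_def)
qed

lemma sin_kap [simp]: "sin (kap k) = 0"
  unfolding kap_def by (rule sin_npi)

lemma sinb_0 [simp]: "sinb k 0 = 0" and sinb_1 [simp]: "sinb k 1 = 0"
  by (simp_all add: sinb_def)

lemma sinb_deriv: "(sinb k has_real_derivative kap k * cosb k x) (at x within S)"
  unfolding sinb_def[abs_def] cosb_def by (auto intro!: derivative_eq_intros)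

lemma cosb_deriv: "(cosb k has_real_derivative - kap k * sinb k x) (at x within S)"
  unfolding sinb_def cosb_def[abs_def] by (auto intro!: derivative_eq_intros)

lemma continuous_on_sinb [continuous_intros]: "continuous_on S (sinb k)"
  unfolding sinb_def[abs_def] by (intro continuous_intros)

lemma continuous_on_cosb [continuous_intros]: "continuous_on S (cosb k)"
  unfolding cosb_def[abs_def] by (intro continuous_intros)

lemma abs_sinb_le: "\<bar>sinb k x\<bar> \<le> 2"
proof -
  have "\<bar>sinb k x\<bar> = sqrt 2 * \<bar>sin (kap k * x)\<bar>" by (simp add: sinb_def abs_mult)
  also have "\<dots> \<le> 2 * 1"
    by (intro mult_mono) (auto simp: sqrt2_less_2 less_imp_le)
  finally show ?thesis by simp
qed

lemma sq_int_sinb [simp]: "sq_int (sinb k)" and sq_int_cosb [simp]: "sq_int (cosb k)"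
  by (intro sq_int_continuous continuous_intros)+

lemma LINT_cos_int:
  fixes m :: int
  assumes "m \<noteq> 0"
  shows "(LINT x|I01. cos (of_int m * pi * x)) = 0"
proof -
  have "(LINT x|I01. cos (of_int m * pi * x))
      = sin (of_int m * pi * 1) / (of_int m * pi) - sin (of_int m * pi * 0) / (of_int m * pi)"
    using assms by (intro LINT_FTC continuous_intros) (auto intro!: derivative_eq_intros)
  also have "sin (of_int m * pi * 1) = 0"
    using sin_zero_iff_int2 by auto
  finally show ?thesis by simp
qed

lemma LINT_cos_kap_diff:
  "(LINT x|I01. cos (kap i * x - kap j * x)) = (if i = j then 1 else 0)"
proof -
  have e: "cos (kap i * x - kap j * x) = cos (of_int (int i - int j) * pi * x)" for x
    by (rule arg_cong[where f=cos]) (simp add: kap_def algebra_simps)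
  show ?thesis
  proof (cases "i = j")
    case True
    then show ?thesis using measure_I01 by simp
  next
    case False
    then have "(LINT x|I01. cos (of_int (int i - int j) * pi * x)) = 0" by (intro LINT_cos_int) simp
    then show ?thesis using False unfolding e by simp
  qed
qed

lemma LINT_cos_kap_add: "(LINT x|I01. cos (kap i * x + kap j * x)) = 0"
proof -
  have e: "cos (kap i * x + kap j * x) = cos (of_int (int i + int j + 2) * pi * x)" for x
    by (rule arg_cong[where f=cos]) (simp add: kap_def algebra_simps)
  show ?thesis unfolding e by (intro LINT_cos_int) simp
qed

lemma sinb_orthonormal: "(LINT x|I01. sinb i x * sinb j x) = (if i = j then 1 else 0)"
proof -
  have "sinb i x * sinb j x = cos (kap i * x - kap j * x) - cos (kap i * x + kap j * x)" for x
    unfolding sinb_def cos_diff cos_add by simp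
  then have "(LINT x|I01. sinb i x * sinb j x)
      = (LINT x|I01. cos (kap i * x - kap j * x) - cos (kap i * x + kap j * x))" by simp
  also have "\<dots> = (LINT x|I01. cos (kap i * x - kap j * x)) - (LINT x|I01. cos (kap i * x + kap j * x))"
    by (intro Bochner_Integration.integral_diff continuous_imp_integrable_real continuous_intros)
  finally show ?thesis by (simp only: LINT_cos_kap_diff LINT_cos_kap_add diff_0_right)
qed

lemma cosb_orthonormal: "(LINT x|I01. cosb i x * cosb j x) = (if i = j then 1 else 0)"
proof -
  have "cosb i x * cosb j x = cos (kap i * x - kap j * x) + cos (kap i * x + kap j * x)" for x
    unfolding cosb_def cos_diff cos_add by simp
  then have "(LINT x|I01. cosb i x * cosb j x)
      = (LINT x|I01. cos (kap i * x - kap j * x) + cos (kap i * x + kap j * x))" by simp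
  also have "\<dots> = (LINT x|I01. cos (kap i * x - kap j * x)) + (LINT x|I01. cos (kap i * x + kap j * x))"
    by (intro Bochner_Integration.integral_add continuous_imp_integrable_real continuous_intros)
  finally show ?thesis by (simp only: LINT_cos_kap_diff LINT_cos_kap_add add_0_right)
qed

section \<open>Finite orthonormal expansions\<close>

lemma LINT_sum_mult:
  assumes "sq_int f" "\<And>k. sq_int (e k)"
  shows "(LINT x|I01. f x * (\<Sum>k<(n::nat). a k * e k x)) = (\<Sum>k<n. a k * (LINT x|I01. f x * e k x))"
proof -
  have "(LINT x|I01. f x * (\<Sum>k<n. a k * e k x)) = (LINT x|I01. (\<Sum>k<n. a k * (f x * e k x)))"
    by (simp add: sum_distrib_left mult_ac)
  also have "\<dots> = (\<Sum>k<n. (LINT x|I01. a k * (f x * e k x)))"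
    by (intro Bochner_Integration.integral_sum integrable_mult_right integrable_sq_int_mult assms)
  finally show ?thesis by simp
qed

lemma LINT_orthonormal_sum:
  assumes "\<And>k. sq_int (e k)" "\<And>i j. (LINT x|I01. e i x * e j x) = (if i = j then 1 else 0)"
  shows "(LINT x|I01. e i x * (\<Sum>k<(n::nat). a k * e k x)) = (if i < n then a i else 0)"
  by (simp add: LINT_sum_mult[OF assms(1) assms(1)] assms(2) if_distrib cong: if_cong)

lemma L2norm_orthonormal_sum:
  assumes "\<And>k. sq_int (e k)" "\<And>i j. (LINT x|I01. e i x * e j x) = (if i = j then 1 else 0)"
  shows "(L2norm (\<lambda>x. \<Sum>k<(n::nat). a k * e k x))\<^sup>2 = (\<Sum>k<n. (a k)\<^sup>2)"
proof -
  let ?s = "\<lambda>x. \<Sum>k<n. a k * e k x"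
  have s: "sq_int ?s" by (intro sq_int_sum sq_int_scale assms finite_lessThan)
  have "(L2norm ?s)\<^sup>2 = (LINT x|I01. ?s x * ?s x)"
    using L2norm_sq[OF s] by (simp add: power2_eq_square)
  also have "\<dots> = (\<Sum>k<n. a k * (LINT x|I01. ?s x * e k x))" by (rule LINT_sum_mult[OF s assms(1)])
  also have "\<dots> = (\<Sum>k<n. a k * a k)"
  proof (rule sum.cong[OF refl])
    fix k assume "k \<in> {..<n}"
    then show "a k * (LINT x|I01. ?s x * e k x) = a k * a k"
      using LINT_orthonormal_sum[OF assms, of k a n] by (simp add: mult.commute)
  qed
  finally show ?thesis by (simp add: power2_eq_square)
qed

lemma Bessel_inequality:
  assumes f: "sq_int f" and e: "\<And>k. sq_int (e k)"
    and on: "\<And>i j. (LINT x|I01. e i x * e j x) = (if i = j then 1 else 0)"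
  shows "(\<Sum>k<(n::nat). (LINT x|I01. f x * e k x)\<^sup>2) \<le> (L2norm f)\<^sup>2"
proof -
  define a where "a k = (LINT x|I01. f x * e k x)" for k
  define s where "s x = (\<Sum>k<n. a k * e k x)" for x
  have s: "sq_int s" unfolding s_def by (intro sq_int_sum sq_int_scale e finite_lessThan)
  have "0 \<le> (LINT x|I01. (f x - s x)\<^sup>2)" by simp
  also have "\<dots> = (LINT x|I01. (f x)\<^sup>2 - 2 * (f x * s x) + (s x)\<^sup>2)"
    by (simp add: power2_diff algebra_simps)
  also have "\<dots> = (L2norm f)\<^sup>2 - 2 * (LINT x|I01. f x * s x) + (L2norm s)\<^sup>2"
    using f s by (simp add: integrable_sq_int_mult sq_int_integrable_sq L2norm_sq)
  also have "(LINT x|I01. f x * s x) = (\<Sum>k<n. a k * a k)"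
    unfolding s_def LINT_sum_mult[OF f e] a_def ..
  also have "(L2norm s)\<^sup>2 = (\<Sum>k<n. (a k)\<^sup>2)"
    unfolding s_def by (rule L2norm_orthonormal_sum[OF e on])
  finally show ?thesis unfolding a_def by (simp add: power2_eq_square)
qed

lemmas sinb_Bessel = Bessel_inequality[OF _ sq_int_sinb sinb_orthonormal, folded scoef_def]
lemmas cosb_Bessel = Bessel_inequality[OF _ sq_int_cosb cosb_orthonormal, folded ccoef_def]

text \<open>Since \<open>2 sin (k \<theta>) cos \<theta> = sin ((k + 1) \<theta>) + sin ((k - 1) \<theta>)\<close>, vanishing sine coefficients
  make \<open>v sin (\<pi> x)\<close> orthogonal to every polynomial in \<open>cos (\<pi> x)\<close>; by Weierstrass, \<open>v\<close> is a uniform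
  limit of such polynomials.\<close>

lemma sine_moment_zero:
  assumes v: "continuous_on {0..1} v" and z: "\<And>k. scoef v k = 0"
  shows "(LINT x|I01. v x * sinb k x * cos (pi * x) ^ n) = 0"
proof (induction n arbitrary: k)
  case 0
  then show ?case using z[of k] by (simp add: scoef_def)
next
  case (Suc n)
  have ii: "integrable I01 (\<lambda>x. v x * sinb j x * cos (pi * x) ^ n)" for j
    by (intro continuous_imp_integrable_real continuous_intros v)
  show ?case
  proof (cases k)
    case 0
    \<comment> \<open>At the lowest frequency the lower neighbour in the product formula is sin 0,
      so a single term remains.\<close>
    have s: "sinb k x * cos (pi * x) = (1/2) * sinb 1 x" for x
      using sin_double[of "pi * x"] by (simp add: 0 sinb_def kap_def algebra_simps)
    have "v x * sinb k x * cos (pi * x) ^ Suc n = v x * (sinb k x * cos (pi * x)) * cos (pi * x) ^ n" for x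
      by (simp add: mult_ac)
    then have e: "v x * sinb k x * cos (pi * x) ^ Suc n = (1/2) * (v x * sinb 1 x * cos (pi * x) ^ n)" for x
      unfolding s by simp
    have "(LINT x|I01. v x * sinb k x * cos (pi * x) ^ Suc n)
        = (1/2) * (LINT x|I01. v x * sinb 1 x * cos (pi * x) ^ n)" unfolding e by simp
    then show ?thesis using Suc.IH[of 1] by simp
  next
    case (Suc j)
    have s: "sinb k x * cos (pi * x) = (1/2) * sinb (Suc k) x + (1/2) * sinb j x" for x
    proof -
      have e: "kap (Suc k) * x = kap k * x + pi * x" "kap j * x = kap k * x - pi * x"
        unfolding kap_def Suc by (simp_all add: algebra_simps)
      show ?thesis unfolding sinb_def e sin_add sin_diff by (simp add: algebra_simps)
    qed
    have "v x * sinb k x * cos (pi * x) ^ Suc n = v x * (sinb k x * cos (pi * x)) * cos (pi * x) ^ n" for x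
      by simp
    then have e: "v x * sinb k x * cos (pi * x) ^ Suc n = (1/2) * (v x * sinb (Suc k) x * cos (pi * x) ^ n)
        + (1/2) * (v x * sinb j x * cos (pi * x) ^ n)" for x
      unfolding s by (simp add: ring_distribs)
    have "(LINT x|I01. v x * sinb k x * cos (pi * x) ^ Suc n)
        = (1/2) * (LINT x|I01. v x * sinb (Suc k) x * cos (pi * x) ^ n)
        + (1/2) * (LINT x|I01. v x * sinb j x * cos (pi * x) ^ n)"
      unfolding e using ii by (simp add: Bochner_Integration.integral_add)
    then show ?thesis using Suc.IH[of "Suc k"] Suc.IH[of j] by simp
  qed
qed

theorem sine_complete:
  assumes v: "continuous_on {0..1} v" and z: "\<And>k. scoef v k = 0" and x: "x \<in> {0..1}"
  shows "v x = 0"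
proof -
  \<comment> \<open>The substitution s = cos (pi x) maps the interval homeomorphically onto [-1, 1]
    and turns polynomials in cos (pi x) into ordinary ones.\<close>
  define h where "h s = v (arccos s / pi)" for s
  have arc: "arccos s / pi \<in> {0..1}" if "s \<in> {-1..1}" for s
    using arccos_lbound[of s] arccos_ubound[of s] that by auto
  have "continuous_on {-1..1} h" unfolding h_def
    using arc by (intro continuous_on_compose2[OF v] continuous_on_divide continuous_on_arccos'
        continuous_intros) auto
  then have approx: "\<exists>g. real_polynomial_function g \<and> (\<forall>s\<in>{-1..1}. \<bar>h s - g s\<bar> < e)" if "e > 0" for e
    using Stone_Weierstrass_real_polynomial_function[of "{-1..1::real}" h e] that
    by (metis compact_Icc)
  have hcos: "h (cos (pi * x)) = v x" if "x \<in> {0..1}" for x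
    using that by (simp add: h_def arccos_cos)
  have contw: "continuous_on {0..1} (\<lambda>x. v x * v x * sin (pi * x))"
    by (intro continuous_intros v)
  have contm: "continuous_on {0..1} (\<lambda>x. \<bar>v x * sinb 0 x\<bar>)"
    by (intro continuous_intros v)
  let ?A = "LINT x|I01. \<bar>v x * sinb 0 x\<bar>"
  \<comment> \<open>\<open>v\<close> is tested against itself: the polynomial approximant
    contributes nothing, so only the approximation error, at most \<open>e\<close>, is left beside
    \<open>\<bar>v x * sinb 0 x\<bar>\<close>.\<close>
  have le: "sqrt 2 * (LINT x|I01. v x * v x * sin (pi * x)) \<le> e * ?A" if e: "e > 0" for e
  proof -
    obtain g where g: "real_polynomial_function g" "\<And>s. s \<in> {-1..1} \<Longrightarrow> \<bar>h s - g s\<bar> < e"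
      using approx[OF e] by blast
    obtain a n where a: "g = (\<lambda>x. \<Sum>i\<le>n. a i * x ^ i)"
      using g(1) unfolding real_polynomial_function_iff_sum by blast
    have contg: "continuous_on {0..1} (\<lambda>x. g (cos (pi * x)))"
      unfolding a by (intro continuous_intros)
    have "(LINT x|I01. v x * sinb 0 x * g (cos (pi * x)))
        = (LINT x|I01. (\<Sum>i\<le>n. a i * (v x * sinb 0 x * cos (pi * x) ^ i)))"
      unfolding a by (simp add: sum_distrib_left mult_ac)
    also have "\<dots> = (\<Sum>i\<le>n. (LINT x|I01. a i * (v x * sinb 0 x * cos (pi * x) ^ i)))"
      by (intro Bochner_Integration.integral_sum integrable_mult_right continuous_imp_integrable_real
          continuous_intros v)
    also have "\<dots> = 0" using sine_moment_zero[OF v z] by simp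
    finally have zero: "(LINT x|I01. v x * sinb 0 x * g (cos (pi * x))) = 0" .
    have i1: "integrable I01 (\<lambda>x. v x * sinb 0 x * v x)"
      by (intro continuous_imp_integrable_real continuous_intros v)
    have i2: "integrable I01 (\<lambda>x. v x * sinb 0 x * g (cos (pi * x)))"
      by (intro continuous_imp_integrable_real continuous_intros v contg)
    have "sqrt 2 * (LINT x|I01. v x * v x * sin (pi * x)) = (LINT x|I01. v x * sinb 0 x * v x)"
      by (subst integral_mult_right_zero[symmetric]) (simp add: sinb_def kap_def mult_ac)
    also have "\<dots> = (LINT x|I01. v x * sinb 0 x * v x - v x * sinb 0 x * g (cos (pi * x)))"
      using i1 i2 zero by simp
    also have "\<dots> \<le> (LINT x|I01. e * \<bar>v x * sinb 0 x\<bar>)"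
    proof (rule integral_mono)
      show "integrable I01 (\<lambda>x. v x * sinb 0 x * v x - v x * sinb 0 x * g (cos (pi * x)))"
        using i1 i2 by simp
      show "integrable I01 (\<lambda>x. e * \<bar>v x * sinb 0 x\<bar>)"
        by (intro integrable_mult_right continuous_imp_integrable_real contm)
      fix x assume "x \<in> space I01"
      then have x: "x \<in> {0..1}" by simp
      have "v x * sinb 0 x * v x - v x * sinb 0 x * g (cos (pi * x))
          = (v x * sinb 0 x) * (h (cos (pi * x)) - g (cos (pi * x)))"
        unfolding hcos[OF x] by (simp add: algebra_simps)
      also have "\<dots> \<le> \<bar>v x * sinb 0 x\<bar> * \<bar>h (cos (pi * x)) - g (cos (pi * x))\<bar>"
        by (simp add: abs_mult[symmetric])
      also have "\<dots> \<le> \<bar>v x * sinb 0 x\<bar> * e"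
        using g(2)[of "cos (pi * x)"] by (intro mult_left_mono) auto
      finally show "v x * sinb 0 x * v x - v x * sinb 0 x * g (cos (pi * x)) \<le> e * \<bar>v x * sinb 0 x\<bar>"
        by (simp add: mult.commute)
    qed
    finally show ?thesis by simp
  qed
  have nn: "0 \<le> v x * v x * sin (pi * x)" if "x \<in> {0..1}" for x
    using that sin_ge_zero[of "pi * x"] by (simp add: mult_le_cancel_left1)
  have "sqrt 2 * (LINT x|I01. v x * v x * sin (pi * x)) \<le> 0"
  proof (rule field_le_epsilon)
    fix e :: real assume "0 < e"
    have A: "0 \<le> ?A" by (intro integral_nonneg_AE) simp
    then have A1: "0 < ?A + 1" by linarith
    have "sqrt 2 * (LINT x|I01. v x * v x * sin (pi * x)) \<le> e / (?A + 1) * ?A"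
      using \<open>0 < e\<close> A1 by (intro le divide_pos_pos)
    also have "\<dots> \<le> e" using A1 \<open>0 < e\<close> by (simp add: divide_le_eq algebra_simps)
    finally show "sqrt 2 * (LINT x|I01. v x * v x * sin (pi * x)) \<le> 0 + e" by simp
  qed
  moreover have "0 \<le> (LINT x|I01. v x * v x * sin (pi * x))"
    by (intro integral_nonneg_AE AE_I01I nn)
  ultimately have "(LINT x|I01. v x * v x * sin (pi * x)) = 0"
    by (simp add: mult_le_0_iff)
  then have w: "v x * v x * sin (pi * x) = 0" if "x \<in> {0..1}" for x
    using integralL_eq_0_iff[OF contw _ nn] that by auto
  \<comment> \<open>The weight sin (pi x) vanishes at both endpoints; these are reached afterwards
    by continuity of \<open>v\<close>.\<close>
  have inner: "v x = 0" if "x \<in> {0<..<1}" for x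
  proof -
    have "sin (pi * x) > 0" using that by (intro sin_gt_zero) auto
    then show ?thesis using w[of x] that by auto
  qed
  have "continuous_on (closure {0<..<1}) v" using v by simp
  then have "v y = 0" if "y \<in> closure {0<..<1}" for y
    using continuous_constant_on_closure[of "{0<..<1}" v 0 y] inner that by auto
  then show ?thesis using x by simp
qed

section \<open>Identification of \<open>H10\<close> with square-summable sequences\<close>

lemma weak_deriv_sq_int: "weak_deriv u g \<Longrightarrow> sq_int g"
  by (simp add: weak_deriv_def)

lemma weak_deriv_integral: "weak_deriv u g \<Longrightarrow> x \<in> {0..1} \<Longrightarrow> integral {0..x} g = u x - u 0"
  unfolding weak_deriv_def by (metis add_diff_cancel_left')

lemma weak_deriv_AE_unique:
  assumes "weak_deriv u g" "weak_deriv u h"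
  shows "AE x in I01. g x = h x"
proof -
  note s = weak_deriv_sq_int[OF assms(1)] weak_deriv_sq_int[OF assms(2)]
  have "AE x in I01. g x - h x = 0"
  proof (rule AE_zero_if_indefinite_integral_zero[OF sq_int_diff[OF s]])
    fix x :: real assume x: "x \<in> {0..1}"
    have "integral {0..x} (\<lambda>y. g y - h y) = integral {0..x} g - integral {0..x} h"
      using sq_int_integrable_on[OF s(1), of 0 x] sq_int_integrable_on[OF s(2), of 0 x] x
      by (intro Henstock_Kurzweil_Integration.integral_diff) auto
    then show "integral {0..x} (\<lambda>y. g y - h y) = 0"
      using weak_deriv_integral[OF assms(1) x] weak_deriv_integral[OF assms(2) x] by simp
  qed
  then show ?thesis by simp
qed

text \<open>Makes the choice operator in \<open>Vnorm\<close> harmless: any two weak derivatives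
  agree almost everywhere.\<close>

lemma Vnorm_eq: "weak_deriv u g \<Longrightarrow> Vnorm u = L2norm g"
  unfolding Vnorm_def using someI[of "weak_deriv u" g]
  by (intro L2norm_cong_AE weak_deriv_AE_unique) (auto intro: weak_deriv_sq_int)

lemma L2norm_tendsto:
  assumes "\<And>n. sq_int (g n)" "sq_int h" "(\<lambda>n. L2norm (\<lambda>x. g n x - h x)) \<longlonglongrightarrow> 0"
  shows "(\<lambda>n. L2norm (g n)) \<longlonglongrightarrow> L2norm h"
proof -
  have "\<bar>L2norm (g n) - L2norm h\<bar> \<le> L2norm (\<lambda>x. g n x - h x)" for n
    using L2norm_triangle[OF sq_int_diff[OF assms(1)[of n] assms(2)] assms(2)]
      L2norm_triangle_diff[OF assms(1)[of n] sq_int_diff[OF assms(1)[of n] assms(2)]] by simp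
  then have "(\<lambda>n. L2norm (g n) - L2norm h) \<longlonglongrightarrow> 0"
    by (intro Lim_null_comparison[OF _ assms(3)]) simp
  then show ?thesis using LIM_zero_iff by blast
qed

lemma LINT_mult_tendsto:
  assumes "\<And>n. sq_int (g n)" "sq_int h" "sq_int p" "(\<lambda>n. L2norm (\<lambda>x. g n x - h x)) \<longlonglongrightarrow> 0"
  shows "(\<lambda>n. LINT x|I01. g n x * p x) \<longlonglongrightarrow> (LINT x|I01. h x * p x)"
proof -
  have b: "\<bar>(LINT x|I01. g n x * p x) - (LINT x|I01. h x * p x)\<bar> \<le> L2norm (\<lambda>x. g n x - h x) * L2norm p" for n
  proof -
    have "(LINT x|I01. g n x * p x) - (LINT x|I01. h x * p x) = (LINT x|I01. (g n x - h x) * p x)"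
      using assms by (simp add: left_diff_distrib integrable_sq_int_mult)
    then show ?thesis using L2_Cauchy_Schwarz[OF sq_int_diff[OF assms(1)[of n] assms(2)] assms(3)] by simp
  qed
  have l: "(\<lambda>n. L2norm (\<lambda>x. g n x - h x) * L2norm p) \<longlonglongrightarrow> 0"
    by (rule tendsto_mult_left_zero[OF assms(4)])
  have "(\<lambda>n. (LINT x|I01. g n x * p x) - (LINT x|I01. h x * p x)) \<longlonglongrightarrow> 0"
    by (rule Lim_null_comparison[OF always_eventually l]) (simp only: real_norm_def b simp_thms)
  then show ?thesis using LIM_zero_iff by blast
qed

lemma integral_tendsto_L2:
  assumes "\<And>n. sq_int (g n)" "sq_int h" "x \<in> {0..1}" "(\<lambda>n. L2norm (\<lambda>x. g n x - h x)) \<longlonglongrightarrow> 0"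
  shows "(\<lambda>n. integral {0..x} (g n)) \<longlonglongrightarrow> integral {0..x} h"
proof -
  have sub: "{0..x} \<subseteq> {0..1}" using assms(3) by auto
  have "\<bar>integral {0..x} (g n) - integral {0..x} h\<bar> \<le> L2norm (\<lambda>x. g n x - h x)" for n
    using abs_integral_le_L2norm[OF sq_int_diff[OF assms(1)[of n] assms(2)] sub]
      Henstock_Kurzweil_Integration.integral_diff[OF sq_int_integrable_on(1)[OF assms(1)[of n] sub] sq_int_integrable_on(1)[OF assms(2) sub]]
    by simp
  then have "(\<lambda>n. integral {0..x} (g n) - integral {0..x} h) \<longlonglongrightarrow> 0"
    by (intro Lim_null_comparison[OF _ assms(4)]) simp
  then show ?thesis using LIM_zero_iff by blast
qed

section \<open>Recovering a function and its weak derivative from coefficients\<close>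

definition cosum :: "ell2 \<Rightarrow> nat \<Rightarrow> real \<Rightarrow> real" where
  "cosum c n x = (\<Sum>k<n. coord c k * cosb k x)"

lemma sq_int_cosum: "sq_int (cosum c n)"
  unfolding cosum_def[abs_def] by (intro sq_int_sum sq_int_scale) auto

lemma L2norm_cosum_diff:
  assumes "N \<le> m" "N \<le> n"
  shows "L2norm (\<lambda>x. cosum c m x - cosum c n x) \<le> norm (c - ell2_trunc N c)"
proof (rule power2_le_imp_le)
  define a where "a k = coord (ell2_trunc m c - ell2_trunc n c) k" for k
  \<comment> \<open>Both sums are padded with zero coefficients to the common length
    \<open>m + n\<close>.\<close>
  have "cosum c m x - cosum c n x = (\<Sum>k<m + n. a k * cosb k x)" for x
  proof -
    have "cosum c j x = (\<Sum>k<m + n. coord (ell2_trunc j c) k * cosb k x)" if "j \<le> m + n" for j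
      unfolding cosum_def using that
      by (intro sum.mono_neutral_cong_left) (auto simp: coord_ell2_trunc)
    then show ?thesis by (simp add: a_def sum_subtractf left_diff_distrib)
  qed
  then have "(L2norm (\<lambda>x. cosum c m x - cosum c n x))\<^sup>2 = (\<Sum>k<m + n. (a k)\<^sup>2)"
    using L2norm_orthonormal_sum[OF sq_int_cosb cosb_orthonormal] by simp
  also have "\<dots> \<le> (\<Sum>k<m + n. (coord (c - ell2_trunc N c) k)\<^sup>2)"
    using assms by (intro sum_mono) (auto simp: a_def coord_ell2_trunc)
  also have "\<dots> \<le> (norm (c - ell2_trunc N c))\<^sup>2" by (rule sum_coord_sq_le) simp
  finally show "(L2norm (\<lambda>x. cosum c m x - cosum c n x))\<^sup>2 \<le> (norm (c - ell2_trunc N c))\<^sup>2" .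
qed simp

lemma cosum_L2_converges: "\<exists>h. sq_int h \<and> (\<lambda>n. L2norm (\<lambda>x. cosum c n x - h x)) \<longlonglongrightarrow> 0"
proof (rule L2_complete[OF sq_int_cosum])
  fix e :: real assume "0 < e"
  then obtain N where "norm (ell2_trunc N c - c) < e"
    using LIMSEQ_D[OF ell2_trunc_tendsto[of c]] by blast
  then have "norm (c - ell2_trunc N c) \<le> e" by (simp add: norm_minus_commute)
  then show "\<exists>N. \<forall>m\<ge>N. \<forall>n\<ge>N. L2norm (\<lambda>x. cosum c m x - cosum c n x) \<le> e"
    using L2norm_cosum_diff order_trans by blast
qed

text \<open>The L^2 sum of the cosine series with coefficients \<open>c\<close>. It is determined
  only almost everywhere, so facts about it are stated in L^2 norm, through integrals, or
  a.e.\<close>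

definition der :: "ell2 \<Rightarrow> real \<Rightarrow> real" where
  "der c = (SOME h. sq_int h \<and> (\<lambda>n. L2norm (\<lambda>x. cosum c n x - h x)) \<longlonglongrightarrow> 0)"

text \<open>The antiderivative of \<open>der c\<close>, summed termwise. The cut-off matters: the
  sine series continues as an odd periodic function, whereas elements of \<open>H10\<close> vanish
  outside the interval.\<close>

definition val :: "ell2 \<Rightarrow> real \<Rightarrow> real" where
  "val c x = (if x \<in> {0..1} then (\<Sum>k. coord c k / kap k * sinb k x) else 0)"

lemma sq_int_der: "sq_int (der c)" and cosum_tendsto_der: "(\<lambda>n. L2norm (\<lambda>x. cosum c n x - der c x)) \<longlonglongrightarrow> 0"
  using someI_ex[OF cosum_L2_converges[of c]] unfolding der_def by auto

lemma L2norm_der: "L2norm (der c) = norm c"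
proof -
  have "(\<lambda>n. (L2norm (cosum c n))\<^sup>2) \<longlonglongrightarrow> (L2norm (der c))\<^sup>2"
    by (intro tendsto_power L2norm_tendsto sq_int_cosum sq_int_der cosum_tendsto_der)
  moreover have "(\<lambda>n. (L2norm (cosum c n))\<^sup>2) \<longlonglongrightarrow> (norm c)\<^sup>2"
    using coord_sums_norm_sq[of c] L2norm_orthonormal_sum[OF sq_int_cosb cosb_orthonormal]
    unfolding cosum_def[abs_def] sums_def by simp
  ultimately have "(L2norm (der c))\<^sup>2 = (norm c)\<^sup>2" by (rule LIMSEQ_unique)
  then show ?thesis by simp
qed

lemma ccoef_der: "ccoef (der c) k = coord c k"
proof -
  have "(\<lambda>n. LINT x|I01. cosum c n x * cosb k x) \<longlonglongrightarrow> ccoef (der c) k"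
    unfolding ccoef_def by (intro LINT_mult_tendsto sq_int_cosum sq_int_der cosum_tendsto_der) simp
  moreover have "\<forall>\<^sub>F n in sequentially. (LINT x|I01. cosum c n x * cosb k x) = coord c k"
  proof (rule eventually_sequentiallyI[of "Suc k"])
    fix n assume "Suc k \<le> n"
    then show "(LINT x|I01. cosum c n x * cosb k x) = coord c k"
      using LINT_orthonormal_sum[OF sq_int_cosb cosb_orthonormal, of k "coord c" n]
      by (simp add: cosum_def mult.commute)
  qed
  then have "(\<lambda>n. LINT x|I01. cosum c n x * cosb k x) \<longlonglongrightarrow> coord c k"
    by (rule tendsto_eventually)
  ultimately show ?thesis by (rule LIMSEQ_unique)
qed

lemma integral_cosum:
  assumes "x \<in> {0..1}"
  shows "integral {0..x} (cosum c n) = (\<Sum>k<n. coord c k / kap k * sinb k x)"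
proof -
  have d: "((\<lambda>y. \<Sum>k<n. coord c k / kap k * sinb k y) has_real_derivative cosum c n y) (at y within {0..x})" for y
  proof -
    have "((\<lambda>y. \<Sum>k<n. coord c k / kap k * sinb k y) has_real_derivative
        (\<Sum>k<n. coord c k / kap k * (kap k * cosb k y))) (at y within {0..x})"
      by (intro DERIV_sum DERIV_cmult sinb_deriv)
    then show ?thesis by (simp add: cosum_def)
  qed
  have "(cosum c n has_integral (\<Sum>k<n. coord c k / kap k * sinb k x) - (\<Sum>k<n. coord c k / kap k * sinb k 0)) {0..x}"
    using assms d by (intro fundamental_theorem_of_calculus)
      (auto simp: has_real_derivative_iff_has_vector_derivative[symmetric])
  then show ?thesis by (simp add: integral_unique)
qed

lemma val_sums: "x \<in> {0..1} \<Longrightarrow> (\<lambda>k. coord c k / kap k * sinb k x) sums integral {0..x} (der c)"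
  unfolding sums_def integral_cosum[symmetric]
  by (intro integral_tendsto_L2 sq_int_cosum sq_int_der cosum_tendsto_der)

lemma val_eq_integral: "x \<in> {0..1} \<Longrightarrow> val c x = integral {0..x} (der c)"
  using sums_unique[OF val_sums] by (simp add: val_def)

lemma val_sums': "x \<in> {0..1} \<Longrightarrow> (\<lambda>k. coord c k / kap k * sinb k x) sums val c x"
  using val_sums val_eq_integral by simp

lemma val_0 [simp]: "val c 0 = 0" and val_1 [simp]: "val c 1 = 0"
  by (simp_all add: val_def)

lemma val_outside: "x \<notin> {0..1} \<Longrightarrow> val c x = 0"
  by (auto simp: val_def)

lemma weak_deriv_val: "weak_deriv (val c) (der c)"
  unfolding weak_deriv_def by (auto simp: sq_int_der val_eq_integral)

lemma val_in_H10: "val c \<in> H10"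
  unfolding H10_def using weak_deriv_val val_outside by auto

lemma Vnorm_val: "Vnorm (val c) = norm c"
  using Vnorm_eq[OF weak_deriv_val] L2norm_der by simp

text \<open>The embedding of V into the bounded functions, with constant 1; every nonlinear
  composition below is controlled through it.\<close>

lemma abs_val_le: "\<bar>val c x\<bar> \<le> norm c"
proof (cases "x \<in> {0..1}")
  case True
  then have "{0..x} \<subseteq> {0..1}" by auto
  then show ?thesis
    using abs_integral_le_L2norm[OF sq_int_der[of c], of 0 x] True by (simp add: val_eq_integral L2norm_der)
qed (simp add: val_outside)

lemma continuous_on_val: "continuous_on {0..1} (val c)"
proof -
  have "continuous_on {0..1} (\<lambda>x. integral {0..x} (der c))"
    using sq_int_integrable_on[OF sq_int_der[of c], of 0 1] by (intro indefinite_integral_continuous_1) auto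
  then show ?thesis by (rule continuous_on_eq) (simp add: val_eq_integral)
qed

lemma sq_int_val: "sq_int (val c)"
  by (intro sq_int_continuous continuous_on_val)

lemma val_add: "val (c + d) x = val c x + val d x"
proof (cases "x \<in> {0..1}")
  case True
  show ?thesis
    by (rule sums_unique2[OF val_sums'[OF True]])
       (use sums_add[OF val_sums'[OF True, of c] val_sums'[OF True, of d]] in
         \<open>simp add: add_divide_distrib distrib_right\<close>)
qed (simp add: val_outside)

lemma val_scaleR: "val (a *\<^sub>R c) x = a * val c x"
proof (cases "x \<in> {0..1}")
  case True
  show ?thesis
    by (rule sums_unique2[OF val_sums'[OF True]])
       (use sums_mult[OF val_sums'[OF True, of c], of a] in \<open>simp add: mult.assoc\<close>)
qed (simp add: val_outside)

lemma val_diff: "val (c - d) x = val c x - val d x"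
  using val_add[of c "(-1) *\<^sub>R d" x] val_scaleR[of "-1" d x] by simp

lemma sq_int_eq_AE_val_der:
  assumes "sq_int h" "\<And>x. x \<in> {0..1} \<Longrightarrow> val c x = integral {0..x} h"
  shows "AE x in I01. der c x = h x"
  by (rule weak_deriv_AE_unique[OF weak_deriv_val]) (use assms in \<open>auto simp: weak_deriv_def\<close>)

lemma der_diff_AE: "AE x in I01. der (c - d) x = der c x - der d x"
proof (rule sq_int_eq_AE_val_der)
  show "sq_int (\<lambda>x. der c x - der d x)" by (intro sq_int_diff sq_int_der)
  fix x :: real assume x: "x \<in> {0..1}"
  have "integral {0..x} (\<lambda>y. der c y - der d y) = integral {0..x} (der c) - integral {0..x} (der d)"
    using sq_int_integrable_on[OF sq_int_der, of 0 x] x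
    by (intro Henstock_Kurzweil_Integration.integral_diff) auto
  then show "val (c - d) x = integral {0..x} (\<lambda>x. der c x - der d x)"
    using x by (simp add: val_diff val_eq_integral)
qed

lemma L2norm_der_diff: "L2norm (\<lambda>x. der c x - der d x) = norm (c - d)"
  using L2norm_cong_AE[OF sq_int_der sq_int_diff[OF sq_int_der sq_int_der] der_diff_AE[of c d]]
  by (simp add: L2norm_der)

text \<open>Integration by parts against \<open>cosb\<close>: the boundary term carries the total
  integral of \<open>g\<close>, which is \<open>u 1 - u 0 = 0\<close>.\<close>

lemma scoef_H10:
  assumes "weak_deriv u g" "u 0 = 0" "u 1 = 0"
  shows "kap k * scoef u k = ccoef g k"
proof -
  have s: "sq_int g" by (rule weak_deriv_sq_int[OF assms(1)])
  have z: "integral {0..1} g = 0" using weak_deriv_integral[OF assms(1), of 1] assms by simp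
  have "(LINT x|I01. - kap k * sinb k x * integral {0..x} g) = cosb k 1 * integral {0..1} g - (LINT x|I01. cosb k x * g x)"
    by (intro LINT_by_parts s cosb_deriv continuous_intros)
  moreover have "(LINT x|I01. - kap k * sinb k x * integral {0..x} g) = - kap k * scoef u k"
  proof -
    have "(LINT x|I01. - kap k * sinb k x * integral {0..x} g) = (LINT x|I01. - kap k * (u x * sinb k x))"
      using assms by (intro Bochner_Integration.integral_cong) (auto simp: weak_deriv_integral)
    then show ?thesis by (simp add: scoef_def)
  qed
  ultimately show ?thesis using z by (simp add: ccoef_def mult.commute)
qed

lemma scoef_val: "scoef (val c) k = coord c k / kap k"
  using scoef_H10[OF weak_deriv_val val_0 val_1, of k c] ccoef_der[of c k]
  by (simp add: field_simps)

lemma val_inject: "val c = val d \<Longrightarrow> c = d"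
proof (rule ell2_eqI)
  fix k assume "val c = val d"
  then have "scoef (val c) k = scoef (val d) k" by simp
  then show "coord c k = coord d k" by (simp add: scoef_val)
qed

lemma scoef_diff: "sq_int f \<Longrightarrow> sq_int g \<Longrightarrow> scoef (\<lambda>x. f x - g x) k = scoef f k - scoef g k"
  unfolding scoef_def by (simp add: left_diff_distrib integrable_sq_int_mult)

text \<open>Given u, the cosine coefficients of a weak derivative are square-summable by Bessel and
  supply \<open>c\<close>. Then \<open>u\<close> and \<open>val c\<close> share all sine
  coefficients, and completeness of the sines among continuous functions identifies them.\<close>

theorem H10_eq_range_val: "H10 = range val"
proof (intro equalityI subsetI)
  fix u assume "u \<in> H10"
  then obtain g where g: "weak_deriv u g" "u 0 = 0" "u 1 = 0" and out: "\<And>x. x \<notin> {0..1} \<Longrightarrow> u x = 0"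
    unfolding H10_def by auto
  have s: "sq_int g" by (rule weak_deriv_sq_int[OF g(1)])
  obtain c where c: "coord c = ccoef g"
    using ell2_exists[of "ccoef g"] cosb_Bessel[OF s] by blast
  have contu: "continuous_on {0..1} u"
  proof -
    have "continuous_on {0..1} (\<lambda>x. integral {0..x} g)"
      using sq_int_integrable_on[OF s, of 0 1] by (intro indefinite_integral_continuous_1) auto
    then show ?thesis
      by (rule continuous_on_eq) (simp add: weak_deriv_integral[OF g(1)] g(2))
  qed
  have "u x = val c x" for x
  proof (cases "x \<in> {0..1}")
    case True
    have "scoef (\<lambda>x. u x - val c x) k = 0" for k
    proof -
      have "kap k * scoef u k = kap k * scoef (val c) k"
        using scoef_H10[OF g] by (simp add: scoef_val c)
      then show ?thesis
        using scoef_diff[OF sq_int_continuous[OF contu] sq_int_val] by simp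
    qed
    then have "u x - val c x = 0"
      by (intro sine_complete[of "\<lambda>x. u x - val c x" x] continuous_intros contu continuous_on_val True)
    then show ?thesis by simp
  qed (simp add: out val_outside)
  then show "u \<in> range val" by blast
qed (use val_in_H10 in blast)

section \<open>Energy estimates for diagonal parabolic systems\<close>

lemma integral_DERIV_interior:
  fixes f :: "real \<Rightarrow> real"
  assumes "continuous_on {0..T} f" "0 < t" "t < T"
  shows "((\<lambda>t. integral {0..t} f) has_real_derivative f t) (at t)"
  using integral_has_real_derivative[of 0 T f t] assms by (simp add: at_within_Icc_at)

lemma gronwall_integral:
  fixes f :: "real \<Rightarrow> real"
  assumes cont: "continuous_on {0..T} f" and B: "0 \<le> B"
    and le: "\<And>t. t \<in> {0..T} \<Longrightarrow> f t \<le> A + B * integral {0..t} f"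
    and t: "t \<in> {0..T}"
  shows "f t \<le> A * exp (B * t)"
proof -
  \<comment> \<open>The exponential factor makes the right-hand side \<open>A + B * integral\<close>
    nonincreasing, so its value at 0 bounds it.\<close>
  define F where "F t = exp (- B * t) * (A + B * integral {0..t} f)" for t
  have contF: "continuous_on {0..T} F"
    unfolding F_def
    by (intro continuous_intros indefinite_integral_continuous_1 integrable_continuous_real cont)
  note dI = integral_DERIV_interior[OF cont]
  have "F t \<le> F 0"
  proof (cases "t = 0")
    case False
    have "0 \<le> t" using t by auto
    then show ?thesis
    proof (rule DERIV_nonpos_imp_decreasing_open)
      fix s assume s: "0 < s" "s < t"
      then have sT: "s < T" "s \<in> {0..T}" using t by auto
      have "(F has_real_derivative exp (- B * s) * (B * f s) + (- B * exp (- B * s)) * (A + B * integral {0..s} f)) (at s)"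
        unfolding F_def by (rule derivative_eq_intros refl dI s sT | simp add: algebra_simps)+
      moreover have "exp (- B * s) * (B * f s) + (- B * exp (- B * s)) * (A + B * integral {0..s} f) \<le> 0"
      proof -
        have "exp (- B * s) * B * (f s - (A + B * integral {0..s} f)) \<le> 0"
          using le[OF sT(2)] B by (intro mult_nonneg_nonpos) auto
        then show ?thesis by (simp add: algebra_simps)
      qed
      ultimately show "\<exists>y. DERIV F s :> y \<and> y \<le> 0" by blast
    next
      show "continuous_on {0..t} F"
        using t by (intro continuous_on_subset[OF contF]) auto
    qed
  qed simp
  then have "exp (- B * t) * (A + B * integral {0..t} f) \<le> A" by (simp add: F_def)
  then have "exp (B * t) * (exp (- B * t) * (A + B * integral {0..t} f)) \<le> exp (B * t) * A"
    by (intro mult_left_mono) auto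
  then have "A + B * integral {0..t} f \<le> exp (B * t) * A"
    by (simp add: mult.assoc[symmetric] exp_add[symmetric])
  then show ?thesis using le[OF t] by (simp add: mult.commute)
qed

text \<open>Completing the square in \<open>(a\<^sup>2)' = - 2 k\<^sup>2 a\<^sup>2 + 2 k a g\<close> gives the bound without any singular kernel.\<close>

lemma scalar_energy:
  fixes a g :: "real \<Rightarrow> real"
  assumes ca: "continuous_on {0..T} a" and cg: "continuous_on {0..T} g"
    and d: "\<And>t. 0 < t \<Longrightarrow> t < T \<Longrightarrow> (a has_real_derivative (- k\<^sup>2 * a t + k * g t)) (at t)"
    and t: "t \<in> {0..T}"
  shows "(a t)\<^sup>2 + k\<^sup>2 * integral {0..t} (\<lambda>s. (a s)\<^sup>2) \<le> (a 0)\<^sup>2 + integral {0..t} (\<lambda>s. (g s)\<^sup>2)"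
proof (cases "t = 0")
  case False
  then have t0: "0 < t" using t by auto
  define F where "F t = (a t)\<^sup>2 + k\<^sup>2 * integral {0..t} (\<lambda>s. (a s)\<^sup>2) - integral {0..t} (\<lambda>s. (g s)\<^sup>2)" for t
  have ca2: "continuous_on {0..T} (\<lambda>s. (a s)\<^sup>2)" and cg2: "continuous_on {0..T} (\<lambda>s. (g s)\<^sup>2)"
    by (intro continuous_intros ca cg)+
  have contF: "continuous_on {0..T} F" unfolding F_def
    by (intro continuous_intros indefinite_integral_continuous_1 integrable_continuous_real ca2 cg2 ca)
  have "F t \<le> F 0"
  proof (rule DERIV_nonpos_imp_decreasing_open[OF less_imp_le[OF t0]])
    fix s assume s: "0 < s" "s < t"
    then have sT: "s < T" using t by auto
    have "(F has_real_derivative 2 * (- k\<^sup>2 * a s + k * g s) * a s + k\<^sup>2 * (a s)\<^sup>2 - (g s)\<^sup>2) (at s)"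
      unfolding F_def
      by (rule derivative_eq_intros refl integral_DERIV_interior[OF ca2] integral_DERIV_interior[OF cg2] d s sT | simp)+
    moreover have "2 * (- k\<^sup>2 * a s + k * g s) * a s + k\<^sup>2 * (a s)\<^sup>2 - (g s)\<^sup>2 = - (k * a s - g s)\<^sup>2"
      by (simp add: power2_eq_square algebra_simps)
    ultimately show "\<exists>y. DERIV F s :> y \<and> y \<le> 0" by (metis neg_le_0_iff_le zero_le_power2)
  next
    show "continuous_on {0..t} F" using t by (intro continuous_on_subset[OF contF]) auto
  qed
  then show ?thesis by (simp add: F_def)
qed simp

text \<open>Kept at finitely many coordinates because the forcing need not be controlled in
  \<open>ell2\<close> at each time: in the scaling estimate its square sum is bounded only after
  integration in time.\<close>

lemma energy_sum:
  fixes a g :: "nat \<Rightarrow> real \<Rightarrow> real"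
  assumes ca: "\<And>k. continuous_on {0..T} (a k)" and cg: "\<And>k. continuous_on {0..T} (g k)"
    and d: "\<And>k t. 0 < t \<Longrightarrow> t < T \<Longrightarrow> (a k has_real_derivative (- (kap k)\<^sup>2 * a k t + kap k * g k t)) (at t)"
    and t: "t \<in> {0..T}"
  shows "(\<Sum>k<n. (a k t)\<^sup>2) + (\<Sum>k<n. (kap k)\<^sup>2 * integral {0..t} (\<lambda>s. (a k s)\<^sup>2))
    \<le> (\<Sum>k<n. (a k 0)\<^sup>2) + integral {0..t} (\<lambda>s. \<Sum>k<n. (g k s)\<^sup>2)"
proof -
  have sub: "{0..t} \<subseteq> {0..T}" using t by auto
  have "integral {0..t} (\<lambda>s. \<Sum>k<n. (g k s)\<^sup>2) = (\<Sum>k<n. integral {0..t} (\<lambda>s. (g k s)\<^sup>2))"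
    by (intro Henstock_Kurzweil_Integration.integral_sum integrable_continuous_real continuous_intros
        continuous_on_subset[OF cg sub]) auto
  moreover have "(\<Sum>k<n. (a k t)\<^sup>2 + (kap k)\<^sup>2 * integral {0..t} (\<lambda>s. (a k s)\<^sup>2))
      \<le> (\<Sum>k<n. (a k 0)\<^sup>2 + integral {0..t} (\<lambda>s. (g k s)\<^sup>2))"
    by (intro sum_mono scalar_energy[OF ca cg d t])
  ultimately show ?thesis by (simp add: sum.distrib)
qed

text \<open>Only coordinatewise continuity of \<open>c\<close> is assumed, so the first bound is
  available before continuity in norm is known. The second bound is maximal regularity: one more
  derivative, square-integrable in time.\<close>

lemma ell2_energy:
  fixes c :: "real \<Rightarrow> ell2" and g :: "nat \<Rightarrow> real \<Rightarrow> real"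
  assumes ca: "\<And>k. continuous_on {0..T} (\<lambda>t. coord (c t) k)" and cg: "\<And>k. continuous_on {0..T} (g k)"
    and d: "\<And>k t. 0 < t \<Longrightarrow> t < T \<Longrightarrow>
      ((\<lambda>t. coord (c t) k) has_real_derivative (- (kap k)\<^sup>2 * coord (c t) k + kap k * g k t)) (at t)"
    and h: "continuous_on {0..T} h" "\<And>n s. s \<in> {0..T} \<Longrightarrow> (\<Sum>k<n. (g k s)\<^sup>2) \<le> h s"
    and t: "t \<in> {0..T}"
  shows "(norm (c t))\<^sup>2 \<le> (norm (c 0))\<^sup>2 + integral {0..t} h"
    and "(\<Sum>k<n. (kap k)\<^sup>2 * integral {0..t} (\<lambda>s. (coord (c s) k)\<^sup>2)) \<le> (norm (c 0))\<^sup>2 + integral {0..t} h"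
proof -
  have sub: "{0..t} \<subseteq> {0..T}" using t by auto
  have *: "(\<Sum>k<n. (coord (c t) k)\<^sup>2) + (\<Sum>k<n. (kap k)\<^sup>2 * integral {0..t} (\<lambda>s. (coord (c s) k)\<^sup>2))
      \<le> (norm (c 0))\<^sup>2 + integral {0..t} h" for n
  proof -
    have "integral {0..t} (\<lambda>s. \<Sum>k<n. (g k s)\<^sup>2) \<le> integral {0..t} h"
      using sub by (intro integral_le integrable_continuous_real continuous_intros
          continuous_on_subset[OF cg sub] continuous_on_subset[OF h(1) sub] h(2)) auto
    then show ?thesis
      using energy_sum[of T "\<lambda>k t. coord (c t) k" g t n, OF ca cg d t] sum_coord_sq_le[of "{..<n}" "c 0"]
      by simp
  qed
  have nn: "0 \<le> (\<Sum>k<n. (kap k)\<^sup>2 * integral {0..t} (\<lambda>s. (coord (c s) k)\<^sup>2))" for n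
    by (intro sum_nonneg mult_nonneg_nonneg Henstock_Kurzweil_Integration.integral_nonneg
        integrable_continuous_real continuous_intros continuous_on_subset[OF ca sub]) auto
  show "(norm (c t))\<^sup>2 \<le> (norm (c 0))\<^sup>2 + integral {0..t} h"
    by (rule norm_sq_leI) (use * nn in \<open>smt (verit)\<close>)
  show "(\<Sum>k<n. (kap k)\<^sup>2 * integral {0..t} (\<lambda>s. (coord (c s) k)\<^sup>2)) \<le> (norm (c 0))\<^sup>2 + integral {0..t} h"
    using *[of n] sum_nonneg[of "{..<n}" "\<lambda>k. (coord (c t) k)\<^sup>2"] by simp
qed

section \<open>Evolution equations with a Lipschitz nonlinearity\<close>

text \<open>The equation is imposed coordinate by coordinate and only at interior times: at the
  level of V the terms \<open>(kap k)^2 * coord (c t) k\<close> need not form an element of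
  \<open>ell2\<close>, in particular at time 0. What is required in norm is continuity up to both
  ends.\<close>

definition solves :: "(ell2 \<Rightarrow> ell2) \<Rightarrow> (real \<Rightarrow> ell2) \<Rightarrow> real \<Rightarrow> bool" where
  "solves G c T \<longleftrightarrow> continuous_on {0..T} c \<and> (\<forall>k t. 0 < t \<and> t < T \<longrightarrow>
     ((\<lambda>t. coord (c t) k) has_real_derivative (- (kap k)\<^sup>2 * coord (c t) k + kap k * coord (G (c t)) k)) (at t))"

lemma solves_continuous: "solves G c T \<Longrightarrow> continuous_on {0..T} c"
  by (simp add: solves_def)

lemma solves_deriv:
  "solves G c T \<Longrightarrow> 0 < t \<Longrightarrow> t < T \<Longrightarrow>
     ((\<lambda>t. coord (c t) k) has_real_derivative (- (kap k)\<^sup>2 * coord (c t) k + kap k * coord (G (c t)) k)) (at t)"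
  by (simp add: solves_def)

lemma solves_mono: "solves G c T \<Longrightarrow> S \<le> T \<Longrightarrow> solves G c S"
  unfolding solves_def by (auto intro: continuous_on_subset)

lemma solves_cong:
  assumes "solves G c T" "\<And>t. t \<in> {0..T} \<Longrightarrow> c t = d t"
  shows "solves G d T"
  unfolding solves_def
proof (intro conjI allI impI)
  show "continuous_on {0..T} d"
    by (rule continuous_on_eq[OF solves_continuous[OF assms(1)] assms(2)])
  fix k t assume t: "0 < t \<and> t < T"
  have ev: "\<forall>\<^sub>F s in nhds t. coord (c s) k = coord (d s) k"
    using t assms(2) by (intro eventually_nhds_in_open[of "{0<..<T}", THEN eventually_mono]) auto
  show "((\<lambda>t. coord (d t) k) has_real_derivative - (kap k)\<^sup>2 * coord (d t) k + kap k * coord (G (d t)) k) (at t)"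
    using solves_deriv[OF assms(1), of t k] t assms(2)[of t] DERIV_cong_ev[OF refl ev refl] by auto
qed

lemma solves_cong_nonlinearity:
  assumes "solves G c T" "\<And>t. 0 < t \<Longrightarrow> t < T \<Longrightarrow> G (c t) = G' (c t)"
  shows "solves G' c T"
  using assms unfolding solves_def by auto

definition duhamel :: "ell2 \<Rightarrow> (real \<Rightarrow> ell2) \<Rightarrow> real \<Rightarrow> nat \<Rightarrow> real" where
  "duhamel c0 g t k = exp (- (kap k)\<^sup>2 * t) *
     (coord c0 k + integral {0..t} (\<lambda>s. exp ((kap k)\<^sup>2 * s) * (kap k * coord (g s) k)))"

text \<open>Each coordinate is solved by variation of constants. The energy bound puts the result in
  \<open>ell2\<close>; applied to tails of the sequences, it gives continuity in norm.\<close>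

lemma duhamel_exists:
  assumes g: "continuous_on {0..T} g"
  shows "\<exists>c. c 0 = c0 \<and> continuous_on {0..T} c \<and> (\<forall>k t. 0 < t \<and> t < T \<longrightarrow>
     ((\<lambda>t. coord (c t) k) has_real_derivative (- (kap k)\<^sup>2 * coord (c t) k + kap k * coord (g t) k)) (at t))"
proof -
  define a where "a k t = duhamel c0 g t k" for k t
  have ci: "continuous_on {0..T} (\<lambda>s. exp ((kap k)\<^sup>2 * s) * (kap k * coord (g s) k))" for k
    by (intro continuous_intros g)
  have ca: "continuous_on {0..T} (a k)" for k
    unfolding a_def duhamel_def
    by (intro continuous_intros indefinite_integral_continuous_1 integrable_continuous_real ci)
  have cg: "continuous_on {0..T} (\<lambda>t. coord (g t) k)" for k by (intro continuous_intros g)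
  have da: "(a k has_real_derivative (- (kap k)\<^sup>2 * a k t + kap k * coord (g t) k)) (at t)"
    if t: "0 < t" "t < T" for k t
  proof -
    let ?f = "\<lambda>s. exp ((kap k)\<^sup>2 * s) * (kap k * coord (g s) k)"
    note dI = integral_DERIV_interior[OF ci t]
    have "(a k has_real_derivative exp (- (kap k)\<^sup>2 * t) * ?f t
        + (- (kap k)\<^sup>2 * exp (- (kap k)\<^sup>2 * t)) * (coord c0 k + integral {0..t} ?f)) (at t)"
      unfolding a_def duhamel_def by (rule derivative_eq_intros refl dI | simp add: algebra_simps)+
    moreover have "exp (- (kap k)\<^sup>2 * t) * ?f t = kap k * coord (g t) k"
      by (simp add: mult.assoc[symmetric] exp_add[symmetric])
    ultimately have "(a k has_real_derivative kap k * coord (g t) k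
        + (- (kap k)\<^sup>2 * exp (- (kap k)\<^sup>2 * t)) * (coord c0 k + integral {0..t} ?f)) (at t)"
      by (simp only:)
    moreover have "kap k * coord (g t) k + (- (kap k)\<^sup>2 * exp (- (kap k)\<^sup>2 * t)) * (coord c0 k + integral {0..t} ?f)
        = - (kap k)\<^sup>2 * a k t + kap k * coord (g t) k"
      by (simp add: a_def duhamel_def mult.assoc)
    ultimately show ?thesis by (simp only:)
  qed
  have a0: "a k 0 = coord c0 k" for k by (simp add: a_def duhamel_def)
  have cn: "continuous_on {0..T} (\<lambda>s. (norm (g s))\<^sup>2)" by (intro continuous_intros g)
  have "\<exists>x. coord x = (\<lambda>k. a k t)" if t: "t \<in> {0..T}" for t
  proof -
    have sub: "{0..t} \<subseteq> {0..T}" using t by auto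
    have "(\<Sum>k<n. (a k t)\<^sup>2) \<le> (norm c0)\<^sup>2 + integral {0..t} (\<lambda>s. (norm (g s))\<^sup>2)" for n
    proof -
      have "integral {0..t} (\<lambda>s. \<Sum>k<n. (coord (g s) k)\<^sup>2) \<le> integral {0..t} (\<lambda>s. (norm (g s))\<^sup>2)"
        by (intro integral_le integrable_continuous_real continuous_intros
            continuous_on_subset[OF g sub] sum_coord_sq_le) auto
      moreover have "0 \<le> (\<Sum>k<n. (kap k)\<^sup>2 * integral {0..t} (\<lambda>s. (a k s)\<^sup>2))"
        by (intro sum_nonneg mult_nonneg_nonneg Henstock_Kurzweil_Integration.integral_nonneg
            integrable_continuous_real continuous_intros continuous_on_subset[OF ca sub]) auto
      ultimately show ?thesis
        using energy_sum[of T a "\<lambda>k t. coord (g t) k" t n, OF ca cg da t] sum_coord_sq_le[of "{..<n}" c0]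
        by (simp add: a0)
    qed
    then show ?thesis
      using ell2_exists[of "\<lambda>k. a k t" "(norm c0)\<^sup>2 + integral {0..t} (\<lambda>s. (norm (g s))\<^sup>2)"] by blast
  qed
  then obtain c where c: "\<And>t. t \<in> {0..T} \<Longrightarrow> coord (c t) = (\<lambda>k. a k t)" by metis
  have cc: "continuous_on {0..T} (\<lambda>t. coord (c t) k)" for k
    by (rule continuous_on_eq[OF ca[of k]]) (simp add: c)
  have dc: "((\<lambda>t. coord (c t) k) has_real_derivative (- (kap k)\<^sup>2 * coord (c t) k + kap k * coord (g t) k)) (at t)"
    if t: "0 < t" "t < T" for k t
  proof -
    have ev: "\<forall>\<^sub>F s in nhds t. a k s = coord (c s) k"
      using t c by (intro eventually_nhds_in_open[of "{0<..<T}", THEN eventually_mono]) auto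
    show ?thesis using da[OF t, of k] t c[of t] DERIV_cong_ev[OF refl ev refl] by auto
  qed
  have "continuous_on {0..T} c"
  proof (cases "0 \<le> T")
    case T: True
    have lim: "uniform_limit {0..T} (\<lambda>n t. ell2_trunc n (c t)) c sequentially"
    proof (rule uniform_limitI)
      fix e :: real assume e: "0 < e"
      \<comment> \<open>Chosen so that \<open>(T + 1) * e'\<close>, the contribution of the initial
        tail plus that of the forcing tail over the whole interval, equals e^2 / 2.\<close>
      define e' where "e' = e\<^sup>2 / (2 * (T + 1))"
      have e': "0 < e'" using e T by (simp add: e'_def)
      have "\<forall>\<^sub>F n in sequentially. \<forall>s\<in>{0..T}. dist (ell2_trunc n (g s)) (g s) < sqrt e'"
        using uniform_limit_ell2_trunc[OF _ g] e' by (intro uniform_limitD) auto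
      moreover have "\<forall>\<^sub>F n in sequentially. dist (ell2_trunc n c0) c0 < sqrt e'"
        using e' by (intro tendstoD[OF ell2_trunc_tendsto]) auto
      ultimately show "\<forall>\<^sub>F n in sequentially. \<forall>t\<in>{0..T}. dist (ell2_trunc n (c t)) (c t) < e"
      proof eventually_elim
        case (elim N)
        show ?case
        proof
          fix t assume t: "t \<in> {0..T}"
          have c0: "c 0 = c0" by (rule ell2_eqI) (simp add: c T a0)
          have sq: "(norm (x - ell2_trunc N x))\<^sup>2 \<le> e'" if "dist (ell2_trunc N x) x < sqrt e'" for x
            using that e' power_mono[of "norm (x - ell2_trunc N x)" "sqrt e'" 2]
            by (simp add: dist_norm norm_minus_commute)
          \<comment> \<open>The tails solve the same diagonal system with the tail of
            \<open>g\<close> as forcing, so small tails of \<open>c0\<close> and \<open>g\<close>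
            force small tails of \<open>c\<close> uniformly in time.\<close>
          have "(norm (c t - ell2_trunc N (c t)))\<^sup>2 \<le> (norm (c 0 - ell2_trunc N (c 0)))\<^sup>2 + integral {0..t} (\<lambda>_. e')"
          proof (rule ell2_energy(1)[where T=T and g="\<lambda>k t. coord (g t - ell2_trunc N (g t)) k"])
            fix k
            show "continuous_on {0..T} (\<lambda>t. coord (c t - ell2_trunc N (c t)) k)"
              using cc[of k] by (cases "k < N") (simp_all add: coord_ell2_trunc)
            show "continuous_on {0..T} (\<lambda>t. coord (g t - ell2_trunc N (g t)) k)"
              using cg[of k] by (cases "k < N") (simp_all add: coord_ell2_trunc)
            fix t assume "0 < t" "t < T"
            then show "((\<lambda>t. coord (c t - ell2_trunc N (c t)) k) has_real_derivative
                - (kap k)\<^sup>2 * coord (c t - ell2_trunc N (c t)) k + kap k * coord (g t - ell2_trunc N (g t)) k) (at t)"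
              using dc[of t k] by (cases "k < N") (simp_all add: coord_ell2_trunc)
          next
            fix n s assume "s \<in> {0..T}"
            then show "(\<Sum>k<n. (coord (g s - ell2_trunc N (g s)) k)\<^sup>2) \<le> e'"
              using elim(1) by (intro order_trans[OF sum_coord_sq_le] sq) auto
          qed (use t in auto)
          also have "\<dots> \<le> e' + t * e'" using sq[OF elim(2)] t by (simp add: c0)
          also have "\<dots> \<le> (T + 1) * e'" using t e' by (simp add: algebra_simps mult_right_mono)
          also have "\<dots> = e\<^sup>2 / 2"
            using T unfolding e'_def by (simp add: field_simps)
          also have "\<dots> < e\<^sup>2" using e by simp
          finally have "norm (c t - ell2_trunc N (c t)) < e" using e by (simp add: power2_less_imp_less)
          then show "dist (ell2_trunc N (c t)) (c t) < e" by (simp add: dist_norm norm_minus_commute)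
        qed
      qed
    qed
    show ?thesis
      by (rule uniform_limit_theorem[OF _ lim]) (auto intro!: always_eventually continuous_on_ell2_trunc cc)
  qed simp
  moreover have "c 0 = c0" if "0 \<le> T" by (rule ell2_eqI) (simp add: c that a0)
  ultimately show ?thesis
  proof (cases "0 \<le> T")
    \<comment> \<open>For negative \<open>T\<close> the conditions on the interval are vacuous and
      only the initial value has to be met.\<close>
    case False
    then show ?thesis by (intro exI[of _ "\<lambda>_. c0"]) auto
  qed (use dc in blast)
qed

text \<open>The Lipschitz bound is asked for along the two curves only, so a locally Lipschitz
  nonlinearity qualifies once both curves are known to stay in a ball.\<close>

lemma solves_difference_bound:
  assumes c: "solves G c T" and d: "solves G d T"
    and G: "continuous_on UNIV G"
    and L: "\<And>t. t \<in> {0..T} \<Longrightarrow> norm (G (c t) - G (d t)) \<le> L * norm (c t - d t)"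
    and t: "t \<in> {0..T}"
  shows "(norm (c t - d t))\<^sup>2 \<le> (norm (c 0 - d 0))\<^sup>2 * exp (L\<^sup>2 * t)"
proof -
  note cc = solves_continuous[OF c] solves_continuous[OF d]
  have Gc: "continuous_on {0..T} (\<lambda>t. G (c t))" "continuous_on {0..T} (\<lambda>t. G (d t))"
    by (intro continuous_on_compose2[OF G] cc; simp)+
  have step: "(norm (c t - d t))\<^sup>2 \<le> (norm (c 0 - d 0))\<^sup>2 + L\<^sup>2 * integral {0..t} (\<lambda>s. (norm (c s - d s))\<^sup>2)"
    if t: "t \<in> {0..T}" for t
  proof -
    have "(norm (c t - d t))\<^sup>2 \<le> (norm (c 0 - d 0))\<^sup>2 + integral {0..t} (\<lambda>s. L\<^sup>2 * (norm (c s - d s))\<^sup>2)"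
    proof (rule ell2_energy(1)[where T=T and g="\<lambda>k t. coord (G (c t) - G (d t)) k"])
      fix k
      show "continuous_on {0..T} (\<lambda>t. coord (c t - d t) k)" "continuous_on {0..T} (\<lambda>t. coord (G (c t) - G (d t)) k)"
        by (intro continuous_intros cc Gc)+
      fix t assume t: "0 < t" "t < T"
      show "((\<lambda>t. coord (c t - d t) k) has_real_derivative
          - (kap k)\<^sup>2 * coord (c t - d t) k + kap k * coord (G (c t) - G (d t)) k) (at t)"
        using DERIV_diff[OF solves_deriv[OF c t, of k] solves_deriv[OF d t, of k]]
        by (simp add: algebra_simps)
    next
      fix n s assume s: "s \<in> {0..T}"
      have "(norm (G (c s) - G (d s)))\<^sup>2 \<le> (L * norm (c s - d s))\<^sup>2"
        by (intro power_mono L s) simp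
      then show "(\<Sum>k<n. (coord (G (c s) - G (d s)) k)\<^sup>2) \<le> L\<^sup>2 * (norm (c s - d s))\<^sup>2"
        by (intro order_trans[OF sum_coord_sq_le]) (auto simp: power_mult_distrib)
    qed (use t in \<open>auto intro!: continuous_intros cc\<close>)
    then show ?thesis by simp
  qed
  show ?thesis
    by (rule gronwall_integral[OF _ _ step t]) (auto intro!: continuous_intros cc)
qed

text \<open>Picard iteration for the Duhamel map. The squared increments are measured with the
  weight exp (mu t), which makes the map contract on the whole of [0, T] instead of on a short
  interval.\<close>

lemma solves_exists_lipschitz:
  assumes L: "\<And>x y. norm (G x - G y) \<le> L * norm (x - y)"
  shows "\<exists>c. c 0 = c0 \<and> solves G c T"
proof -
  have G: "continuous_on UNIV G"
  proof (rule lipschitz_on_continuous_on, rule lipschitz_onI)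
    fix x y :: ell2
    show "dist (G x) (G y) \<le> \<bar>L\<bar> * dist x y"
      unfolding dist_norm by (rule order_trans[OF L]) (intro mult_right_mono, auto)
  qed simp
  have "\<exists>d. d 0 = c0 \<and> continuous_on {0..T} d \<and> (\<forall>k t. 0 < t \<and> t < T \<longrightarrow>
     ((\<lambda>t. coord (d t) k) has_real_derivative (- (kap k)\<^sup>2 * coord (d t) k + kap k * coord (G (c t)) k)) (at t))"
    if "continuous_on {0..T} c" for c
    by (rule duhamel_exists) (intro continuous_on_compose2[OF G that], simp)
  then obtain Phi where Phi: "\<And>c. continuous_on {0..T} c \<Longrightarrow> Phi c 0 = c0"
      "\<And>c. continuous_on {0..T} c \<Longrightarrow> continuous_on {0..T} (Phi c)"
      "\<And>c k t. continuous_on {0..T} c \<Longrightarrow> 0 < t \<Longrightarrow> t < T \<Longrightarrow>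
        ((\<lambda>t. coord (Phi c t) k) has_real_derivative (- (kap k)\<^sup>2 * coord (Phi c t) k + kap k * coord (G (c t)) k)) (at t)"
    by metis
  have Phi_diff: "(norm (Phi c t - Phi d t))\<^sup>2 \<le> L\<^sup>2 * integral {0..t} (\<lambda>s. (norm (c s - d s))\<^sup>2)"
    if c: "continuous_on {0..T} c" and d: "continuous_on {0..T} d" and t: "t \<in> {0..T}" for c d t
  proof -
    have "(norm (Phi c t - Phi d t))\<^sup>2 \<le> (norm (Phi c 0 - Phi d 0))\<^sup>2 + integral {0..t} (\<lambda>s. L\<^sup>2 * (norm (c s - d s))\<^sup>2)"
    proof (rule ell2_energy(1)[where T=T and g="\<lambda>k t. coord (G (c t) - G (d t)) k"])
      fix k
      show "continuous_on {0..T} (\<lambda>t. coord (Phi c t - Phi d t) k)"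
        by (intro continuous_intros Phi c d)
      show "continuous_on {0..T} (\<lambda>t. coord (G (c t) - G (d t)) k)"
        by (intro continuous_intros continuous_on_compose2[OF G c] continuous_on_compose2[OF G d]) auto
      fix t assume t: "0 < t" "t < T"
      show "((\<lambda>t. coord (Phi c t - Phi d t) k) has_real_derivative
          - (kap k)\<^sup>2 * coord (Phi c t - Phi d t) k + kap k * coord (G (c t) - G (d t)) k) (at t)"
        using DERIV_diff[OF Phi(3)[OF c t, of k] Phi(3)[OF d t, of k]]
        by (simp add: algebra_simps)
    next
      fix n s assume s: "s \<in> {0..T}"
      have "(norm (G (c s) - G (d s)))\<^sup>2 \<le> (L * norm (c s - d s))\<^sup>2"
        by (intro power_mono L) simp
      then show "(\<Sum>k<n. (coord (G (c s) - G (d s)) k)\<^sup>2) \<le> L\<^sup>2 * (norm (c s - d s))\<^sup>2"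
        by (intro order_trans[OF sum_coord_sq_le]) (auto simp: power_mult_distrib)
    qed (use t in \<open>auto intro!: continuous_intros c d\<close>)
    then show ?thesis using Phi(1)[OF c] Phi(1)[OF d] by simp
  qed
  define X where "X n = (Phi ^^ n) (\<lambda>_. c0)" for n
  have X0: "X 0 = (\<lambda>_. c0)" and XS: "X (Suc n) = Phi (X n)" for n by (simp_all add: X_def)
  have cX: "continuous_on {0..T} (X n)" for n
    by (induction n) (auto simp: X0 XS intro!: Phi(2))
  obtain K where K: "\<And>t. t \<in> {0..T} \<Longrightarrow> (norm (X 1 t - X 0 t))\<^sup>2 \<le> K"
  proof -
    have "bounded ((\<lambda>t. (norm (X 1 t - X 0 t))\<^sup>2) ` {0..T})"
      by (intro compact_imp_bounded compact_continuous_image continuous_intros cX compact_Icc)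
    then obtain K where "\<forall>y\<in>(\<lambda>t. (norm (X 1 t - X 0 t))\<^sup>2) ` {0..T}. norm y \<le> K"
      unfolding bounded_iff by blast
    then show ?thesis by (intro that[of K]) auto
  qed
  define K' where "K' = max K 0"
  have K': "0 \<le> K'" "\<And>t. t \<in> {0..T} \<Longrightarrow> (norm (X 1 t - X 0 t))\<^sup>2 \<le> K'"
    unfolding K'_def using order_trans[OF K max.cobounded1] by auto
  \<comment> \<open>Integrating the weight gains 1 / mu, so L^2 / mu is at most 1/4 and each
    iteration shrinks squared increments by that factor; the summand 1 keeps mu positive when L =
    0.\<close>
  define mu where "mu = 4 * L\<^sup>2 + 1"
  have mu: "0 < mu" "4 * L\<^sup>2 \<le> mu" by (simp_all add: mu_def add_nonneg_pos)
  have step: "(norm (X (Suc n) t - X n t))\<^sup>2 \<le> K' * exp (mu * t) * (1/4)^n" if "t \<in> {0..T}" for n t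
    using that
  proof (induction n arbitrary: t)
    case 0
    have "K' * 1 \<le> K' * exp (mu * t)" using 0 mu K' by (intro mult_left_mono) auto
    then show ?case using K'(2)[OF 0] by simp
  next
    case (Suc n)
    have sub: "{0..t} \<subseteq> {0..T}" using Suc.prems by auto
    have "(norm (X (Suc (Suc n)) t - X (Suc n) t))\<^sup>2 \<le> L\<^sup>2 * integral {0..t} (\<lambda>s. (norm (X (Suc n) s - X n s))\<^sup>2)"
      unfolding XS[of "Suc n"] XS[of n] using Phi_diff[OF cX[of "Suc n"] cX[of n] Suc.prems] by (simp add: XS)
    also have "\<dots> \<le> L\<^sup>2 * integral {0..t} (\<lambda>s. K' * exp (mu * s) * (1/4)^n)"
      using sub by (intro mult_left_mono integral_le Suc.IH integrable_continuous_real continuous_intros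
          continuous_on_subset[OF cX sub]) auto
    also have "integral {0..t} (\<lambda>s. K' * exp (mu * s) * (1/4)^n)
        = K' * exp (mu * t) / mu * (1/4)^n - K' * exp (mu * 0) / mu * (1/4)^n"
      using Suc.prems mu
      by (intro integral_unique fundamental_theorem_of_calculus)
         (auto simp: has_real_derivative_iff_has_vector_derivative[symmetric] intro!: derivative_eq_intros)
    also have "\<dots> \<le> K' * exp (mu * t) / mu * (1/4)^n"
      using K' mu by simp
    also have "L\<^sup>2 * (K' * exp (mu * t) / mu * (1/4)^n) \<le> (mu / 4) * (K' * exp (mu * t) / mu * (1/4)^n)"
      using mu K' by (intro mult_right_mono) auto
    also have "\<dots> = K' * exp (mu * t) * (1/4)^(Suc n)" using mu by simp
    finally show ?case by (simp add: mult_left_mono)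
  qed
  define Y where "Y = sqrt (K' * exp (mu * T))"
  have step': "norm (X (Suc n) t - X n t) \<le> Y * (1/2)^n" if t: "t \<in> {0..T}" for n t
  proof (rule power2_le_imp_le)
    have "(norm (X (Suc n) t - X n t))\<^sup>2 \<le> K' * exp (mu * t) * (1/4)^n" by (rule step[OF t])
    also have "\<dots> \<le> K' * exp (mu * T) * (1/4)^n"
      using K' mu t by (intro mult_right_mono mult_left_mono) auto
    also have "\<dots> = (Y * (1/2)^n)\<^sup>2"
    proof -
      have "((1/2::real)^n)\<^sup>2 = ((1/2)\<^sup>2)^n" by (simp only: power_mult[symmetric] mult.commute)
      then have "((1/2::real)^n)\<^sup>2 = (1/4)^n" by (simp add: power2_eq_square)
      moreover have "Y\<^sup>2 = K' * exp (mu * T)" using K' by (simp add: Y_def)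
      ultimately show ?thesis by (simp only: power_mult_distrib)
    qed
    finally show "(norm (X (Suc n) t - X n t))\<^sup>2 \<le> (Y * (1/2)^n)\<^sup>2" .
  qed (use K' in \<open>auto simp: Y_def\<close>)
  define c where "c t = c0 + (\<Sum>i. X (Suc i) t - X i t)" for t
  have "uniform_limit {0..T} (\<lambda>n t. \<Sum>i<n. X (Suc i) t - X i t) (\<lambda>t. \<Sum>i. X (Suc i) t - X i t) sequentially"
    by (rule Weierstrass_m_test[OF step']) (auto intro!: summable_mult summable_geometric)
  then have "uniform_limit {0..T} (\<lambda>n t. c0 + (\<Sum>i<n. X (Suc i) t - X i t)) c sequentially"
    unfolding c_def by (intro uniform_limit_intros)
  then have lim: "uniform_limit {0..T} X c sequentially"
    by (simp add: sum_lessThan_telescope[of "\<lambda>i. X i _"] X0)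
  have cc: "continuous_on {0..T} c"
    by (rule uniform_limit_theorem[OF _ lim]) (auto intro!: always_eventually cX)
  have fix1: "c t = Phi c t" if t: "t \<in> {0..T}" for t
  proof -
    have T: "0 \<le> T" using t by simp
    have "(\<lambda>n. X (Suc n) t) \<longlonglongrightarrow> c t"
      by (rule LIMSEQ_Suc[OF tendsto_uniform_limitI[OF lim t]])
    moreover have "(\<lambda>n. X (Suc n) t) \<longlonglongrightarrow> Phi c t"
    proof (rule LIMSEQ_I)
      fix e :: real assume e: "0 < e"
      \<comment> \<open>One application of \<open>Phi\<close> turns an error \<open>e'\<close> into
        at most \<open>\<bar>L\<bar> * (T + 1) * e'\<close>, which this choice keeps below e; the
        extra 1 keeps the denominator positive.\<close>
      define e' where "e' = e / (2 * (\<bar>L\<bar> * (T + 1) + 1))"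
      have pos: "0 < \<bar>L\<bar> * (T + 1) + 1" using T by (intro add_nonneg_pos mult_nonneg_nonneg) auto
      have e': "0 < e'" using e pos by (simp add: e'_def)
      have "\<forall>\<^sub>F n in sequentially. \<forall>s\<in>{0..T}. dist (X n s) (c s) < e'"
        using lim e' by (rule uniform_limitD)
      then obtain N where N: "\<And>n s. n \<ge> N \<Longrightarrow> s \<in> {0..T} \<Longrightarrow> dist (X n s) (c s) < e'"
        unfolding eventually_sequentially by blast
      have "norm (X (Suc n) t - Phi c t) < e" if n: "n \<ge> N" for n
      proof -
        have sub: "{0..t} \<subseteq> {0..T}" using t by auto
        have le: "(norm (X n s - c s))\<^sup>2 \<le> e'\<^sup>2" if "s \<in> {0..t}" for s
          using N[OF n, of s] that t by (intro power_mono) (auto simp: dist_norm)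
        have "(norm (X (Suc n) t - Phi c t))\<^sup>2 \<le> L\<^sup>2 * integral {0..t} (\<lambda>s. (norm (X n s - c s))\<^sup>2)"
          unfolding XS by (rule Phi_diff[OF cX cc t])
        also have "\<dots> \<le> L\<^sup>2 * integral {0..t} (\<lambda>s. e'\<^sup>2)"
          by (intro mult_left_mono integral_le le integrable_continuous_real continuous_intros
              continuous_on_subset[OF cX sub] continuous_on_subset[OF cc sub]) auto
        also have "\<dots> = (L * e')\<^sup>2 * t" using t by (simp add: power_mult_distrib)
        also have "\<dots> \<le> (L * e')\<^sup>2 * (T + 1)\<^sup>2"
        proof (intro mult_left_mono)
          have "t \<le> (T + 1) * 1" using t by simp
          also have "\<dots> \<le> (T + 1) * (T + 1)" using T by (intro mult_left_mono) auto
          finally show "t \<le> (T + 1)\<^sup>2" unfolding power2_eq_square .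
        qed simp
        also have "\<dots> = (\<bar>L\<bar> * (T + 1) * e')\<^sup>2" by (simp add: power_mult_distrib mult_ac)
        finally have "norm (X (Suc n) t - Phi c t) \<le> \<bar>L\<bar> * (T + 1) * e'"
          by (rule power2_le_imp_le) (use T e' in auto)
        also have "\<dots> \<le> (\<bar>L\<bar> * (T + 1) + 1) * e'" using e' by (simp add: algebra_simps)
        also have "\<dots> = e / 2" using pos by (simp add: e'_def field_simps)
        also have "\<dots> < e" using e by simp
        finally show ?thesis .
      qed
      then show "\<exists>N. \<forall>n\<ge>N. norm (X (Suc n) t - Phi c t) < e" by blast
    qed
    ultimately show ?thesis by (rule LIMSEQ_unique)
  qed
  \<comment> \<open>The equation is read off for \<open>Phi c\<close>, which is differentiable by
    construction; the fixed-point identity, valid only on [0, T], is used just inside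
    \<open>G\<close>.\<close>
  define d where "d t = Phi c t" for t
  have cd: "G (c t) = G (d t)" if "t \<in> {0..T}" for t using fix1[OF that] by (simp add: d_def)
  have "solves G d T"
    unfolding solves_def
  proof (intro conjI allI impI)
    show "continuous_on {0..T} d" unfolding d_def by (intro Phi(2) cc)
    fix k t assume t: "0 < t \<and> t < T"
    then show "((\<lambda>t. coord (d t) k) has_real_derivative - (kap k)\<^sup>2 * coord (d t) k + kap k * coord (G (d t)) k) (at t)"
      using Phi(3)[OF cc, of t k] cd[of t] unfolding d_def by simp
  qed
  moreover have "d 0 = c0" by (simp add: d_def Phi(1)[OF cc])
  ultimately show ?thesis by blast
qed

section \<open>The nonlinearity in sine coefficients\<close>

definition sc :: "(real \<Rightarrow> real) \<Rightarrow> ell2" where "sc g = Abs_ell2 (scoef g)"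

lemma coord_sc: "sq_int g \<Longrightarrow> coord (sc g) k = scoef g k"
  and norm_sc_le: "sq_int g \<Longrightarrow> norm (sc g) \<le> L2norm g"
proof -
  assume g: "sq_int g"
  obtain x where x: "coord x = scoef g" "(norm x)\<^sup>2 \<le> (L2norm g)\<^sup>2"
    using ell2_exists[of "scoef g"] sinb_Bessel[OF g] by blast
  then have "sc g = x" by (metis coord_inverse sc_def)
  then show "coord (sc g) k = scoef g k" "norm (sc g) \<le> L2norm g"
    using x by (auto intro: power2_le_imp_le)
qed

lemma sc_diff: "sq_int g \<Longrightarrow> sq_int h \<Longrightarrow> sc g - sc h = sc (\<lambda>x. g x - h x)"
  by (rule ell2_eqI) (simp add: coord_sc sq_int_diff scoef_diff)

lemma continuous_on_if_lipschitz_on_balls: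
  fixes G :: "'a::real_normed_vector \<Rightarrow> 'b::metric_space"
  assumes "\<And>rho. \<exists>L. \<forall>c d. norm c \<le> rho \<longrightarrow> norm d \<le> rho \<longrightarrow> dist (G c) (G d) \<le> L * norm (c - d)"
  shows "continuous_on UNIV G"
proof -
  have "continuous_on (ball 0 rho) G" for rho
  proof -
    obtain L where L: "\<And>c d. norm c \<le> rho \<Longrightarrow> norm d \<le> rho \<Longrightarrow> dist (G c) (G d) \<le> L * norm (c - d)"
      using assms[of rho] by blast
    have "\<bar>L\<bar>-lipschitz_on (ball 0 rho) G"
    proof (rule lipschitz_onI)
      fix x y :: 'a assume "x \<in> ball 0 rho" "y \<in> ball 0 rho"
      then have "dist (G x) (G y) \<le> L * norm (x - y)" by (intro L) auto
      also have "\<dots> \<le> \<bar>L\<bar> * norm (x - y)" by (intro mult_right_mono) auto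
      finally show "dist (G x) (G y) \<le> \<bar>L\<bar> * dist x y" by (simp add: dist_norm)
    qed simp
    then show ?thesis by (rule lipschitz_on_continuous_on)
  qed
  then have "continuous_on (\<Union>rho. ball 0 rho) G"
    by (intro continuous_on_open_UN) auto
  moreover have "(\<Union>rho. ball (0::'a) rho) = UNIV"
    by (auto intro: gt_ex)
  ultimately show ?thesis by simp
qed

locale reaction =
  fixes f f1 f2 r r1 r2 :: "real \<Rightarrow> real"
  assumes f1: "(f has_real_derivative f1 x) (at x)" and f2: "(f1 has_real_derivative f2 x) (at x)"
    and cont_f2: "continuous_on UNIV f2"
    and r1: "(r has_real_derivative r1 x) (at x)" and r2: "(r1 has_real_derivative r2 x) (at x)"
    and cont_r2: "continuous_on UNIV r2"
begin

lemma cont_f: "continuous_on S f" and cont_f1: "continuous_on S f1"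
  and cont_r: "continuous_on S r" and cont_r1: "continuous_on S r1"
  by (rule DERIV_continuous_on[OF has_field_derivative_at_within[OF f1]]
      DERIV_continuous_on[OF has_field_derivative_at_within[OF f2]]
      DERIV_continuous_on[OF has_field_derivative_at_within[OF r1]]
      DERIV_continuous_on[OF has_field_derivative_at_within[OF r2]])+

lemma bounds_exist:
  "\<exists>B\<ge>0. \<forall>x. \<bar>x\<bar> \<le> rho \<longrightarrow> \<bar>f1 x\<bar> \<le> B \<and> \<bar>f2 x\<bar> \<le> B \<and> \<bar>r x\<bar> \<le> B \<and> \<bar>r1 x\<bar> \<le> B \<and> \<bar>r2 x\<bar> \<le> B"
proof -
  have "\<exists>B. \<forall>x. \<bar>x\<bar> \<le> rho \<longrightarrow> \<bar>g x\<bar> \<le> B" if "continuous_on UNIV g" for g :: "real \<Rightarrow> real"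
  proof -
    have "bounded (g ` {-rho..rho})"
      by (intro compact_imp_bounded compact_continuous_image continuous_on_subset[OF that]) auto
    then obtain B where "\<forall>y\<in>g ` {-rho..rho}. norm y \<le> B" unfolding bounded_iff by blast
    then show ?thesis by (intro exI[of _ B]) (auto simp: abs_le_iff)
  qed
  note bd = this
  obtain B1 where B1: "\<And>x. \<bar>x\<bar> \<le> rho \<Longrightarrow> \<bar>f1 x\<bar> \<le> B1" using bd[OF cont_f1] by blast
  obtain B2 where B2: "\<And>x. \<bar>x\<bar> \<le> rho \<Longrightarrow> \<bar>f2 x\<bar> \<le> B2" using bd[OF cont_f2] by blast
  obtain B3 where B3: "\<And>x. \<bar>x\<bar> \<le> rho \<Longrightarrow> \<bar>r x\<bar> \<le> B3" using bd[OF cont_r] by blast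
  obtain B4 where B4: "\<And>x. \<bar>x\<bar> \<le> rho \<Longrightarrow> \<bar>r1 x\<bar> \<le> B4" using bd[OF cont_r1] by blast
  obtain B5 where B5: "\<And>x. \<bar>x\<bar> \<le> rho \<Longrightarrow> \<bar>r2 x\<bar> \<le> B5" using bd[OF cont_r2] by blast
  define B where "B = Max {0, B1, B2, B3, B4, B5}"
  have B: "0 \<le> B" "B1 \<le> B" "B2 \<le> B" "B3 \<le> B" "B4 \<le> B" "B5 \<le> B"
    unfolding B_def by (intro Max_ge; simp)+
  then show ?thesis
    using order_trans[OF B1 B(2)] order_trans[OF B2 B(3)] order_trans[OF B3 B(4)]
      order_trans[OF B4 B(5)] order_trans[OF B5 B(6)] by (intro exI[of _ B]) auto
qed

definition FFfun :: "ell2 \<Rightarrow> real \<Rightarrow> real" where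
  "FFfun c x = - f1 (val c x) * der c x + r (val c x)"

definition FF :: "ell2 \<Rightarrow> ell2" where "FF c = sc (FFfun c)"

lemma cont_val_comp:
  "continuous_on UNIV g \<Longrightarrow> continuous_on {0..1} (\<lambda>x. g (val c x))" for g :: "real \<Rightarrow> real"
  by (rule continuous_on_compose2[OF _ continuous_on_val]) auto

lemma sq_int_FFfun: "sq_int (FFfun c)"
  unfolding FFfun_def[abs_def]
  by (intro sq_int_add sq_int_mult_continuous sq_int_der continuous_on_minus cont_val_comp cont_f1
      sq_int_continuous cont_r)

lemma coord_FF: "coord (FF c) k = scoef (FFfun c) k"
  unfolding FF_def by (rule coord_sc[OF sq_int_FFfun])

lemma norm_FF_diff_le: "norm (FF c - FF d) \<le> L2norm (\<lambda>x. FFfun c x - FFfun d x)"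
  unfolding FF_def sc_diff[OF sq_int_FFfun sq_int_FFfun]
  by (intro norm_sc_le sq_int_diff sq_int_FFfun)

lemma lipschitz_bound:
  fixes g g' :: "real \<Rightarrow> real"
  assumes "\<And>x. (g has_real_derivative g' x) (at x)" "\<And>x. \<bar>x\<bar> \<le> rho \<Longrightarrow> \<bar>g' x\<bar> \<le> B"
    and "\<bar>x\<bar> \<le> rho" "\<bar>y\<bar> \<le> rho"
  shows "\<bar>g x - g y\<bar> \<le> B * \<bar>x - y\<bar>"
  using field_differentiable_bound[of "{-rho..rho}" g g' B x y] assms
  by (auto intro: has_field_derivative_at_within simp: abs_le_iff)

text \<open>Values are bounded pointwise by the norm of V, and the derivative, which is not, enters
  linearly. In the difference of the products one term carries the difference of derivatives with a
  bounded factor, the other the difference of \<open>f1\<close> in sup norm with a derivative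
  bounded in L^2.\<close>

lemma FFfun_lipschitz:
  "\<exists>L\<ge>0. \<forall>c d. norm c \<le> rho \<longrightarrow> norm d \<le> rho \<longrightarrow> L2norm (\<lambda>x. FFfun c x - FFfun d x) \<le> L * norm (c - d)"
proof -
  obtain B where B0: "B \<ge> 0" and B: "\<And>x. \<bar>x\<bar> \<le> rho \<Longrightarrow> \<bar>f1 x\<bar> \<le> B"
    "\<And>x. \<bar>x\<bar> \<le> rho \<Longrightarrow> \<bar>f2 x\<bar> \<le> B" "\<And>x. \<bar>x\<bar> \<le> rho \<Longrightarrow> \<bar>r1 x\<bar> \<le> B"
    using bounds_exist[of rho] by blast
  have "L2norm (\<lambda>x. FFfun c x - FFfun d x) \<le> B * (2 + \<bar>rho\<bar>) * norm (c - d)"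
    if c: "norm c \<le> rho" and d: "norm d \<le> rho" for c d
  proof -
    have vc: "\<bar>val c x\<bar> \<le> rho" and vd: "\<bar>val d x\<bar> \<le> rho" for x
      using abs_val_le order_trans c d by blast+
    have vcd: "\<bar>val c x - val d x\<bar> \<le> norm (c - d)" for x
      using abs_val_le[of "c - d" x] by (simp add: val_diff)
    let ?A = "\<lambda>x. - f1 (val c x) * (der c x - der d x)"
    let ?B = "\<lambda>x. - (f1 (val c x) - f1 (val d x)) * der d x"
    let ?C = "\<lambda>x. r (val c x) - r (val d x)"
    have sA: "sq_int ?A"
      by (intro sq_int_mult_continuous sq_int_diff sq_int_der continuous_on_minus cont_val_comp cont_f1)
    have sB: "sq_int ?B"
      by (intro sq_int_mult_continuous sq_int_der continuous_on_minus continuous_on_diff cont_val_comp cont_f1)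
    have sC: "sq_int ?C"
      by (intro sq_int_continuous continuous_on_diff cont_val_comp cont_r)
    have "L2norm (\<lambda>x. FFfun c x - FFfun d x) = L2norm (\<lambda>x. (?A x + ?B x) + ?C x)"
      by (rule L2norm_cong) (simp add: FFfun_def algebra_simps)
    also have "\<dots> \<le> L2norm (\<lambda>x. ?A x + ?B x) + L2norm ?C"
      by (intro L2norm_triangle sq_int_add sA sB sC)
    also have "L2norm (\<lambda>x. ?A x + ?B x) \<le> L2norm ?A + L2norm ?B"
      by (intro L2norm_triangle sA sB)
    also have "L2norm ?A \<le> B * L2norm (\<lambda>x. der c x - der d x)"
      by (intro L2norm_mult_bounded sq_int_diff sq_int_der sA B0) (simp add: B vc)
    also have "\<dots> = B * norm (c - d)" by (simp add: L2norm_der_diff)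
    also have "L2norm ?B \<le> (B * norm (c - d)) * L2norm (der d)"
    proof (intro L2norm_mult_bounded sq_int_der sB)
      fix x
      have "\<bar>f1 (val c x) - f1 (val d x)\<bar> \<le> B * \<bar>val c x - val d x\<bar>"
        by (rule lipschitz_bound[OF f2 B(2) vc vd])
      also have "\<dots> \<le> B * norm (c - d)" by (intro mult_left_mono vcd B0)
      finally show "\<bar>- (f1 (val c x) - f1 (val d x))\<bar> \<le> B * norm (c - d)" by simp
    qed (use B0 in auto)
    also have "\<dots> \<le> (B * norm (c - d)) * \<bar>rho\<bar>"
      using d B0 by (intro mult_left_mono) (auto simp: L2norm_der)
    also have "L2norm ?C \<le> B * norm (c - d)"
    proof (rule L2norm_bounded[OF sC])
      fix x
      have "\<bar>r (val c x) - r (val d x)\<bar> \<le> B * \<bar>val c x - val d x\<bar>"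
        by (rule lipschitz_bound[OF r1 B(3) vc vd])
      also have "\<dots> \<le> B * norm (c - d)" by (intro mult_left_mono vcd B0)
      finally show "\<bar>r (val c x) - r (val d x)\<bar> \<le> B * norm (c - d)" .
    qed
    finally show ?thesis by (simp add: algebra_simps)
  qed
  then show ?thesis using B0 by (intro exI[of _ "B * (2 + \<bar>rho\<bar>)"]) auto
qed

lemma FF_lipschitz:
  "\<exists>L\<ge>0. \<forall>c d. norm c \<le> rho \<longrightarrow> norm d \<le> rho \<longrightarrow> norm (FF c - FF d) \<le> L * norm (c - d)"
  using FFfun_lipschitz[of rho] norm_FF_diff_le order_trans by meson

lemma continuous_on_FF: "continuous_on S FF"
  by (rule continuous_on_subset[OF continuous_on_if_lipschitz_on_balls])
     (use FF_lipschitz in \<open>unfold dist_norm, blast\<close>, simp)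

text \<open>Once values are bounded, the growth in the norm of V is only linear; this lets a sup
  bound from the maximum principle become a V bound by Gronwall.\<close>

lemma FF_growth:
  "\<exists>B\<ge>0. \<forall>c. (\<forall>x. \<bar>val c x\<bar> \<le> K) \<longrightarrow> norm (FF c) \<le> B * norm c + B"
proof -
  obtain B where B0: "B \<ge> 0" and B: "\<And>x. \<bar>x\<bar> \<le> K \<Longrightarrow> \<bar>f1 x\<bar> \<le> B" "\<And>x. \<bar>x\<bar> \<le> K \<Longrightarrow> \<bar>r x\<bar> \<le> B"
    using bounds_exist[of K] by blast
  have "norm (FF c) \<le> B * norm c + B" if c: "\<And>x. \<bar>val c x\<bar> \<le> K" for c
  proof -
    have s1: "sq_int (\<lambda>x. - f1 (val c x) * der c x)" and s2: "sq_int (\<lambda>x. r (val c x))"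
      by (intro sq_int_mult_continuous sq_int_der continuous_on_minus cont_val_comp cont_f1
          sq_int_continuous cont_r)+
    have "norm (FF c) \<le> L2norm (FFfun c)" unfolding FF_def by (rule norm_sc_le[OF sq_int_FFfun])
    also have "\<dots> \<le> L2norm (\<lambda>x. - f1 (val c x) * der c x) + L2norm (\<lambda>x. r (val c x))"
      unfolding FFfun_def[abs_def] by (rule L2norm_triangle[OF s1 s2])
    also have "L2norm (\<lambda>x. - f1 (val c x) * der c x) \<le> B * L2norm (der c)"
      by (intro L2norm_mult_bounded sq_int_der s1 B0) (simp add: B c)
    also have "L2norm (\<lambda>x. r (val c x)) \<le> B" by (rule L2norm_bounded[OF s2 B(2)[OF c]])
    finally show ?thesis by (simp add: L2norm_der)
  qed
  then show ?thesis using B0 by blast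
qed

end

section \<open>Point evaluation and weak convergence\<close>

lemma ev_exists: "\<exists>e. coord e = (\<lambda>k. sinb k x / kap k)"
proof -
  have "summable (\<lambda>k. (sinb k x / kap k)\<^sup>2)"
  proof (rule summable_comparison_test')
    have "summable (\<lambda>n. inverse (real (Suc n) ^ 2))"
      using summable_Suc_iff[of "\<lambda>n. inverse (real n ^ 2)"] inverse_power_summable[of 2] by simp
    then show "summable (\<lambda>n. 4 * inverse (real (Suc n) ^ 2))" by (rule summable_mult)
    fix n :: nat
    have "(sinb n x / kap n)\<^sup>2 = (sinb n x)\<^sup>2 * inverse ((kap n)\<^sup>2)"
      by (simp add: power_divide field_simps)
    also have "\<dots> \<le> 4 * inverse (real (Suc n) ^ 2)"
    proof (rule mult_mono)
      show "(sinb n x)\<^sup>2 \<le> 4" using power_mono[OF abs_sinb_le[of n x] abs_ge_zero, of 2] by simp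
      have "real (Suc n) * 1 \<le> kap n" unfolding kap_def using pi_ge_two by (intro mult_left_mono) auto
      then show "inverse ((kap n)\<^sup>2) \<le> inverse (real (Suc n) ^ 2)"
        by (intro le_imp_inverse_le power_mono) auto
    qed auto
    finally show "norm ((sinb n x / kap n)\<^sup>2) \<le> 4 * inverse (real (Suc n) ^ 2)" by simp
  qed
  from coord_Abs[OF this] show ?thesis by blast
qed

text \<open>The Riesz representative in V of evaluation at x, that is, the Green function of
  -d^2/dx^2 with pole at x.\<close>

definition ev :: "real \<Rightarrow> ell2" where "ev x = (SOME e. coord e = (\<lambda>k. sinb k x / kap k))"

lemma coord_ev: "coord (ev x) k = sinb k x / kap k"
  using someI_ex[OF ev_exists[of x]] unfolding ev_def by simp

lemma inner_ev: "x \<in> {0..1} \<Longrightarrow> inner c (ev x) = val c x"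
  unfolding inner_ell2_def coord_ev val_def by (simp add: field_simps)

text \<open>Cauchy-Schwarz for \<open>der c\<close> against the indicator function of the interval
  between the two points.\<close>

lemma val_holder:
  assumes "x \<in> {0..1}" "y \<in> {0..1}"
  shows "\<bar>val c x - val c y\<bar> \<le> sqrt \<bar>x - y\<bar> * norm c"
proof -
  have *: "\<bar>val c b - val c a\<bar> \<le> sqrt (b - a) * norm c" if ab: "0 \<le> a" "a \<le> b" "b \<le> 1" for a b
  proof -
    let ?i = "\<lambda>x. if x \<in> {a..b} then 1 else (0::real)"
    have int: "(?i has_integral (b - a)) {0..1}"
    proof -
      have "((\<lambda>x. 1::real) has_integral (b - a)) {a..b}"
        using has_integral_const_real[of "1::real" a b] ab by simp
      then show ?thesis using ab by (subst has_integral_restrict) auto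
    qed
    have sq: "(?i x)\<^sup>2 = ?i x" for x by simp
    have "sq_int ?i" unfolding sq_int_iff
    proof
      show m: "?i \<in> borel_measurable I01"
        using borel_measurable_indicator[of "{a..b}" I01] ab
        by (subst measurable_cong[of _ _ "indicator {a..b}"])
           (auto simp: indicator_def sets_restrict_space_iff intro!: borel_measurable_indicator)
      have "?i absolutely_integrable_on {0..1}"
        using int by (intro nonnegative_absolutely_integrable_1) (auto simp: has_integral_integrable)
      then show "integrable I01 (\<lambda>x. (?i x)\<^sup>2)"
        unfolding sq by (rule absolutely_integrable_imp_integrable) simp
    qed
    note s = this
    have "val c b - val c a = integral {a..b} (der c)"
      using Henstock_Kurzweil_Integration.integral_combine[of 0 a b "der c"] sq_int_integrable_on[OF sq_int_der, of 0 b] ab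
      by (auto simp: val_eq_integral)
    also have "\<dots> = integral {0..1} (\<lambda>x. if x \<in> {a..b} then der c x else 0)"
    proof -
      have "{a..b} \<inter> {0..1} = {a..b}" using ab by auto
      then show ?thesis using integral_restrict_Int[of "{0..1}" "{a..b}" "der c"] by (metis Int_commute)
    qed
    also have "\<dots> = integral {0..1} (\<lambda>x. ?i x * der c x)"
      by (intro integral_cong) auto
    also have "\<dots> = (LINT x|I01. ?i x * der c x)"
      by (intro integral_I01_eq integrable_sq_int_mult s sq_int_der)
    finally have "\<bar>val c b - val c a\<bar> \<le> L2norm ?i * L2norm (der c)"
      using L2_Cauchy_Schwarz[OF s sq_int_der] by simp
    moreover have "L2norm ?i = sqrt (b - a)"
      unfolding L2norm_def sq using integral_unique[OF int] by simp
    ultimately show ?thesis by (simp add: L2norm_der)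
  qed
  show ?thesis
  proof (cases "x \<le> y")
    case True
    then show ?thesis using *[of x y] assms by (simp add: abs_minus_commute)
  next
    case False
    then show ?thesis using *[of y x] assms by simp
  qed
qed

text \<open>In \<open>ell2\<close>, bounded and coordinatewise convergent means weakly convergent:
  the tail of \<open>e\<close> is small, and its head sees finitely many coordinates.\<close>

lemma inner_tendsto_weak:
  fixes z :: "'a \<Rightarrow> ell2"
  assumes b: "\<forall>\<^sub>F m in F. norm (z m) \<le> B" and co: "\<And>k. ((\<lambda>m. coord (z m) k) \<longlongrightarrow> coord z0 k) F"
  shows "((\<lambda>m. inner (z m) e) \<longlongrightarrow> inner z0 e) F"
proof (rule tendstoI)
  fix eps :: real assume eps: "0 < eps"
  define B' where "B' = \<bar>B\<bar> + norm z0 + 1"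
  have B': "0 < B'" unfolding B'_def by (smt (verit) norm_ge_zero)
  obtain n where n: "norm (e - ell2_trunc n e) < eps / (2 * B')"
    using LIMSEQ_D[OF ell2_trunc_tendsto[of e], of "eps / (2 * B')"] eps B'
    by (auto simp: norm_minus_commute)
  have fin: "inner x (ell2_trunc n e) = (\<Sum>k<n. coord x k * coord e k)" for x
    unfolding inner_ell2_def coord_ell2_trunc by (subst suminf_finite[of "{..<n}"]) auto
  have "((\<lambda>m. inner (z m) (ell2_trunc n e)) \<longlongrightarrow> inner z0 (ell2_trunc n e)) F"
    unfolding fin by (intro tendsto_intros co)
  then have "\<forall>\<^sub>F m in F. dist (inner (z m) (ell2_trunc n e)) (inner z0 (ell2_trunc n e)) < eps / 2"
    using eps by (intro tendstoD) auto
  with b show "\<forall>\<^sub>F m in F. dist (inner (z m) e) (inner z0 e) < eps"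
  proof eventually_elim
    case (elim m)
    have "inner (z m) e - inner z0 e
        = (inner (z m) (ell2_trunc n e) - inner z0 (ell2_trunc n e)) + inner (z m - z0) (e - ell2_trunc n e)"
      by (simp add: inner_diff_left inner_diff_right)
    moreover have "\<bar>inner (z m - z0) (e - ell2_trunc n e)\<bar> \<le> eps / 2"
    proof -
      have "norm (z m - z0) \<le> B'" using norm_triangle_ineq4[of "z m" z0] elim(1) by (simp add: B'_def)
      then have "norm (z m - z0) * norm (e - ell2_trunc n e) \<le> B' * (eps / (2 * B'))"
        using n B' by (intro mult_mono) auto
      also have "\<dots> = eps / 2" using B' by simp
      finally show ?thesis using Cauchy_Schwarz_ineq2[of "z m - z0" "e - ell2_trunc n e"] by linarith
    qed
    ultimately show ?case using elim(2) unfolding dist_real_def by linarith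
  qed
qed

text \<open>Weak continuity in time handles a fixed point x, and the Hoelder bound, uniform on
  norm-bounded sets, handles motion in x. It serves the time derivative, for which only local bounds
  and coordinatewise continuity are known.\<close>

lemma continuous_on_val_weak:
  fixes z :: "real \<Rightarrow> ell2"
  assumes co: "\<And>k. continuous_on A (\<lambda>t. coord (z t) k)"
    and b: "\<And>t. t \<in> A \<Longrightarrow> \<exists>B. \<forall>\<^sub>F s in at t within A. norm (z s) \<le> B"
  shows "continuous_on (A \<times> {0..1}) (\<lambda>(t, x). val (z t) x)"
  unfolding continuous_on_def
proof safe
  fix t x :: real assume t: "t \<in> A" and x: "x \<in> {0..1}"
  obtain B where B: "\<forall>\<^sub>F s in at t within A. norm (z s) \<le> B" using b[OF t] by blast
  define B' where "B' = max B (norm (z t))"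
  have B': "\<forall>\<^sub>F s in nhds t. s \<in> A \<longrightarrow> norm (z s) \<le> B'"
    using B unfolding eventually_at_filter by eventually_elim (auto simp: B'_def)
  let ?F = "at (t, x) within A \<times> {0..1}"
  have ft: "filterlim fst (nhds t) ?F" and fx: "filterlim snd (nhds x) ?F"
    using tendsto_fst[OF tendsto_ident_at[of "(t, x)" "A \<times> {0..1}"]]
      tendsto_snd[OF tendsto_ident_at[of "(t, x)" "A \<times> {0..1}"]] by simp_all
  have mem: "\<forall>\<^sub>F p in ?F. fst p \<in> A \<and> snd p \<in> {0..1}"
    by (simp add: eventually_at_filter mem_Times_iff)
  have bd: "\<forall>\<^sub>F p in ?F. norm (z (fst p)) \<le> B'"
    using eventually_compose_filterlim[OF B' ft] mem by eventually_elim auto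
  have cz: "((\<lambda>p. coord (z (fst p)) k) \<longlongrightarrow> coord (z t) k) ?F" for k
  proof -
    \<comment> \<open>The unpunctured filter is needed here: a pair can approach
      \<open>(t, x)\<close> while its first component equals \<open>t\<close>.\<close>
    have l: "((\<lambda>s. coord (z s) k) \<longlongrightarrow> coord (z t) k) (inf (nhds t) (principal A))"
    proof (rule tendstoI)
      fix e :: real assume e: "0 < e"
      then have "\<forall>\<^sub>F s in at t within A. dist (coord (z s) k) (coord (z t) k) < e"
        using co[of k] t unfolding continuous_on_def by (intro tendstoD) auto
      then show "\<forall>\<^sub>F s in inf (nhds t) (principal A). dist (coord (z s) k) (coord (z t) k) < e"
        unfolding eventually_inf_principal eventually_at_filter
      proof eventually_elim
        case (elim s)
        then show ?case using e by (cases "s = t") auto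
      qed
    qed
    have "filterlim fst (inf (nhds t) (principal A)) ?F"
      using ft mem by (auto simp: filterlim_inf filterlim_principal elim: eventually_mono)
    then show ?thesis by (rule filterlim_compose[OF l])
  qed
  have "((\<lambda>p. inner (z (fst p)) (ev x)) \<longlongrightarrow> inner (z t) (ev x)) ?F"
    by (rule inner_tendsto_weak[OF bd cz])
  moreover have "((\<lambda>p. val (z (fst p)) (snd p) - inner (z (fst p)) (ev x)) \<longlongrightarrow> 0) ?F"
  proof (rule Lim_null_comparison)
    have "((\<lambda>p. sqrt \<bar>snd p - x\<bar> * B') \<longlongrightarrow> sqrt \<bar>x - x\<bar> * B') ?F"
      using fx by (intro tendsto_intros)
    then show "((\<lambda>p. sqrt \<bar>snd p - x\<bar> * B') \<longlongrightarrow> 0) ?F" by simp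
    show "\<forall>\<^sub>F p in ?F. norm (val (z (fst p)) (snd p) - inner (z (fst p)) (ev x)) \<le> sqrt \<bar>snd p - x\<bar> * B'"
      using bd mem
    proof eventually_elim
      case (elim p)
      then have "norm (val (z (fst p)) (snd p) - inner (z (fst p)) (ev x)) \<le> sqrt \<bar>snd p - x\<bar> * norm (z (fst p))"
        using val_holder[of "snd p" x "z (fst p)"] x by (simp add: inner_ev)
      also have "\<dots> \<le> sqrt \<bar>snd p - x\<bar> * B'" using elim by (intro mult_left_mono) auto
      finally show ?case .
    qed
  qed
  ultimately have "((\<lambda>p. inner (z (fst p)) (ev x) + (val (z (fst p)) (snd p) - inner (z (fst p)) (ev x)))
      \<longlongrightarrow> inner (z t) (ev x) + 0) ?F" by (rule tendsto_add)
  then show "((\<lambda>(t, x). val (z t) x) \<longlongrightarrow> val (z t) x) ?F"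
    using x by (simp add: inner_ev case_prod_beta')
qed

text \<open>The difference quotients are bounded and converge coordinatewise, hence weakly, and
  evaluation at x is weakly continuous.\<close>

lemma has_derivative_val_weak:
  fixes c w :: "real \<Rightarrow> ell2"
  assumes d: "\<And>k. ((\<lambda>t. coord (c t) k) has_real_derivative coord w0 k) (at t)"
    and b: "\<forall>\<^sub>F s in at t. norm (c s - c t) \<le> B * \<bar>s - t\<bar>"
    and x: "x \<in> {0..1}"
  shows "((\<lambda>t. val (c t) x) has_real_derivative val w0 x) (at t)"
proof -
  define z where "z s = (c s - c t) /\<^sub>R (s - t)" for s
  have "\<forall>\<^sub>F s in at t. s \<noteq> t" by (simp add: eventually_at_filter)
  with b have bz: "\<forall>\<^sub>F s in at t. norm (z s) \<le> B"
  proof eventually_elim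
    case (elim s)
    have "norm (z s) = norm (c s - c t) / \<bar>s - t\<bar>" by (simp add: z_def divide_inverse mult.commute)
    then show ?case using elim by (simp add: divide_le_eq)
  qed
  have "((\<lambda>s. coord (z s) k) \<longlongrightarrow> coord w0 k) (at t)" for k
    using d[of k] unfolding has_field_derivative_iff z_def by (simp add: divide_inverse mult.commute)
  then have "((\<lambda>s. inner (z s) (ev x)) \<longlongrightarrow> inner w0 (ev x)) (at t)"
    by (rule inner_tendsto_weak[OF bz])
  then have "((\<lambda>s. (val (c s) x - val (c t) x) / (s - t)) \<longlongrightarrow> val w0 x) (at t)"
    using inner_ev[OF x] by (simp add: z_def val_scaleR val_diff divide_inverse mult.commute)
  then show ?thesis by (simp add: has_field_derivative_iff)
qed

section \<open>Regularity of solutions\<close>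

lemma integral_stretch:
  fixes w :: "real \<Rightarrow> real"
  assumes w: "continuous_on {0..T} w" and q: "0 < q" "q \<le> 1" and t: "t \<in> {0..T}"
  shows "integral {0..t} (\<lambda>s. w (q * s)) = integral {0..q * t} w / q"
proof -
  have qs: "q * s \<in> {0..T}" if "s \<in> {0..t}" for s
  proof -
    have "q * s \<le> 1 * s" using q that by (intro mult_right_mono) auto
    also have "\<dots> \<le> T" using that t by simp
    finally show ?thesis using q that by auto
  qed
  have "((\<lambda>s. integral {0..q * s} w / q) has_vector_derivative w (q * s)) (at s within {0..t})" if s: "s \<in> {0..t}" for s
  proof -
    have d: "((\<lambda>u. integral {0..u} w) has_real_derivative w (q * s)) (at (q * s) within {0..T})"
      by (rule integral_has_real_derivative[OF w qs[OF s]])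
    have "((\<lambda>s. integral {0..q * s} w) has_real_derivative w (q * s) * q) (at s within {0..t})"
    proof -
      have "((\<lambda>u. integral {0..u} w) has_real_derivative w (q * s)) (at (q * s) within (\<lambda>s. q * s) ` {0..t})"
        by (rule DERIV_subset[OF d]) (use qs in auto)
      from DERIV_image_chain[OF this, of q] show ?thesis
        by (auto intro!: derivative_eq_intros simp: o_def)
    qed
    then have "((\<lambda>s. integral {0..q * s} w / q) has_real_derivative w (q * s) * q / q) (at s within {0..t})"
      by (rule DERIV_cdivide)
    then show ?thesis using q by (simp add: has_real_derivative_iff_has_vector_derivative)
  qed
  then have "((\<lambda>s. w (q * s)) has_integral integral {0..q * t} w / q - integral {0..q * 0} w / q) {0..t}"
    using t by (intro fundamental_theorem_of_calculus) auto
  then show ?thesis by (simp add: integral_unique)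
qed

context reaction
begin

lemma solves_bounds:
  assumes c: "solves FF c T"
  shows "\<exists>rho. \<forall>t\<in>{0..T}. norm (c t) \<le> rho \<and> norm (FF (c t)) \<le> rho"
proof -
  have cc: "continuous_on {0..T} c" by (rule solves_continuous[OF c])
  have "bounded (c ` {0..T})" "bounded ((\<lambda>t. FF (c t)) ` {0..T})"
    by (intro compact_imp_bounded compact_continuous_image cc compact_Icc
        continuous_on_compose2[OF continuous_on_FF[of UNIV] cc] subset_UNIV)+
  then obtain R1 R2 where "\<forall>y\<in>c ` {0..T}. norm y \<le> R1" "\<forall>y\<in>(\<lambda>t. FF (c t)) ` {0..T}. norm y \<le> R2"
    unfolding bounded_iff by blast
  then show ?thesis by (intro exI[of _ "max R1 R2"]) (auto simp: le_max_iff_disj)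
qed

text \<open>The rescaled curve \<open>c (q t)\<close> solves the same equation up to a factor \<open>q\<close> and starts at the same
  point, so the energy estimate bounds \<open>c (q t) - c t\<close> by \<open>1 - q\<close>, maximal regularity absorbing
  the term \<open>(q - 1) kap c\<close>.\<close>

lemma solves_scaling_bound:
  assumes c: "solves FF c T" and T: "0 \<le> T"
  shows "\<exists>K\<ge>0. \<forall>q t. 1/2 \<le> q \<longrightarrow> q \<le> 1 \<longrightarrow> t \<in> {0..T} \<longrightarrow> norm (c (q * t) - c t) \<le> K * (1 - q)"
proof -
  obtain rho where rho: "\<And>t. t \<in> {0..T} \<Longrightarrow> norm (c t) \<le> rho" "\<And>t. t \<in> {0..T} \<Longrightarrow> norm (FF (c t)) \<le> rho"
    using solves_bounds[OF c] by blast
  have rho0: "0 \<le> rho" using rho(1)[of 0] T norm_ge_zero[of "c 0"] by (simp del: norm_ge_zero)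
  obtain L where L0: "L \<ge> 0" and L: "\<And>c d. norm c \<le> rho \<Longrightarrow> norm d \<le> rho \<Longrightarrow> norm (FF c - FF d) \<le> L * norm (c - d)"
    using FF_lipschitz[of rho] by blast
  have cc: "continuous_on {0..T} c" by (rule solves_continuous[OF c])
  have cF: "continuous_on {0..T} (\<lambda>t. FF (c t))"
    by (intro continuous_on_compose2[OF continuous_on_FF[of UNIV] cc] subset_UNIV)
  define M where "M = (norm (c 0))\<^sup>2 + T * rho\<^sup>2"
  \<comment> \<open>Collects the forcing that does not involve \<open>D\<close>:
    \<open>4 * rho^2 * T\<close> stems from the factor \<open>q\<close> before the nonlinearity,
    \<open>4 * M\<close> from maximal regularity.\<close>
  define K where "K = 4 * rho\<^sup>2 * T + 4 * M"
  have maxreg: "(\<Sum>k<n. (kap k)\<^sup>2 * integral {0..t} (\<lambda>s. (coord (c s) k)\<^sup>2)) \<le> M" if t: "t \<in> {0..T}" for t n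
  proof -
    have "(\<Sum>k<n. (kap k)\<^sup>2 * integral {0..t} (\<lambda>s. (coord (c s) k)\<^sup>2)) \<le> (norm (c 0))\<^sup>2 + integral {0..t} (\<lambda>s. rho\<^sup>2)"
    proof (rule ell2_energy(2)[where T=T and g="\<lambda>k t. coord (FF (c t)) k"])
      fix n s assume "s \<in> {0..T}"
      then show "(\<Sum>k<n. (coord (FF (c s)) k)\<^sup>2) \<le> rho\<^sup>2"
        by (intro order_trans[OF sum_coord_sq_le] power_mono rho) auto
    qed (use t solves_deriv[OF c] in \<open>auto intro!: continuous_intros cc cF\<close>)
    also have "\<dots> \<le> M" using t by (auto simp: M_def mult_right_mono)
    finally show ?thesis .
  qed
  have main: "norm (c (q * t) - c t) \<le> sqrt (K * exp (4 * L\<^sup>2 * T)) * (1 - q)"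
    if q: "1/2 \<le> q" "q \<le> 1" and t: "t \<in> {0..T}" for q t
  proof -
    have q0: "0 < q" using q by simp
    have qs: "q * s \<in> {0..T}" if "s \<in> {0..T}" for s
    proof -
      have "q * s \<le> 1 * s" using q that by (intro mult_right_mono) auto
      also have "\<dots> \<le> T" using that by simp
      finally show ?thesis using q0 that by auto
    qed
    have cq: "continuous_on {0..T} (\<lambda>s. c (q * s))"
      by (rule continuous_on_compose2[OF cc]) (use qs in \<open>auto intro!: continuous_intros\<close>)
    have cFq: "continuous_on {0..T} (\<lambda>s. FF (c (q * s)))"
      by (rule continuous_on_compose2[OF cF]) (use qs in \<open>auto intro!: continuous_intros\<close>)
    define D where "D s = c (q * s) - c s" for s
    have cD: "continuous_on {0..T} D" unfolding D_def by (intro continuous_intros cq cc)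
    define h where "h s = q *\<^sub>R FF (c (q * s)) - FF (c s)" for s
    \<comment> \<open>The rescaled curve has dissipation \<open>q * (kap k)^2\<close>. Restoring the
      full dissipation leaves \<open>(1 - q) * (kap k)^2\<close> times its coordinate, of which one
      factor \<open>kap k\<close> is set apart by the energy estimate and the other stays in
      \<open>g\<close>.\<close>
    define g where "g k s = coord (h s) k + (1 - q) * (kap k * coord (c (q * s)) k)" for k s
    have ch: "continuous_on {0..T} h" unfolding h_def by (intro continuous_intros cF cFq)
    have cg: "continuous_on {0..T} (g k)" for k unfolding g_def by (intro continuous_intros ch cq)
    have dD: "((\<lambda>s. coord (D s) k) has_real_derivative (- (kap k)\<^sup>2 * coord (D s) k + kap k * g k s)) (at s)"
      if s: "0 < s" "s < T" for k s
    proof -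
      have qs': "0 < q * s" "q * s < T"
      proof -
        show "0 < q * s" using q0 s by simp
        have "q * s \<le> 1 * s" using q s by (intro mult_right_mono) auto
        also have "\<dots> < T" using s by simp
        finally show "q * s < T" .
      qed
      have "((\<lambda>s. coord (c (q * s)) k) has_real_derivative
          (- (kap k)\<^sup>2 * coord (c (q * s)) k + kap k * coord (FF (c (q * s))) k) * q) (at s)"
        by (rule DERIV_chain'[where f="\<lambda>s. q * s", OF _ solves_deriv[OF c qs']])
           (auto intro!: derivative_eq_intros)
      from DERIV_diff[OF this solves_deriv[OF c s, of k]]
      have "((\<lambda>s. coord (D s) k) has_real_derivative
          (- (kap k)\<^sup>2 * coord (c (q * s)) k + kap k * coord (FF (c (q * s))) k) * q
          - (- (kap k)\<^sup>2 * coord (c s) k + kap k * coord (FF (c s)) k)) (at s)"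
        unfolding D_def coord_diff .
      moreover have "(- (kap k)\<^sup>2 * coord (c (q * s)) k + kap k * coord (FF (c (q * s))) k) * q
          - (- (kap k)\<^sup>2 * coord (c s) k + kap k * coord (FF (c s)) k)
          = - (kap k)\<^sup>2 * coord (D s) k + kap k * g k s"
        unfolding g_def D_def h_def by (simp add: algebra_simps power2_eq_square)
      ultimately show ?thesis by simp
    qed
    have hle: "(norm (h s))\<^sup>2 \<le> 2 * L\<^sup>2 * (norm (D s))\<^sup>2 + 2 * (1 - q)\<^sup>2 * rho\<^sup>2" if s: "s \<in> {0..T}" for s
    proof -
      have "h s = (FF (c (q * s)) - FF (c s)) - (1 - q) *\<^sub>R FF (c (q * s))"
        by (simp add: h_def algebra_simps)
      then have "norm (h s) \<le> norm (FF (c (q * s)) - FF (c s)) + norm ((1 - q) *\<^sub>R FF (c (q * s)))"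
        by (metis norm_triangle_ineq4)
      also have "\<dots> \<le> L * norm (D s) + (1 - q) * rho"
        using q unfolding D_def by (intro add_mono L rho s qs) (auto intro!: mult_left_mono rho s qs)
      finally have "(norm (h s))\<^sup>2 \<le> (L * norm (D s) + (1 - q) * rho)\<^sup>2"
        by (intro power_mono) auto
      also have "\<dots> \<le> 2 * (L * norm (D s))\<^sup>2 + 2 * ((1 - q) * rho)\<^sup>2"
        using sum_squares_bound[of "L * norm (D s)" "(1 - q) * rho"] by (simp add: power2_sum)
      finally show ?thesis by (simp add: power_mult_distrib)
    qed
    have step: "(norm (D t))\<^sup>2 \<le> (1 - q)\<^sup>2 * K + 4 * L\<^sup>2 * integral {0..t} (\<lambda>s. (norm (D s))\<^sup>2)"
      if t: "t \<in> {0..T}" for t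
    proof (rule norm_sq_leI)
      fix n
      have sub: "{0..t} \<subseteq> {0..T}" using t by auto
      have ci: "(\<lambda>s. (kap k * coord (c (q * s)) k)\<^sup>2) integrable_on {0..t}" for k
        by (intro integrable_continuous_real continuous_intros continuous_on_subset[OF cq sub])
      have D0: "coord (D 0) k = 0" for k by (simp add: D_def)
      have nn: "0 \<le> (\<Sum>k<n. (kap k)\<^sup>2 * integral {0..t} (\<lambda>s. (coord (D s) k)\<^sup>2))"
        by (intro sum_nonneg mult_nonneg_nonneg Henstock_Kurzweil_Integration.integral_nonneg
            integrable_continuous_real continuous_intros continuous_on_subset[OF cD sub]) auto
      have "(\<Sum>k<n. (coord (D t) k)\<^sup>2) \<le> integral {0..t} (\<lambda>s. \<Sum>k<n. (g k s)\<^sup>2)"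
        using energy_sum[of T "\<lambda>k s. coord (D s) k" g t n, OF _ cg dD t] nn
        by (simp add: D0 continuous_on_coord[OF cD])
      also have "\<dots> \<le> integral {0..t} (\<lambda>s. 2 * (2 * L\<^sup>2 * (norm (D s))\<^sup>2 + 2 * (1 - q)\<^sup>2 * rho\<^sup>2)
          + 2 * (1 - q)\<^sup>2 * (\<Sum>k<n. (kap k * coord (c (q * s)) k)\<^sup>2))"
      proof (rule integral_le)
        show "(\<lambda>s. \<Sum>k<n. (g k s)\<^sup>2) integrable_on {0..t}"
          by (intro integrable_continuous_real continuous_intros continuous_on_subset[OF cg sub])
        show "(\<lambda>s. 2 * (2 * L\<^sup>2 * (norm (D s))\<^sup>2 + 2 * (1 - q)\<^sup>2 * rho\<^sup>2)
          + 2 * (1 - q)\<^sup>2 * (\<Sum>k<n. (kap k * coord (c (q * s)) k)\<^sup>2)) integrable_on {0..t}"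
          by (intro integrable_continuous_real continuous_intros continuous_on_subset[OF cD sub]
              continuous_on_subset[OF cq sub])
        fix s assume s: "s \<in> {0..t}"
        have "(\<Sum>k<n. (g k s)\<^sup>2) \<le> (\<Sum>k<n. 2 * (coord (h s) k)\<^sup>2 + 2 * (1 - q)\<^sup>2 * (kap k * coord (c (q * s)) k)\<^sup>2)"
        proof (rule sum_mono)
          fix k
          show "(g k s)\<^sup>2 \<le> 2 * (coord (h s) k)\<^sup>2 + 2 * (1 - q)\<^sup>2 * (kap k * coord (c (q * s)) k)\<^sup>2"
            using sum_squares_bound[of "coord (h s) k" "(1 - q) * (kap k * coord (c (q * s)) k)"]
            unfolding g_def by (simp add: power2_sum power_mult_distrib mult.left_commute add.commute)
        qed
        also have "\<dots> = 2 * (\<Sum>k<n. (coord (h s) k)\<^sup>2) + 2 * (1 - q)\<^sup>2 * (\<Sum>k<n. (kap k * coord (c (q * s)) k)\<^sup>2)"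
          by (simp add: sum.distrib sum_distrib_left)
        also have "(\<Sum>k<n. (coord (h s) k)\<^sup>2) \<le> 2 * L\<^sup>2 * (norm (D s))\<^sup>2 + 2 * (1 - q)\<^sup>2 * rho\<^sup>2"
          using s sub by (intro order_trans[OF sum_coord_sq_le hle]) auto
        finally show "(\<Sum>k<n. (g k s)\<^sup>2) \<le> 2 * (2 * L\<^sup>2 * (norm (D s))\<^sup>2 + 2 * (1 - q)\<^sup>2 * rho\<^sup>2)
          + 2 * (1 - q)\<^sup>2 * (\<Sum>k<n. (kap k * coord (c (q * s)) k)\<^sup>2)" by simp
      qed
      also have "\<dots> = 4 * L\<^sup>2 * integral {0..t} (\<lambda>s. (norm (D s))\<^sup>2) + 4 * (1 - q)\<^sup>2 * rho\<^sup>2 * t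
          + 2 * (1 - q)\<^sup>2 * (\<Sum>k<n. (kap k)\<^sup>2 * (integral {0..q * t} (\<lambda>s. (coord (c s) k)\<^sup>2) / q))"
      proof (rule integral_unique)
        have i1: "((\<lambda>s. (norm (D s))\<^sup>2) has_integral integral {0..t} (\<lambda>s. (norm (D s))\<^sup>2)) {0..t}"
          by (intro integrable_integral integrable_continuous_real continuous_intros continuous_on_subset[OF cD sub])
        have i2: "((\<lambda>s. (coord (c (q * s)) k)\<^sup>2) has_integral integral {0..q * t} (\<lambda>s. (coord (c s) k)\<^sup>2) / q) {0..t}" for k
          unfolding integral_stretch[OF continuous_on_power[OF continuous_on_coord[OF cc]] q0 q(2) t, symmetric]
          by (intro integrable_integral integrable_continuous_real continuous_intros continuous_on_subset[OF cq sub])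
        have i3: "((\<lambda>s. 4 * (1 - q)\<^sup>2 * rho\<^sup>2) has_integral 4 * (1 - q)\<^sup>2 * rho\<^sup>2 * t) {0..t}"
          using has_integral_const_real[of "4 * (1 - q)\<^sup>2 * rho\<^sup>2" 0 t] t by (simp add: mult.commute)
        have "((\<lambda>s. 4 * L\<^sup>2 * (norm (D s))\<^sup>2 + 4 * (1 - q)\<^sup>2 * rho\<^sup>2
            + 2 * (1 - q)\<^sup>2 * (\<Sum>k<n. (kap k)\<^sup>2 * (coord (c (q * s)) k)\<^sup>2)) has_integral
            4 * L\<^sup>2 * integral {0..t} (\<lambda>s. (norm (D s))\<^sup>2) + 4 * (1 - q)\<^sup>2 * rho\<^sup>2 * t
            + 2 * (1 - q)\<^sup>2 * (\<Sum>k<n. (kap k)\<^sup>2 * (integral {0..q * t} (\<lambda>s. (coord (c s) k)\<^sup>2) / q))) {0..t}"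
          by (intro has_integral_add has_integral_mult_right has_integral_sum i1 i2 i3 finite_lessThan)
        then show "((\<lambda>s. 2 * (2 * L\<^sup>2 * (norm (D s))\<^sup>2 + 2 * (1 - q)\<^sup>2 * rho\<^sup>2)
            + 2 * (1 - q)\<^sup>2 * (\<Sum>k<n. (kap k * coord (c (q * s)) k)\<^sup>2)) has_integral
            4 * L\<^sup>2 * integral {0..t} (\<lambda>s. (norm (D s))\<^sup>2) + 4 * (1 - q)\<^sup>2 * rho\<^sup>2 * t
            + 2 * (1 - q)\<^sup>2 * (\<Sum>k<n. (kap k)\<^sup>2 * (integral {0..q * t} (\<lambda>s. (coord (c s) k)\<^sup>2) / q))) {0..t}"
          by (simp add: power_mult_distrib mult.assoc distrib_left)
      qed
      also have "(\<Sum>k<n. (kap k)\<^sup>2 * (integral {0..q * t} (\<lambda>s. (coord (c s) k)\<^sup>2) / q)) \<le> 2 * M"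
      proof -
        have "(\<Sum>k<n. (kap k)\<^sup>2 * (integral {0..q * t} (\<lambda>s. (coord (c s) k)\<^sup>2) / q))
            = (\<Sum>k<n. (kap k)\<^sup>2 * integral {0..q * t} (\<lambda>s. (coord (c s) k)\<^sup>2)) / q"
          by (simp add: sum_divide_distrib)
        also have "\<dots> \<le> M / q" using maxreg[OF qs[OF t], of n] q0 by (intro divide_right_mono) auto
        \<comment> \<open>The change of variables costs 1 / q; this is where \<open>q\<close> must
          stay away from 0.\<close>
        also have "\<dots> \<le> M / (1/2)"
          using q T by (intro divide_left_mono) (auto simp: M_def)
        finally show ?thesis by simp
      qed
      finally have "(\<Sum>k<n. (coord (D t) k)\<^sup>2) \<le> 4 * L\<^sup>2 * integral {0..t} (\<lambda>s. (norm (D s))\<^sup>2)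
          + 4 * (1 - q)\<^sup>2 * rho\<^sup>2 * t + 2 * (1 - q)\<^sup>2 * (2 * M)"
        by (simp add: mult_left_mono)
      moreover have "4 * (1 - q)\<^sup>2 * rho\<^sup>2 * t \<le> 4 * (1 - q)\<^sup>2 * rho\<^sup>2 * T"
        using t by (intro mult_left_mono) auto
      ultimately show "(\<Sum>k<n. (coord (D t) k)\<^sup>2) \<le> (1 - q)\<^sup>2 * K + 4 * L\<^sup>2 * integral {0..t} (\<lambda>s. (norm (D s))\<^sup>2)"
        unfolding K_def by (simp add: algebra_simps)
    qed
    have K0: "0 \<le> K" using T by (simp add: K_def M_def)
    have "(norm (D t))\<^sup>2 \<le> (1 - q)\<^sup>2 * K * exp (4 * L\<^sup>2 * t)"
      by (rule gronwall_integral[OF _ _ step t]) (auto intro!: continuous_intros cD)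
    also have "\<dots> \<le> (1 - q)\<^sup>2 * K * exp (4 * L\<^sup>2 * T)"
      using K0 t by (intro mult_left_mono) (auto intro: mult_left_mono)
    also have "\<dots> = (sqrt (K * exp (4 * L\<^sup>2 * T)) * (1 - q))\<^sup>2"
      using K0 by (simp add: power_mult_distrib)
    finally have "norm (D t) \<le> sqrt (K * exp (4 * L\<^sup>2 * T)) * (1 - q)"
      by (rule power2_le_imp_le) (use q K0 in auto)
    then show ?thesis by (simp add: D_def)
  qed
  have "0 \<le> sqrt (K * exp (4 * L\<^sup>2 * T))"
    using T by (simp add: K_def M_def)
  with main show ?thesis by blast
qed

end

section \<open>Joint continuity and uniformly close time slices\<close>

lemma continuous_on_slices_uniform:
  fixes F :: "real \<Rightarrow> real \<Rightarrow> real"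
  assumes F: "continuous_on (A \<times> {0..1}) (\<lambda>(t, x). F t x)" and A: "open A" and t: "t \<in> A" and e: "0 < e"
  shows "\<exists>d>0. \<forall>s. \<bar>s - t\<bar> < d \<longrightarrow> s \<in> A \<and> (\<forall>x\<in>{0..1}. \<bar>F s x - F t x\<bar> < e)"
proof -
  obtain d0 where d0: "d0 > 0" "cball t d0 \<subseteq> A" using open_contains_cball A t by blast
  let ?K = "cball t d0 \<times> {0..1::real}"
  have "uniformly_continuous_on ?K (\<lambda>(t, x). F t x)"
    by (intro compact_uniformly_continuous continuous_on_subset[OF F] compact_Times) (use d0 in auto)
  then obtain d where d: "d > 0"
    "\<And>p q. p \<in> ?K \<Longrightarrow> q \<in> ?K \<Longrightarrow> dist q p < d \<Longrightarrow> dist ((\<lambda>(t, x). F t x) q) ((\<lambda>(t, x). F t x) p) < e"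
    unfolding uniformly_continuous_on_def using e by metis
  have "s \<in> A \<and> (\<forall>x\<in>{0..1}. \<bar>F s x - F t x\<bar> < e)" if s: "\<bar>s - t\<bar> < min d d0" for s
  proof -
    have sK: "s \<in> cball t d0" using s by (simp add: dist_real_def abs_minus_commute)
    moreover have "\<bar>F s x - F t x\<bar> < e" if "x \<in> {0..1}" for x
      using d(2)[of "(t, x)" "(s, x)"] that sK s d0 by (simp add: dist_Pair_Pair dist_real_def)
    ultimately show ?thesis using d0 by auto
  qed
  then show ?thesis using d d0 by (intro exI[of _ "min d d0"]) auto
qed

lemma continuous_on_from_slices:
  fixes F :: "real \<Rightarrow> real \<Rightarrow> real"
  assumes u: "\<And>t e. t \<in> A \<Longrightarrow> 0 < e \<Longrightarrow> \<exists>d>0. \<forall>s\<in>A. \<bar>s - t\<bar> < d \<longrightarrow> (\<forall>x\<in>{0..1}. \<bar>F s x - F t x\<bar> < e)"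
    and F: "\<And>t. t \<in> A \<Longrightarrow> continuous_on {0..1} (F t)"
  shows "continuous_on (A \<times> {0..1}) (\<lambda>(t, x). F t x)"
  unfolding continuous_on_iff
proof (intro ballI allI impI)
  fix p :: "real \<times> real" and e :: real assume p: "p \<in> A \<times> {0..1}" and e: "0 < e"
  obtain t x where tx: "p = (t, x)" by (cases p)
  then have t: "t \<in> A" and x: "x \<in> {0..1}" using p by auto
  obtain d1 where d1: "d1 > 0" "\<And>s x. s \<in> A \<Longrightarrow> \<bar>s - t\<bar> < d1 \<Longrightarrow> x \<in> {0..1} \<Longrightarrow> \<bar>F s x - F t x\<bar> < e / 2"
    using u[OF t, of "e / 2"] e by auto
  obtain d2 where d2: "d2 > 0" "\<And>y. y \<in> {0..1} \<Longrightarrow> dist y x < d2 \<Longrightarrow> dist (F t y) (F t x) < e / 2"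
    using F[OF t] x e unfolding continuous_on_iff by (metis half_gt_zero)
  have "dist (F s y) (F t x) < e" if s: "s \<in> A" "y \<in> {0..1}" "dist (s, y) (t, x) < min d1 d2" for s y
  proof -
    have "dist s t < d1" "dist y x < d2"
      using dist_fst_le[of "(s, y)" "(t, x)"] dist_snd_le[of "(s, y)" "(t, x)"] s(3) by auto
    then have "\<bar>F s y - F t y\<bar> < e / 2" "\<bar>F t y - F t x\<bar> < e / 2"
      using d1(2)[of s y] d2(2)[of y] s by (auto simp: dist_real_def)
    then show ?thesis unfolding dist_real_def by linarith
  qed
  then show "\<exists>d>0. \<forall>q\<in>A \<times> {0..1}. dist q p < d \<longrightarrow>
      dist (case q of (t, x) \<Rightarrow> F t x) (case p of (t, x) \<Rightarrow> F t x) < e"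
    using d1(1) d2(1) unfolding tx by (intro exI[of _ "min d1 d2"]) auto
qed

section \<open>Time and space derivatives as classical functions\<close>

context reaction
begin

text \<open>The right-hand side of the system as an element of \<open>ell2\<close>. The abstraction
  is meaningful only where this sequence is square-summable, which \<open>tder_bound\<close>
  establishes at interior times.\<close>

definition tder :: "(real \<Rightarrow> ell2) \<Rightarrow> real \<Rightarrow> ell2" where
  "tder c t = Abs_ell2 (\<lambda>k. - (kap k)\<^sup>2 * coord (c t) k + kap k * coord (FF (c t)) k)"

text \<open>The derivative of \<open>c (q * t)\<close> with respect to q at 1 is t times the time
  derivative. Dividing the scaling bound by \<open>1 - q\<close> and letting q tend to 1 in finite
  partial sums bounds it by K.\<close>

lemma tder_bound:
  assumes c: "solves FF c T"
  shows "\<exists>K\<ge>0. \<forall>t. 0 < t \<and> t < T \<longrightarrow> t * norm (tder c t) \<le> K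
    \<and> (\<forall>k. coord (tder c t) k = - (kap k)\<^sup>2 * coord (c t) k + kap k * coord (FF (c t)) k)"
proof (cases "0 \<le> T")
  case True
  obtain K where K0: "K \<ge> 0" and K: "\<And>q t. 1/2 \<le> q \<Longrightarrow> q \<le> 1 \<Longrightarrow> t \<in> {0..T} \<Longrightarrow> norm (c (q * t) - c t) \<le> K * (1 - q)"
    using solves_scaling_bound[OF c True] by blast
  have "t * norm (tder c t) \<le> K \<and> (\<forall>k. coord (tder c t) k = - (kap k)\<^sup>2 * coord (c t) k + kap k * coord (FF (c t)) k)"
    if t: "0 < t" "t < T" for t
  proof -
    define a where "a k = - (kap k)\<^sup>2 * coord (c t) k + kap k * coord (FF (c t)) k" for k
    have lim: "((\<lambda>q. coord (c (q * t) - c t) k / (q - 1)) \<longlongrightarrow> t * a k) (at_left 1)" for k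
    proof -
      have d: "((\<lambda>u. coord (c u) k) has_real_derivative a k) (at (1 * t))"
        using solves_deriv[OF c t, of k] by (simp add: a_def)
      have "((\<lambda>q. coord (c (q * t)) k) has_real_derivative a k * t) (at 1)"
        by (rule DERIV_chain'[where f="\<lambda>q. q * t", OF _ d]) (auto intro!: derivative_eq_intros)
      then have "((\<lambda>q. (coord (c (q * t)) k - coord (c (1 * t)) k) / (q - 1)) \<longlongrightarrow> a k * t) (at 1)"
        by (simp add: has_field_derivative_iff)
      then show ?thesis by (simp add: mult.commute filterlim_at_split)
    qed
    have "(\<Sum>k<n. (t * a k)\<^sup>2) \<le> K\<^sup>2" for n
    proof (rule tendsto_upperbound)
      show "((\<lambda>q. \<Sum>k<n. (coord (c (q * t) - c t) k / (q - 1))\<^sup>2) \<longlongrightarrow> (\<Sum>k<n. (t * a k)\<^sup>2)) (at_left 1)"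
        by (intro tendsto_intros lim)
      have "\<forall>\<^sub>F q in at_left 1. q \<in> {1/2<..<(1::real)}"
        by (rule eventually_at_left_real) simp
      then show "\<forall>\<^sub>F q in at_left 1. (\<Sum>k<n. (coord (c (q * t) - c t) k / (q - 1))\<^sup>2) \<le> K\<^sup>2"
      proof eventually_elim
        case (elim q)
        have "(\<Sum>k<n. (coord (c (q * t) - c t) k / (q - 1))\<^sup>2) = (\<Sum>k<n. (coord (c (q * t) - c t) k)\<^sup>2) / (q - 1)\<^sup>2"
          by (simp add: power_divide sum_divide_distrib)
        also have "\<dots> \<le> (K * (1 - q))\<^sup>2 / (q - 1)\<^sup>2"
          using elim t by (intro divide_right_mono order_trans[OF sum_coord_sq_le] power_mono K) auto
        also have "\<dots> = K\<^sup>2" using elim by (simp add: power_mult_distrib power2_commute[of 1 q])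
        finally show ?case .
      qed
    qed simp
    then obtain z where z: "coord z = (\<lambda>k. t * a k)" "(norm z)\<^sup>2 \<le> K\<^sup>2"
      using ell2_exists[of "\<lambda>k. t * a k" "K\<^sup>2"] by blast
    have ca: "coord ((1 / t) *\<^sub>R z) = a" using z t by (auto simp: fun_eq_iff)
    then have e: "tder c t = (1 / t) *\<^sub>R z"
      unfolding tder_def a_def[abs_def, symmetric] by (metis coord_inverse)
    have "norm z \<le> K" using z(2) K0 by (rule power2_le_imp_le)
    then show ?thesis using e ca t by (simp add: a_def fun_eq_iff)
  qed
  then show ?thesis using K0 by blast
qed auto

lemma coord_tder:
  "solves FF c T \<Longrightarrow> 0 < t \<Longrightarrow> t < T \<Longrightarrow>
    coord (tder c t) k = - (kap k)\<^sup>2 * coord (c t) k + kap k * coord (FF (c t)) k"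
  using tder_bound by blast

lemma solves_val_deriv:
  assumes c: "solves FF c T" and t: "0 < t" "t < T" and x: "x \<in> {0..1}"
  shows "((\<lambda>t. val (c t) x) has_real_derivative val (tder c t) x) (at t)"
proof -
  obtain K where K0: "K \<ge> 0" and K: "\<And>q t. 1/2 \<le> q \<Longrightarrow> q \<le> 1 \<Longrightarrow> t \<in> {0..T} \<Longrightarrow> norm (c (q * t) - c t) \<le> K * (1 - q)"
    using solves_scaling_bound[OF c] t by (metis less_imp_le order_less_trans)
  show ?thesis
  proof (rule has_derivative_val_weak[OF _ _ x])
    show "((\<lambda>t. coord (c t) k) has_real_derivative coord (tder c t) k) (at t)" for k
      using solves_deriv[OF c t, of k] coord_tder[OF c t, of k] by simp
    \<comment> \<open>Within a factor two of \<open>t\<close>, the quotient of the smaller by the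
      larger time lies in [1/2, 1], the range of the scaling bound; the larger time plays the role
      of \<open>t\<close> there.\<close>
    have "\<forall>\<^sub>F s in at t. s \<in> {t / 2<..<min (2 * t) T}"
      using t by (intro eventually_at_in_open') auto
    then show "\<forall>\<^sub>F s in at t. norm (c s - c t) \<le> K / t * \<bar>s - t\<bar>"
    proof eventually_elim
      case (elim s)
      then have s: "t / 2 < s" "s < 2 * t" "s < T" by auto
      then have s0: "0 < s" using t by linarith
      show ?case
      proof (cases "s \<le> t")
        case True
        have "norm (c (s / t * t) - c t) \<le> K * (1 - s / t)"
          using t s True by (intro K) (auto simp: field_simps)
        also have "K * (1 - s / t) = K / t * \<bar>s - t\<bar>" using t True by (simp add: field_simps)
        finally show ?thesis using t by simp
      next
        case False
        have "norm (c (t / s * s) - c s) \<le> K * (1 - t / s)"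
          using t s s0 False by (intro K) (auto simp: field_simps)
        also have "\<dots> = K / s * (s - t)" using s0 by (simp add: field_simps)
        also have "\<dots> \<le> K / t * (s - t)"
          using False t s0 K0 by (intro mult_right_mono divide_left_mono) auto
        finally show ?thesis using s0 False by (simp add: norm_minus_commute)
      qed
    qed
  qed
qed

lemma solves_val_continuous:
  assumes c: "solves FF c T"
  shows "continuous_on ({0..T} \<times> {0..1}) (\<lambda>(t, x). val (c t) x)"
proof (rule continuous_on_val_weak)
  show "continuous_on {0..T} (\<lambda>t. coord (c t) k)" for k
    by (intro continuous_intros solves_continuous[OF c])
  obtain rho where "\<And>t. t \<in> {0..T} \<Longrightarrow> norm (c t) \<le> rho" using solves_bounds[OF c] by blast
  then show "\<exists>B. \<forall>\<^sub>F s in at t within {0..T}. norm (c s) \<le> B" for t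
    by (intro exI[of _ rho]) (simp add: eventually_at_filter)
qed

text \<open>The norm of \<open>tder c t\<close> may blow up like 1 / t, so it is bounded only
  locally away from 0; together with coordinatewise continuity this is enough for weak
  continuity.\<close>

lemma solves_tder_continuous:
  assumes c: "solves FF c T"
  shows "continuous_on ({0<..<T} \<times> {0..1}) (\<lambda>(t, x). val (tder c t) x)"
proof (rule continuous_on_val_weak)
  have sub: "{0<..<T} \<subseteq> {0..T}" by auto
  have cc: "continuous_on {0<..<T} c" by (rule continuous_on_subset[OF solves_continuous[OF c] sub])
  show "continuous_on {0<..<T} (\<lambda>t. coord (tder c t) k)" for k
  proof (rule continuous_on_eq)
    show "continuous_on {0<..<T} (\<lambda>t. - (kap k)\<^sup>2 * coord (c t) k + kap k * coord (FF (c t)) k)"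
      by (intro continuous_intros cc continuous_on_compose2[OF continuous_on_FF[of UNIV] cc] subset_UNIV)
  qed (simp add: coord_tder[OF c])
  obtain K where K: "K \<ge> 0" "\<And>t. 0 < t \<Longrightarrow> t < T \<Longrightarrow> t * norm (tder c t) \<le> K"
    using tder_bound[OF c] by blast
  fix t assume t: "t \<in> {0<..<T}"
  have "\<forall>\<^sub>F s in nhds t. s \<in> {t / 2<..}" using t by (intro eventually_nhds_in_open) auto
  then have "\<forall>\<^sub>F s in at t within {0<..<T}. norm (tder c s) \<le> K / (t / 2)"
    unfolding eventually_at_filter
  proof eventually_elim
    case (elim s)
    show ?case
    proof (intro impI)
      assume "s \<noteq> t" "s \<in> {0<..<T}"
      then have "norm (tder c s) \<le> K / s" using K(2)[of s] by (simp add: field_simps)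
      also have "\<dots> \<le> K / (t / 2)" using elim t K(1) by (intro divide_left_mono) auto
      finally show "norm (tder c s) \<le> K / (t / 2)" .
    qed
  qed
  then show "\<exists>B. \<forall>\<^sub>F s in at t within {0<..<T}. norm (tder c s) \<le> B" by blast
qed

text \<open>The equation solved for the second space derivative. Through \<open>FFfun\<close> it
  still contains \<open>der\<close>, so at this stage it is merely an L^2 function.\<close>

definition gfun :: "(real \<Rightarrow> ell2) \<Rightarrow> real \<Rightarrow> real \<Rightarrow> real" where
  "gfun c t x = val (tder c t) x - FFfun (c t) x"

text \<open>The subtracted constant is the mean of the first antiderivative; it makes the second
  antiderivative vanish at 1, the right-hand boundary condition.\<close>

definition yxfun :: "(real \<Rightarrow> ell2) \<Rightarrow> real \<Rightarrow> real \<Rightarrow> real" where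
  "yxfun c t x = integral {0..x} (gfun c t) - integral {0..1} (\<lambda>z. integral {0..z} (gfun c t))"

lemma sq_int_gfun: "sq_int (gfun c t)"
  unfolding gfun_def[abs_def] by (intro sq_int_diff sq_int_val sq_int_FFfun)

lemma continuous_on_integral_gfun: "continuous_on {0..1} (\<lambda>x. integral {0..x} (gfun c t))"
  using sq_int_integrable_on[OF sq_int_gfun, of 0 1] by (intro indefinite_integral_continuous_1) auto

lemma continuous_on_yxfun: "continuous_on {0..1} (yxfun c t)"
  unfolding yxfun_def[abs_def] by (intro continuous_intros continuous_on_integral_gfun)

text \<open>The sine coefficients of \<open>gfun c t\<close> are \<open>- kap k\<close> times the coordinates of \<open>c t\<close>; integrating twice
  identifies \<open>val (c t)\<close> with the solution of \<open>u'' = gfun c t\<close>.\<close>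

lemma solves_val_eq_integral:
  assumes c: "solves FF c T" and t: "0 < t" "t < T" and x: "x \<in> {0..1}"
  shows "val (c t) x = integral {0..x} (yxfun c t)"
proof -
  define p where "p x = integral {0..x} (gfun c t)" for x
  define m where "m = integral {0..1} p"
  have yx: "yxfun c t = (\<lambda>x. p x - m)" by (simp add: yxfun_def[abs_def] p_def[abs_def] m_def)
  define Y where "Y x = integral {0..x} (yxfun c t)" for x
  have cp: "continuous_on {0..1} p" unfolding p_def by (rule continuous_on_integral_gfun)
  have sY: "sq_int (yxfun c t)" by (intro sq_int_continuous continuous_on_yxfun)
  have Y0: "Y 0 = 0" by (simp add: Y_def)
  have Y1: "Y 1 = 0"
    unfolding Y_def yx
    by (subst Henstock_Kurzweil_Integration.integral_diff) (auto intro: integrable_continuous_real cp simp: m_def)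
  have wY: "weak_deriv Y (yxfun c t)" unfolding weak_deriv_def using sY Y0 by (simp add: Y_def)
  have cY: "continuous_on {0..1} Y"
    unfolding Y_def by (intro indefinite_integral_continuous_1 integrable_continuous_real continuous_on_yxfun)
  have sg: "scoef (gfun c t) k = - kap k * coord (c t) k" for k
  proof -
    have "scoef (gfun c t) k = coord (tder c t) k / kap k - coord (FF (c t)) k"
      unfolding gfun_def[abs_def] by (simp add: scoef_diff sq_int_val sq_int_FFfun scoef_val coord_FF)
    then show ?thesis unfolding coord_tder[OF c t] by (simp add: field_simps power2_eq_square)
  qed
  have "ccoef (yxfun c t) k = coord (c t) k" for k
  proof -
    have d: "((\<lambda>x. sinb k x / kap k) has_real_derivative cosb k x) (at x within {0..1})" for x
      using DERIV_cdivide[OF sinb_deriv[of k x "{0..1}"], of "kap k"] by simp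
    have "(LINT x|I01. cosb k x * p x) = - (LINT x|I01. sinb k x / kap k * gfun c t x)"
      unfolding p_def
      using LINT_by_parts[OF sq_int_gfun[of c t], of "\<lambda>x. sinb k x / kap k" "cosb k"] d continuous_on_cosb by simp
    also have "(LINT x|I01. sinb k x / kap k * gfun c t x) = scoef (gfun c t) k / kap k"
      unfolding scoef_def by (simp add: mult.commute)
    finally have 1: "(LINT x|I01. cosb k x * p x) = coord (c t) k" by (simp add: sg)
    \<comment> \<open>Every \<open>cosb k\<close> has mean zero, so the constant \<open>m\<close>
      leaves all cosine coefficients unchanged.\<close>
    have 2: "(LINT x|I01. cosb k x) = 0"
      using LINT_FTC[of "\<lambda>x. sinb k x / kap k" "cosb k"] d continuous_on_cosb by simp
    have "ccoef (yxfun c t) k = (LINT x|I01. cosb k x * p x - m * cosb k x)"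
      unfolding ccoef_def yx by (simp add: algebra_simps)
    also have "\<dots> = (LINT x|I01. cosb k x * p x) - (LINT x|I01. m * cosb k x)"
      by (intro Bochner_Integration.integral_diff continuous_imp_integrable_real continuous_intros cp)
    finally show ?thesis using 1 2 by simp
  qed
  then have "scoef Y k = scoef (val (c t)) k" for k
    using scoef_H10[OF wY Y0 Y1, of k] by (simp add: scoef_val field_simps)
  then have "scoef (\<lambda>x. Y x - val (c t) x) k = 0" for k
    using scoef_diff[OF sq_int_continuous[OF cY] sq_int_val] by simp
  then have "Y x - val (c t) x = 0"
    by (intro sine_complete[of "\<lambda>x. Y x - val (c t) x" x] continuous_intros cY continuous_on_val x)
  then show ?thesis by (simp add: Y_def)
qed

lemma der_eq_yxfun_AE:
  assumes "solves FF c T" "0 < t" "t < T"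
  shows "AE x in I01. der (c t) x = yxfun c t x"
  by (rule sq_int_eq_AE_val_der[OF sq_int_continuous[OF continuous_on_yxfun] solves_val_eq_integral[OF assms]])

text \<open>\<open>gfun\<close> with the a.e. defined \<open>der\<close> replaced by its continuous
  representative \<open>yxfun\<close>; this is the classical second derivative.\<close>

definition yxxfun :: "(real \<Rightarrow> ell2) \<Rightarrow> real \<Rightarrow> real \<Rightarrow> real" where
  "yxxfun c t x = val (tder c t) x + f1 (val (c t) x) * yxfun c t x - r (val (c t) x)"

lemma continuous_on_yxxfun: "continuous_on {0..1} (yxxfun c t)"
  unfolding yxxfun_def[abs_def]
  by (intro continuous_intros continuous_on_val cont_val_comp cont_f1 cont_r continuous_on_yxfun)

lemma solves_val_x_deriv:
  assumes c: "solves FF c T" and t: "0 < t" "t < T" and x: "x \<in> {0..1}"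
  shows "(val (c t) has_real_derivative yxfun c t x) (at x within {0..1})"
    and "(yxfun c t has_real_derivative yxxfun c t x) (at x within {0..1})"
proof -
  have "((\<lambda>x. integral {0..x} (yxfun c t)) has_real_derivative yxfun c t x) (at x within {0..1})"
    by (rule integral_has_real_derivative[OF continuous_on_yxfun x])
  then show "(val (c t) has_real_derivative yxfun c t x) (at x within {0..1})"
    by (rule has_field_derivative_transform_within[OF _ zero_less_one x])
       (simp add: solves_val_eq_integral[OF c t])
  \<comment> \<open>Bootstrap: the two integrands agree a.e., so \<open>yxfun\<close> is also an
    antiderivative of a continuous function and hence classically differentiable.\<close>
  have "AE x in I01. gfun c t x = yxxfun c t x"
    using der_eq_yxfun_AE[OF c t]
  proof eventually_elim
    case (elim x)
    then show ?case by (simp add: gfun_def yxxfun_def FFfun_def)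
  qed
  then have ae: "AE x in I01. gfun c t x - yxxfun c t x = 0" by simp
  have s: "sq_int (yxxfun c t)" by (intro sq_int_continuous continuous_on_yxxfun)
  have i: "integral {0..z} (gfun c t) = integral {0..z} (yxxfun c t)" if z: "z \<in> {0..1}" for z
  proof -
    have sub: "{0..z} \<subseteq> {0..1}" using z by auto
    have "\<bar>integral {0..z} (\<lambda>x. gfun c t x - yxxfun c t x)\<bar> \<le> L2norm (\<lambda>x. gfun c t x - yxxfun c t x)"
      by (intro abs_integral_le_L2norm sq_int_diff sq_int_gfun s sub)
    also have "\<dots> = L2norm (\<lambda>x. 0)"
      by (intro L2norm_cong_AE sq_int_diff sq_int_gfun s sq_int_zero ae)
    finally have "integral {0..z} (\<lambda>x. gfun c t x - yxxfun c t x) = 0" by (simp add: L2norm_const)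
    then show ?thesis
      using Henstock_Kurzweil_Integration.integral_diff[OF sq_int_integrable_on(1)[OF sq_int_gfun sub] sq_int_integrable_on(1)[OF s sub]]
      by simp
  qed
  have "((\<lambda>x. integral {0..x} (yxxfun c t) - integral {0..1} (\<lambda>z. integral {0..z} (gfun c t)))
      has_real_derivative yxxfun c t x) (at x within {0..1})"
    using integral_has_real_derivative[OF continuous_on_yxxfun x, of c t] by (auto intro!: derivative_eq_intros)
  then show "(yxfun c t has_real_derivative yxxfun c t x) (at x within {0..1})"
    by (rule has_field_derivative_transform_within[OF _ zero_less_one x]) (simp add: yxfun_def i)
qed

lemma solves_yxfun_continuous:
  assumes c: "solves FF c T"
  shows "continuous_on ({0<..<T} \<times> {0..1}) (\<lambda>(t, x). yxfun c t x)"
proof (rule continuous_on_from_slices[OF _ continuous_on_yxfun])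
  fix t e :: real assume t: "t \<in> {0<..<T}" and e: "0 < e"
  obtain rho where rho: "\<And>t. t \<in> {0..T} \<Longrightarrow> norm (c t) \<le> rho" using solves_bounds[OF c] by blast
  obtain L where L0: "L \<ge> 0" and L: "\<And>c d. norm c \<le> rho \<Longrightarrow> norm d \<le> rho \<Longrightarrow>
      L2norm (\<lambda>x. FFfun c x - FFfun d x) \<le> L * norm (c - d)"
    using FFfun_lipschitz[of rho] by blast
  \<comment> \<open>Two contributions of e / 5 bound the L^2 distance of the \<open>gfun\<close>
    slices, and the antiderivative and its mean each move by at most that distance: 4e / 5 in
    total.\<close>
  obtain d1 where d1: "d1 > 0" "\<And>s x. \<bar>s - t\<bar> < d1 \<Longrightarrow> x \<in> {0..1} \<Longrightarrow> \<bar>val (tder c s) x - val (tder c t) x\<bar> < e / 5"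
    using continuous_on_slices_uniform[OF solves_tder_continuous[OF c] _ t, of "e / 5"] e by auto
  obtain d2 where d2: "d2 > 0" "\<And>s. s \<in> {0..T} \<Longrightarrow> \<bar>s - t\<bar> < d2 \<Longrightarrow> dist (c s) (c t) < e / (5 * (L + 1))"
    using solves_continuous[OF c, unfolded continuous_on_iff, rule_format, of t "e / (5 * (L + 1))"] t e L0
    by (auto simp: dist_real_def)
  have "\<bar>yxfun c s x - yxfun c t x\<bar> < e" if s: "s \<in> {0<..<T}" "\<bar>s - t\<bar> < min d1 d2" and x: "x \<in> {0..1}" for s x
  proof -
    define w where "w = L2norm (\<lambda>x. gfun c s x - gfun c t x)"
    have "w = L2norm (\<lambda>x. (val (tder c s) x - val (tder c t) x) - (FFfun (c s) x - FFfun (c t) x))"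
      unfolding w_def by (rule L2norm_cong) (simp add: gfun_def)
    also have "\<dots> \<le> L2norm (\<lambda>x. val (tder c s) x - val (tder c t) x) + L2norm (\<lambda>x. FFfun (c s) x - FFfun (c t) x)"
      by (intro L2norm_triangle_diff sq_int_diff sq_int_val sq_int_FFfun)
    also have "L2norm (\<lambda>x. val (tder c s) x - val (tder c t) x) \<le> e / 5"
      using d1(2)[of s] s by (intro L2norm_bounded sq_int_diff sq_int_val less_imp_le) auto
    also have "L2norm (\<lambda>x. FFfun (c s) x - FFfun (c t) x) \<le> L * norm (c s - c t)"
      using s t by (intro L rho) auto
    also have "L * norm (c s - c t) \<le> (L + 1) * (e / (5 * (L + 1)))"
      using d2(2)[of s] s L0 by (intro mult_mono) (auto simp: dist_norm)
    also have "\<dots> = e / 5" using L0 by (simp add: field_simps)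
    finally have w: "w \<le> 2 * e / 5" by simp
    have pd: "\<bar>integral {0..z} (gfun c s) - integral {0..z} (gfun c t)\<bar> \<le> w" if z: "z \<in> {0..1}" for z
    proof -
      have sub: "{0..z} \<subseteq> {0..1}" using z by auto
      show ?thesis
        using abs_integral_le_L2norm[OF sq_int_diff[OF sq_int_gfun[of c s] sq_int_gfun[of c t]] sub]
          Henstock_Kurzweil_Integration.integral_diff[OF sq_int_integrable_on(1)[OF sq_int_gfun[of c s] sub] sq_int_integrable_on(1)[OF sq_int_gfun[of c t] sub]]
        by (simp add: w_def)
    qed
    have ii: "(\<lambda>z. integral {0..z} (gfun c s)) integrable_on {0..1}" for s
      by (intro integrable_continuous_real continuous_on_integral_gfun)
    have "\<bar>integral {0..1} (\<lambda>z. integral {0..z} (gfun c s)) - integral {0..1} (\<lambda>z. integral {0..z} (gfun c t))\<bar> \<le> w"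
    proof -
      have "norm (integral {0..1} (\<lambda>z. integral {0..z} (gfun c s) - integral {0..z} (gfun c t))) \<le> integral {0..1} (\<lambda>z::real. w)"
        using pd by (intro integral_norm_bound_integral Henstock_Kurzweil_Integration.integrable_diff ii) auto
      then show ?thesis by (simp add: Henstock_Kurzweil_Integration.integral_diff[OF ii ii])
    qed
    then have "\<bar>yxfun c s x - yxfun c t x\<bar> \<le> 2 * w" using pd[OF x] unfolding yxfun_def by linarith
    then show ?thesis using w e by linarith
  qed
  then show "\<exists>d>0. \<forall>s\<in>{0<..<T}. \<bar>s - t\<bar> < d \<longrightarrow> (\<forall>x\<in>{0..1}. \<bar>yxfun c s x - yxfun c t x\<bar> < e)"
    using d1(1) d2(1) by (intro exI[of _ "min d1 d2"]) auto
qed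

lemma solves_yxxfun_continuous:
  assumes c: "solves FF c T"
  shows "continuous_on ({0<..<T} \<times> {0..1}) (\<lambda>(t, x). yxxfun c t x)"
proof -
  have y: "continuous_on ({0<..<T} \<times> {0..1}) (\<lambda>(t, x). val (c t) x)"
    by (rule continuous_on_subset[OF solves_val_continuous[OF c]]) auto
  have comp: "continuous_on ({0<..<T} \<times> {0..1}) (\<lambda>p. g (case p of (t, x) \<Rightarrow> val (c t) x))"
    if "continuous_on UNIV g" for g :: "real \<Rightarrow> real"
    by (rule continuous_on_compose2[OF that y]) simp
  have "continuous_on ({0<..<T} \<times> {0..1}) (\<lambda>p. (case p of (t, x) \<Rightarrow> val (tder c t) x)
      + f1 (case p of (t, x) \<Rightarrow> val (c t) x) * (case p of (t, x) \<Rightarrow> yxfun c t x) - r (case p of (t, x) \<Rightarrow> val (c t) x))"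
    by (intro continuous_intros comp cont_f1 cont_r solves_tder_continuous[OF c] solves_yxfun_continuous[OF c])
  then show ?thesis by (simp add: yxxfun_def case_prod_beta')
qed

end

section \<open>The maximum principle and global existence\<close>

text \<open>The Osgood primitive \<open>P\<close> of \<open>1 / (\<bar>r\<bar> + 1)\<close> turns the comparison function of the ODE
  \<open>Y' = \<bar>r Y\<bar> + 1\<close> into the linear function \<open>t + P M0\<close>.\<close>

lemma max_principle:
  fixes y yx yxx yt b :: "real \<Rightarrow> real \<Rightarrow> real" and r :: "real \<Rightarrow> real"
  assumes cy: "continuous_on ({0..S} \<times> {0..1}) (\<lambda>(t, x). y t x)"
    and bc: "\<And>t. t \<in> {0..S} \<Longrightarrow> y t 0 = 0" "\<And>t. t \<in> {0..S} \<Longrightarrow> y t 1 = 0"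
    and ini: "\<And>x. x \<in> {0..1} \<Longrightarrow> y 0 x \<le> M0" and M0: "0 \<le> M0"
    and dx: "\<And>t x. 0 < t \<Longrightarrow> t \<le> S \<Longrightarrow> x \<in> {0<..<1} \<Longrightarrow> (y t has_real_derivative yx t x) (at x)"
    and dxx: "\<And>t x. 0 < t \<Longrightarrow> t \<le> S \<Longrightarrow> x \<in> {0<..<1} \<Longrightarrow> (yx t has_real_derivative yxx t x) (at x)"
    and dt: "\<And>t x. 0 < t \<Longrightarrow> t \<le> S \<Longrightarrow> x \<in> {0<..<1} \<Longrightarrow> ((\<lambda>s. y s x) has_real_derivative yt t x) (at t)"
    and pde: "\<And>t x. 0 < t \<Longrightarrow> t \<le> S \<Longrightarrow> x \<in> {0<..<1} \<Longrightarrow> yt t x + b t x * yx t x = yxx t x + r (y t x)"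
    and cr: "continuous_on UNIV r"
    and t: "t \<in> {0..S}" and x: "x \<in> {0..1}"
  shows "integral {0..max 0 (y t x)} (\<lambda>s. 1 / (\<bar>r s\<bar> + 1)) \<le> t + integral {0..M0} (\<lambda>s. 1 / (\<bar>r s\<bar> + 1))"
proof -
  define g where "g s = 1 / (\<bar>r s\<bar> + 1)" for s
  have g: "0 < g s" "g s \<le> 1" for s
  proof -
    have "0 < \<bar>r s\<bar> + 1" by linarith
    then show "0 < g s" "g s \<le> 1" by (simp_all add: g_def)
  qed
  have cg: "continuous_on A g" for A
  proof -
    have "\<bar>r s\<bar> + 1 \<noteq> 0" for s by linarith
    then show ?thesis unfolding g_def by (intro continuous_intros continuous_on_subset[OF cr]) auto
  qed
  have gi: "g integrable_on {a..b}" for a b by (intro integrable_continuous_real cg)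
  \<comment> \<open>Clamping at 0 makes \<open>P\<close> vanish on nonpositive arguments, so
    negative and boundary values of \<open>y\<close> cannot produce the maximum sought
    below.\<close>
  define P where "P s = integral {0..max 0 s} g" for s
  have P_inc: "0 \<le> P s' - P s \<and> P s' - P s \<le> s' - s" if "s \<le> s'" for s s'
  proof -
    let ?a = "max 0 s" and ?b = "max 0 s'"
    have ab: "0 \<le> ?a" "?a \<le> ?b" "?b - ?a \<le> s' - s" using that by (auto simp: max_def)
    have "P s' - P s = integral {?a..?b} g"
      unfolding P_def using Henstock_Kurzweil_Integration.integral_combine[OF ab(1,2) gi] by simp
    moreover have "0 \<le> integral {?a..?b} g"
      by (intro Henstock_Kurzweil_Integration.integral_nonneg gi) (simp add: g less_imp_le)
    moreover have "integral {?a..?b} g \<le> integral {?a..?b} (\<lambda>_. 1)"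
      by (intro integral_le gi) (auto simp: g)
    ultimately show ?thesis using ab by simp
  qed
  have cP: "continuous_on UNIV P"
  proof (rule lipschitz_on_continuous_on, rule lipschitz_onI)
    fix s s' show "dist (P s) (P s') \<le> 1 * dist s s'"
      using P_inc[of s s'] P_inc[of s' s] by (cases "s \<le> s'") (auto simp: dist_real_def)
  qed simp
  have dP: "(P has_real_derivative g s) (at s)" if s: "0 < s" for s
  proof -
    have "((\<lambda>u. integral {0..u} g) has_real_derivative g s) (at s)"
      using s by (intro integral_DERIV_interior[OF cg[of "{0..s + 1}"]]) auto
    moreover have ev: "\<forall>\<^sub>F u in nhds s. integral {0..u} g = P u"
      using eventually_nhds_in_open[of "{0<..}" s] s by (auto simp: P_def elim!: eventually_mono)
    ultimately show ?thesis using DERIV_cong_ev[OF refl ev refl] by simp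
  qed
  have P_strict: "P s < P s'" if "0 < s" "s < s'" for s s'
  proof (rule DERIV_pos_imp_increasing[OF that(2)])
    fix u assume "s \<le> u"
    then show "\<exists>y. DERIV P u :> y \<and> 0 < y" using dP[of u] g(1)[of u] that by auto
  qed
  let ?K = "{0..S} \<times> {0..1::real}"
  have S: "0 \<le> S" using t by simp
  \<comment> \<open>The function to be maximised over the closed space-time rectangle is
    \<open>P (y t x) - t\<close>; the claim is that its maximum is at most
    \<open>P M0\<close>.\<close>
  have cF: "continuous_on ?K (\<lambda>p. P (case p of (t, x) \<Rightarrow> y t x) - fst p)"
    by (intro continuous_intros continuous_on_compose2[OF cP cy]) simp
  have "compact ?K" "?K \<noteq> {}" using S by (auto intro: compact_Times)
  from continuous_attains_sup[OF this cF]
  obtain p where p: "p \<in> ?K" "\<And>q. q \<in> ?K \<Longrightarrow> P (case q of (t, x) \<Rightarrow> y t x) - fst q \<le> P (case p of (t, x) \<Rightarrow> y t x) - fst p"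
    by blast
  obtain t0 x0 where tx0: "p = (t0, x0)" by (cases p)
  have t0: "t0 \<in> {0..S}" and x0: "x0 \<in> {0..1}" using p(1) tx0 by auto
  have mx: "P (y s z) - s \<le> P (y t0 x0) - t0" if "s \<in> {0..S}" "z \<in> {0..1}" for s z
    using p(2)[of "(s, z)"] that tx0 by simp
  have P0: "P s = 0" if "s \<le> 0" for s using that by (simp add: P_def max_def)
  have PM: "0 \<le> P M0" using P_inc[of 0 M0] M0 P0[of 0] by simp
  have "P (y t0 x0) - t0 \<le> P M0"
  proof (rule ccontr)
    assume "\<not> P (y t0 x0) - t0 \<le> P M0"
    then have big: "P M0 < P (y t0 x0) - t0" by simp
    have tpos: "0 < t0"
    proof (rule ccontr)
      assume "\<not> 0 < t0"
      then have "t0 = 0" using t0 by simp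
      then show False using big P_inc[OF ini[OF x0]] by simp
    qed
    have xin: "x0 \<in> {0<..<1}"
    proof (rule ccontr)
      assume "x0 \<notin> {0<..<1}"
      then have "x0 = 0 \<or> x0 = 1" using x0 by auto
      then have "y t0 x0 = 0" using bc t0 by auto
      then show False using big PM tpos P0[of 0] by simp
    qed
    have ypos: "0 < y t0 x0" using big PM tpos P0[of "y t0 x0"] by (cases "y t0 x0 \<le> 0") auto
    have tS: "t0 \<le> S" using t0 by simp
    have "((\<lambda>s. P (y s x0) - s) has_real_derivative (g (y t0 x0) * yt t0 x0 - 1)) (at t0)"
      by (intro DERIV_diff DERIV_ident DERIV_chain2[OF dP[OF ypos] dt[OF tpos tS xin]])
    note dphi = this
    \<comment> \<open>\<open>t0\<close> may be the final time, so only earlier times are compared: a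
      negative time derivative would give a larger value just before \<open>t0\<close>.\<close>
    have yt_ge: "0 \<le> g (y t0 x0) * yt t0 x0 - 1"
    proof (rule ccontr)
      assume "\<not> ?thesis"
      then have "g (y t0 x0) * yt t0 x0 - 1 < 0" by simp
      from DERIV_neg_dec_left[OF dphi this] obtain d where d: "d > 0"
        "\<And>h. h > 0 \<Longrightarrow> h < d \<Longrightarrow> P (y t0 x0) - t0 < P (y (t0 - h) x0) - (t0 - h)" by blast
      define h where "h = min d t0 / 2"
      have "h > 0" "h < d" "t0 - h \<in> {0..S}" using d(1) tpos tS by (auto simp: h_def min_def)
      then show False using d(2)[of h] mx[of "t0 - h" x0] x0 by auto
    qed
    have "((\<lambda>z. P (y t0 z)) has_real_derivative (g (y t0 x0) * yx t0 x0)) (at x0)"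
      by (intro DERIV_chain2[OF dP[OF ypos] dx[OF tpos tS xin]])
    then have "g (y t0 x0) * yx t0 x0 = 0"
    proof (rule DERIV_local_max)
      show "0 < min x0 (1 - x0)" using xin by auto
      show "\<forall>z. \<bar>x0 - z\<bar> < min x0 (1 - x0) \<longrightarrow> P (y t0 z) \<le> P (y t0 x0)"
      proof (intro allI impI)
        fix z assume "\<bar>x0 - z\<bar> < min x0 (1 - x0)"
        then have "z \<in> {0..1}" by (auto simp: abs_less_iff)
        then show "P (y t0 z) \<le> P (y t0 x0)" using mx[OF t0, of z] by simp
      qed
    qed
    then have yx0: "yx t0 x0 = 0" using g(1)[of "y t0 x0"] by simp
    \<comment> \<open>If the second derivative were positive, \<open>yx\<close>, being 0 at
      \<open>x0\<close>, would be positive just to the right, and \<open>y\<close> would increase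
      there.\<close>
    have yxx_le: "yxx t0 x0 \<le> 0"
    proof (rule ccontr)
      assume "\<not> ?thesis"
      then have "0 < yxx t0 x0" by simp
      from DERIV_pos_inc_right[OF dxx[OF tpos tS xin] this] obtain d where d: "d > 0"
        "\<And>h. h > 0 \<Longrightarrow> h < d \<Longrightarrow> yx t0 x0 < yx t0 (x0 + h)" by blast
      define h where "h = min d (1 - x0) / 2"
      have h: "h > 0" "h < d" "x0 + h < 1" using d(1) xin by (auto simp: h_def min_def field_simps)
      have "y t0 x0 < y t0 (x0 + h)"
      proof (rule DERIV_pos_imp_increasing_open[where f="y t0" and a=x0 and b="x0 + h"])
        show "x0 < x0 + h" using h by simp
        fix z assume z: "x0 < z" "z < x0 + h"
        then have "z \<in> {0<..<1}" using xin h by auto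
        moreover have "0 < yx t0 z" using d(2)[of "z - x0"] z h yx0 by simp
        ultimately show "\<exists>w. DERIV (y t0) z :> w \<and> 0 < w" using dx[OF tpos tS] by blast
      next
        show "continuous_on {x0..x0 + h} (y t0)"
        proof (rule DERIV_continuous_on)
          fix z assume "z \<in> {x0..x0 + h}"
          then have "z \<in> {0<..<1}" using xin h by auto
          from dx[OF tpos tS this] show "(y t0 has_real_derivative yx t0 z) (at z within {x0..x0 + h})"
            by (rule has_field_derivative_at_within)
        qed
      qed
      then have "P (y t0 x0) < P (y t0 (x0 + h))" by (intro P_strict ypos)
      moreover have "P (y t0 (x0 + h)) \<le> P (y t0 x0)" using mx[OF t0, of "x0 + h"] xin h by auto
      ultimately show False by simp
    qed
    \<comment> \<open>The summand 1 in the Osgood integrand decides: at the maximum the equation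
      gives y_t at most r(y), the weight gives y_t at least
      \<open>\<bar>r\<bar> + 1\<close>.\<close>
    have "yt t0 x0 \<le> r (y t0 x0)" using pde[OF tpos tS xin] yx0 yxx_le by simp
    moreover have "\<bar>r (y t0 x0)\<bar> + 1 \<le> yt t0 x0"
    proof -
      have "0 < \<bar>r (y t0 x0)\<bar> + 1" by linarith
      then show ?thesis using yt_ge by (simp add: g_def field_simps)
    qed
    ultimately show False by linarith
  qed
  then show ?thesis using mx[OF t x] unfolding P_def g_def using M0 by (simp add: max_def)
qed

locale osgood = reaction +
  assumes r_neg: "filterlim (\<lambda>a. integral {-a..0} (\<lambda>y. 1 / (\<bar>r y\<bar> + 1))) at_top at_top"
    and r_pos: "filterlim (\<lambda>a. integral {0..a} (\<lambda>y. 1 / (\<bar>r y\<bar> + 1))) at_top at_top"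
begin

text \<open>The lower bound is the maximum principle for -y, which solves the equation with reaction
  \<open>- r (- s)\<close> and the same transport coefficient. The bound depends on \<open>M\<close>
  and \<open>T\<close> alone, so it is common to all solutions on shorter intervals.\<close>

lemma sup_bound:
  assumes M: "0 \<le> M"
  shows "\<exists>K. \<forall>c tau. tau \<le> T \<longrightarrow> solves FF c tau \<longrightarrow> norm (c 0) \<le> M \<longrightarrow>
    (\<forall>t x. 0 \<le> t \<longrightarrow> t < tau \<longrightarrow> \<bar>val (c t) x\<bar> \<le> K)"
proof -
  let ?P = "\<lambda>s. integral {0..s} (\<lambda>y. 1 / (\<bar>r y\<bar> + 1))"
  let ?Q = "\<lambda>s. integral {0..s} (\<lambda>y. 1 / (\<bar>- r (- y)\<bar> + 1))"
  have Q: "?Q s = integral {-s..0} (\<lambda>y. 1 / (\<bar>r y\<bar> + 1))" for s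
    using Henstock_Kurzweil_Integration.integral_reflect_real[of 0 "-s" "\<lambda>y. 1 / (\<bar>r y\<bar> + 1)"] by simp
  \<comment> \<open>Divergence of the Osgood integral gives a level beyond which it exceeds the
    largest value that the maximum principle permits by time \<open>T\<close>.\<close>
  obtain K1 where K1: "\<And>a. a \<ge> K1 \<Longrightarrow> T + ?P M < ?P a"
    using r_pos unfolding filterlim_at_top_dense eventually_at_top_linorder by blast
  obtain K2 where K2: "\<And>a. a \<ge> K2 \<Longrightarrow> T + ?Q M < ?Q a"
    using r_neg unfolding filterlim_at_top_dense eventually_at_top_linorder Q[symmetric] by blast
  have main: "\<bar>val (c t) x\<bar> \<le> max K1 K2"
    if tau: "tau \<le> T" and c: "solves FF c tau" and cM: "norm (c 0) \<le> M" and t: "0 \<le> t" "t < tau"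
      and x: "x \<in> {0..1}" for c tau t x
  proof -
    have sub: "{0..t} \<times> {0..1} \<subseteq> {0..tau} \<times> {0..1::real}" using t by auto
    have cy: "continuous_on ({0..t} \<times> {0..1}) (\<lambda>(t, x). val (c t) x)"
      by (rule continuous_on_subset[OF solves_val_continuous[OF c] sub])
    have ini: "\<bar>val (c 0) z\<bar> \<le> M" for z using abs_val_le cM order_trans by blast
    have d: "(val (c s) has_real_derivative yxfun c s z) (at z)"
      "(yxfun c s has_real_derivative yxxfun c s z) (at z)"
      "((\<lambda>s. val (c s) z) has_real_derivative val (tder c s) z) (at s)"
      if s: "0 < s" "s \<le> t" "z \<in> {0<..<1}" for s z
    proof -
      have s': "0 < s" "s < tau" "z \<in> {0..1}" using s t by auto
      show "(val (c s) has_real_derivative yxfun c s z) (at z)"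
        "(yxfun c s has_real_derivative yxxfun c s z) (at z)"
        using solves_val_x_deriv[OF c s'] s by (auto simp: at_within_Icc_at)
      show "((\<lambda>s. val (c s) z) has_real_derivative val (tder c s) z) (at s)"
        by (rule solves_val_deriv[OF c s'])
    qed
    have "?P (max 0 (val (c t) x)) \<le> t + ?P M"
    proof (rule max_principle[where y="\<lambda>t. val (c t)" and yx="yxfun c" and yxx="yxxfun c"
          and yt="\<lambda>t. val (tder c t)" and b="\<lambda>t x. f1 (val (c t) x)" and S=t])
      show "val (tder c s) z + f1 (val (c s) z) * yxfun c s z = yxxfun c s z + r (val (c s) z)" for s z
        by (simp add: yxxfun_def)
      show "val (c 0) z \<le> M" for z using ini[of z] by linarith
    qed (use cy d M cont_r t x in auto)
    then have "\<not> K1 \<le> max 0 (val (c t) x)" using K1[of "max 0 (val (c t) x)"] t tau by auto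
    moreover have "?Q (max 0 (- val (c t) x)) \<le> t + ?Q M"
    proof (rule max_principle[where y="\<lambda>t x. - val (c t) x" and yx="\<lambda>t x. - yxfun c t x" and yxx="\<lambda>t x. - yxxfun c t x"
          and yt="\<lambda>t x. - val (tder c t) x" and b="\<lambda>t x. f1 (val (c t) x)" and S=t and r="\<lambda>s. - r (- s)"])
      show "- val (tder c s) z + f1 (val (c s) z) * (- yxfun c s z) = - yxxfun c s z + - r (- (- val (c s) z))" for s z
        by (simp add: yxxfun_def)
      show "- val (c 0) z \<le> M" for z using ini[of z] by linarith
      show "continuous_on ({0..t} \<times> {0..1}) (\<lambda>(t, x). - val (c t) x)"
        using continuous_on_minus[OF cy] by (simp add: case_prod_beta')
      show "continuous_on UNIV (\<lambda>s. - r (- s))"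
        by (intro continuous_intros continuous_on_compose2[OF cont_r[of UNIV]]) auto
    qed (use d M t x in \<open>auto intro: DERIV_minus\<close>)
    then have "\<not> K2 \<le> max 0 (- val (c t) x)" using K2[of "max 0 (- val (c t) x)"] t tau by auto
    ultimately show ?thesis by (auto simp: abs_le_iff)
  qed
  show ?thesis
  proof (intro exI[of _ "max 0 (max K1 K2)"] allI impI)
    fix c tau t x
    assume "tau \<le> T" "solves FF c tau" "norm (c 0) \<le> M" "0 \<le> t" "t < tau"
    then show "\<bar>val (c t) x\<bar> \<le> max 0 (max K1 K2)"
      using main[of tau c t x] by (cases "x \<in> {0..1}") (auto simp: val_outside)
  qed
qed

text \<open>The sup bound makes the nonlinearity grow linearly, and the energy estimate with
  Gronwall closes in V. Uniformity in \<open>tau\<close> and in the solution is what the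
  continuation argument and the dependence estimates require.\<close>

lemma apriori_bound:
  assumes M: "0 \<le> M"
  shows "\<exists>rho\<ge>0. \<forall>c tau. tau \<le> T \<longrightarrow> solves FF c tau \<longrightarrow> norm (c 0) \<le> M \<longrightarrow> (\<forall>t\<in>{0..tau}. norm (c t) \<le> rho)"
proof -
  obtain K where K: "\<And>c tau t x. tau \<le> T \<Longrightarrow> solves FF c tau \<Longrightarrow> norm (c 0) \<le> M \<Longrightarrow> 0 \<le> t \<Longrightarrow> t < tau \<Longrightarrow> \<bar>val (c t) x\<bar> \<le> K"
    using sup_bound[OF M, of T] by blast
  obtain B where B0: "0 \<le> B" and B: "\<And>c. (\<And>x. \<bar>val c x\<bar> \<le> K) \<Longrightarrow> norm (FF c) \<le> B * norm c + B"
    using FF_growth[of K] by blast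
  \<comment> \<open>From \<open>(B * n + B)^2 <= 2 * B^2 * n^2 + 2 * B^2\<close>: the constant part
    integrates to at most \<open>2 * B^2 * \<bar>T\<bar>\<close>, the other part goes into
    Gronwall.\<close>
  define A where "A = M\<^sup>2 + 2 * B\<^sup>2 * \<bar>T\<bar>"
  define rho where "rho = sqrt (A * exp (2 * B\<^sup>2 * \<bar>T\<bar>))"
  have A0: "0 \<le> A" by (simp add: A_def)
  have rho0: "0 \<le> rho" using A0 by (simp add: rho_def)
  have main: "norm (c t) \<le> rho"
    if tau: "tau \<le> T" and c: "solves FF c tau" and cM: "norm (c 0) \<le> M" and t: "t \<in> {0..<tau}" for c tau t
  proof -
    have ts: "t \<le> tau" using t by auto
    have ct: "solves FF c t" by (rule solves_mono[OF c ts])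
    have cc: "continuous_on {0..t} c" by (rule solves_continuous[OF ct])
    have cF: "continuous_on {0..t} (\<lambda>t. FF (c t))"
      by (intro continuous_on_compose2[OF continuous_on_FF[of UNIV] cc] subset_UNIV)
    have step: "(norm (c s))\<^sup>2 \<le> A + (2 * B\<^sup>2) * integral {0..s} (\<lambda>s. (norm (c s))\<^sup>2)" if s: "s \<in> {0..t}" for s
    proof -
      have sub: "{0..s} \<subseteq> {0..t}" using s by auto
      have "(norm (c s))\<^sup>2 \<le> (norm (c 0))\<^sup>2 + integral {0..s} (\<lambda>s. 2 * B\<^sup>2 * (norm (c s))\<^sup>2 + 2 * B\<^sup>2)"
      proof (rule ell2_energy(1)[where T=t and g="\<lambda>k t. coord (FF (c t)) k"])
        fix n u assume u: "u \<in> {0..t}"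
        have "norm (FF (c u)) \<le> B * norm (c u) + B"
          using u t by (intro B K[OF tau c cM]) auto
        then have "(norm (FF (c u)))\<^sup>2 \<le> (B * norm (c u) + B)\<^sup>2" by (intro power_mono) auto
        also have "\<dots> \<le> 2 * B\<^sup>2 * (norm (c u))\<^sup>2 + 2 * B\<^sup>2"
          using sum_squares_bound[of "B * norm (c u)" B] by (simp add: power2_sum power_mult_distrib)
        finally show "(\<Sum>k<n. (coord (FF (c u)) k)\<^sup>2) \<le> 2 * B\<^sup>2 * (norm (c u))\<^sup>2 + 2 * B\<^sup>2"
          by (intro order_trans[OF sum_coord_sq_le]) auto
      qed (use s solves_deriv[OF ct] in \<open>auto intro!: continuous_intros cc cF\<close>)
      also have "integral {0..s} (\<lambda>s. 2 * B\<^sup>2 * (norm (c s))\<^sup>2 + 2 * B\<^sup>2)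
          = (2 * B\<^sup>2) * integral {0..s} (\<lambda>s. (norm (c s))\<^sup>2) + 2 * B\<^sup>2 * s"
      proof (rule integral_unique)
        have "((\<lambda>s. 2 * B\<^sup>2) has_integral 2 * B\<^sup>2 * s) {0..s}"
          using has_integral_const_real[of "2 * B\<^sup>2" 0 s] s by (simp add: mult.commute)
        then show "((\<lambda>s. 2 * B\<^sup>2 * (norm (c s))\<^sup>2 + 2 * B\<^sup>2) has_integral
            (2 * B\<^sup>2) * integral {0..s} (\<lambda>s. (norm (c s))\<^sup>2) + 2 * B\<^sup>2 * s) {0..s}"
          by (intro has_integral_add has_integral_mult_right integrable_integral integrable_continuous_real
              continuous_intros continuous_on_subset[OF cc sub])
      qed
      also have "2 * B\<^sup>2 * s \<le> 2 * B\<^sup>2 * \<bar>T\<bar>" using s t tau by (intro mult_left_mono) auto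
      also have "(norm (c 0))\<^sup>2 \<le> M\<^sup>2" using cM by (intro power_mono) auto
      finally show ?thesis by (simp add: A_def)
    qed
    have "(norm (c t))\<^sup>2 \<le> A * exp (2 * B\<^sup>2 * t)"
      by (rule gronwall_integral[OF _ _ step]) (use t in \<open>auto intro!: continuous_intros cc\<close>)
    also have "\<dots> \<le> A * exp (2 * B\<^sup>2 * \<bar>T\<bar>)"
      using A0 t tau by (intro mult_left_mono) (auto intro!: mult_left_mono)
    also have "\<dots> = rho\<^sup>2" using A0 by (simp add: rho_def)
    finally show ?thesis by (rule power2_le_imp_le[OF _ rho0])
  qed
  have "norm (c t) \<le> max rho M"
    if tau: "tau \<le> T" and c: "solves FF c tau" and cM: "norm (c 0) \<le> M" and t: "t \<in> {0..tau}" for c tau t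
  proof (cases "t < tau")
    case True
    then show ?thesis using main[OF tau c cM, of t] t by auto
  next
    case False
    then have t': "t = tau" using t by simp
    show ?thesis
    proof (cases "tau = 0")
      case True
      then show ?thesis using cM t' by simp
    next
      case False
      then have pos: "0 < tau" using t by simp
      \<comment> \<open>The sup bound covers times strictly before \<open>tau\<close>; the endpoint
        follows as a limit from the left.\<close>
      have "continuous_on {0..tau} (\<lambda>s. norm (c s))" by (intro continuous_intros solves_continuous[OF c])
      then have lim: "((\<lambda>s. norm (c s)) \<longlongrightarrow> norm (c tau)) (at_left tau)"
        using pos by (simp add: continuous_on_def at_within_Icc_at_left)
           (metis at_within_Icc_at_left atLeastAtMost_iff less_imp_le order_refl)
      have "\<forall>\<^sub>F s in at_left tau. s \<in> {0<..<tau}" by (rule eventually_at_left_real[OF pos])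
      then have "\<forall>\<^sub>F s in at_left tau. norm (c s) \<le> rho"
        by eventually_elim (use main[OF tau c cM] in auto)
      then have "norm (c tau) \<le> rho"
        by (intro tendsto_upperbound[OF lim]) auto
      then show ?thesis using t' by simp
    qed
  qed
  then show ?thesis using rho0 by (intro exI[of _ "max rho M"]) auto
qed

section \<open>Global existence by radial truncation of the nonlinearity\<close>

definition radial :: "real \<Rightarrow> ell2 \<Rightarrow> ell2" where
  "radial rho c = (if norm c \<le> rho then c else (rho / norm c) *\<^sub>R c)"

lemma norm_radial_le: "0 \<le> rho \<Longrightarrow> norm (radial rho c) \<le> rho"
  by (auto simp: radial_def)

text \<open>With v the longer vector, both points are compared with the common scaling by
  \<open>rho / norm v\<close>: this scaling contracts differences, and replacing
  \<open>radial rho u\<close> by \<open>(rho / norm v) *\<^sub>R u\<close> costs at most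
  \<open>norm v - norm u\<close>.\<close>

lemma radial_lipschitz:
  assumes rho: "0 \<le> rho"
  shows "norm (radial rho c - radial rho d) \<le> 2 * norm (c - d)"
proof -
  have far: "norm (radial rho u - (rho / norm v) *\<^sub>R v) \<le> 2 * norm (u - v)"
    if v: "rho < norm v" and u: "norm u \<le> norm v" "norm (radial rho u - (rho / norm v) *\<^sub>R u) \<le> norm v - norm u" for u v
  proof -
    have v0: "0 < norm v" using rho v by linarith
    have "radial rho u - (rho / norm v) *\<^sub>R v
        = (radial rho u - (rho / norm v) *\<^sub>R u) + (rho / norm v) *\<^sub>R (u - v)"
      by (simp add: scaleR_diff_right)
    also have "norm \<dots> \<le> norm (radial rho u - (rho / norm v) *\<^sub>R u) + norm ((rho / norm v) *\<^sub>R (u - v))"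
      by (rule norm_triangle_ineq)
    also have "norm ((rho / norm v) *\<^sub>R (u - v)) \<le> 1 * norm (u - v)"
      unfolding norm_scaleR using rho v v0 by (intro mult_right_mono) auto
    also have "norm (radial rho u - (rho / norm v) *\<^sub>R u) \<le> norm (u - v)"
      using u(2) norm_triangle_ineq2[of v u] by (simp add: norm_minus_commute)
    finally show ?thesis by simp
  qed
  have main: "norm (radial rho u - radial rho v) \<le> 2 * norm (u - v)" if uv: "norm u \<le> norm v" for u v
  proof (cases "norm v \<le> rho")
    case True
    then show ?thesis using uv by (simp add: radial_def)
  next
    case False
    then have v: "rho < norm v" and rv: "radial rho v = (rho / norm v) *\<^sub>R v" by (auto simp: radial_def)
    have v0: "0 < norm v" using rho v by linarith
    have "norm (radial rho u - (rho / norm v) *\<^sub>R u) \<le> norm v - norm u"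
    proof (cases "norm u \<le> rho")
      case True
      have "radial rho u - (rho / norm v) *\<^sub>R u = (1 - rho / norm v) *\<^sub>R u"
        using True by (simp add: radial_def scaleR_diff_left)
      then have "norm (radial rho u - (rho / norm v) *\<^sub>R u) = \<bar>1 - rho / norm v\<bar> * norm u"
        by simp
      also have "\<dots> = (norm v - rho) * (norm u / norm v)"
        using v v0 by (simp add: field_simps abs_if)
      also have "\<dots> \<le> (norm v - rho) * 1"
        using v v0 uv by (intro mult_left_mono) auto
      also have "\<dots> \<le> norm v - norm u" using True by simp
      finally show ?thesis .
    next
      case False
      then have u0: "0 < norm u" using rho by linarith
      have "radial rho u - (rho / norm v) *\<^sub>R u = (rho / norm u - rho / norm v) *\<^sub>R u"
        using False by (simp add: radial_def scaleR_diff_left)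
      then have "norm (radial rho u - (rho / norm v) *\<^sub>R u) = \<bar>rho / norm u - rho / norm v\<bar> * norm u" by simp
      also have "\<bar>rho / norm u - rho / norm v\<bar> = rho / norm u - rho / norm v"
        using u0 v0 uv rho by (simp add: divide_left_mono)
      also have "(rho / norm u - rho / norm v) * norm u = rho * (norm v - norm u) / norm v"
        using u0 v0 by (simp add: field_simps)
      also have "\<dots> \<le> norm v - norm u"
        using v v0 uv by (simp add: divide_le_eq mult.commute[of rho] mult_left_mono)
      finally show ?thesis .
    qed
    then show ?thesis unfolding rv by (rule far[OF v uv])
  qed
  show ?thesis using main[of c d] main[of d c] by (cases "norm c \<le> norm d") (auto simp: norm_minus_commute)
qed

text \<open>The truncated nonlinearity is globally Lipschitz, so a solution exists on the whole
  interval. Until it first reaches the truncation radius it solves the true equation, where the a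
  priori bound keeps it strictly inside; it therefore never gets there.\<close>

lemma solves_exists_finite:
  assumes T: "0 \<le> T"
  shows "\<exists>c. c 0 = c0 \<and> solves FF c T"
proof -
  obtain rho where rho0: "rho \<ge> 0" and rho: "\<And>c tau t. tau \<le> T \<Longrightarrow> solves FF c tau \<Longrightarrow> norm (c 0) \<le> norm c0 \<Longrightarrow>
      t \<in> {0..tau} \<Longrightarrow> norm (c t) \<le> rho"
    using apriori_bound[of "norm c0" T] by auto
  \<comment> \<open>The margin 1 makes the a priori bound contradict an arrival at the
    radius.\<close>
  define R where "R = rho + 1"
  have R: "0 \<le> R" using rho0 by (simp add: R_def)
  obtain L where L0: "L \<ge> 0" and L: "\<And>c d. norm c \<le> R \<Longrightarrow> norm d \<le> R \<Longrightarrow> norm (FF c - FF d) \<le> L * norm (c - d)"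
    using FF_lipschitz[of R] by blast
  have "norm (FF (radial R x) - FF (radial R y)) \<le> (L * 2) * norm (x - y)" for x y
    using order_trans[OF L[OF norm_radial_le[OF R] norm_radial_le[OF R]] mult_left_mono[OF radial_lipschitz[OF R] L0]]
    by (simp add: mult.assoc)
  then obtain c where c: "c 0 = c0" "solves (\<lambda>c. FF (radial R c)) c T"
    using solves_exists_lipschitz[of "\<lambda>c. FF (radial R c)"] by blast
  have "norm (c t) \<le> R" if t: "t \<in> {0..T}" for t
  proof (rule ccontr)
    assume "\<not> norm (c t) \<le> R"
    let ?S = "{0..T} \<inter> (\<lambda>t. norm (c t)) -` {R..}"
    have "closed ?S"
      by (intro continuous_closed_preimage continuous_intros solves_continuous[OF c(2)])
    then have "compact ?S" by (metis bounded_closed_interval bounded_Int compact_eq_bounded_closed)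
    moreover have "?S \<noteq> {}" using t \<open>\<not> norm (c t) \<le> R\<close> by auto
    \<comment> \<open>\<open>s\<close> is the first time at which the norm reaches \<open>R\<close>;
      before it the truncation acts as the identity.\<close>
    ultimately obtain s where s: "s \<in> ?S" "\<And>u. u \<in> ?S \<Longrightarrow> s \<le> u"
      using compact_attains_inf[of ?S] by blast
    have "norm (c u) < R" if "0 < u" "u < s" for u
      using s(1) s(2)[of u] that by (cases "R \<le> norm (c u)") auto
    then have "solves FF c s"
      using s(1) by (intro solves_cong_nonlinearity[OF solves_mono[OF c(2)]])
        (auto simp: radial_def less_imp_le)
    then have "norm (c s) \<le> rho" using s(1) c(1) by (intro rho[of s c s]) auto
    then show False using s(1) by (simp add: R_def)
  qed
  then have "solves FF c T"
    by (intro solves_cong_nonlinearity[OF c(2)]) (auto simp: radial_def)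
  then show ?thesis using c(1) by blast
qed

section \<open>Uniqueness and the solution curve for all times\<close>

lemma solves_unique:
  assumes c: "solves FF c T" and d: "solves FF d S" and eq: "c 0 = d 0" and t: "0 \<le> t" "t \<le> T" "t \<le> S"
  shows "c t = d t"
proof -
  have c': "solves FF c t" and d': "solves FF d t" using c d t solves_mono by blast+
  obtain R1 R2 where R: "\<And>s. s \<in> {0..t} \<Longrightarrow> norm (c s) \<le> R1" "\<And>s. s \<in> {0..t} \<Longrightarrow> norm (d s) \<le> R2"
    using solves_bounds[OF c'] solves_bounds[OF d'] by blast
  obtain L where L: "\<And>c d. norm c \<le> max R1 R2 \<Longrightarrow> norm d \<le> max R1 R2 \<Longrightarrow> norm (FF c - FF d) \<le> L * norm (c - d)"
    using FF_lipschitz[of "max R1 R2"] by blast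
  have "(norm (c t - d t))\<^sup>2 \<le> (norm (c 0 - d 0))\<^sup>2 * exp (L\<^sup>2 * t)"
    using R t by (intro solves_difference_bound[OF c' d' continuous_on_FF] L) (auto simp: le_max_iff_disj)
  then show ?thesis using eq by simp
qed

text \<open>At each time t a solution on [0, t] is chosen and evaluated at its own end; uniqueness
  makes these choices fit together into one curve on every interval.\<close>

definition curve :: "ell2 \<Rightarrow> real \<Rightarrow> ell2" where
  "curve c0 t = (SOME c. c 0 = c0 \<and> solves FF c t) t"

lemma solves_eq_curve:
  assumes c: "solves FF c T" "c 0 = c0" and t: "t \<in> {0..T}"
  shows "c t = curve c0 t"
proof -
  have t0: "0 \<le> t" using t by simp
  define d where "d = (SOME c. c 0 = c0 \<and> solves FF c t)"
  have "d 0 = c0 \<and> solves FF d t" unfolding d_def by (rule someI_ex[OF solves_exists_finite[OF t0]])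
  then have d: "solves FF d t" and d0: "c 0 = d 0" using c(2) by blast+
  have "c t = d t" using t by (intro solves_unique[OF c(1) d d0 t0]) simp_all
  then show ?thesis unfolding curve_def d_def .
qed

lemma curve_0: "curve c0 0 = c0"
  using solves_exists_finite[of 0 c0] solves_eq_curve[of _ 0 c0 0] by fastforce

lemma solves_curve: "solves FF (curve c0) T"
proof (cases "0 \<le> T")
  case True
  obtain c where c: "c 0 = c0" "solves FF c T" using solves_exists_finite[OF True] by blast
  then show ?thesis using solves_cong[OF c(2) solves_eq_curve[OF c(2,1)]] by blast
next
  case False
  then have no: "(0 < t \<and> t < T) = False" for t by auto
  show ?thesis using False unfolding solves_def no by simp
qed

end

section \<open>The solution operator in coefficients\<close>

lemma continuous_on_half_strip:
  fixes F :: "real \<times> real \<Rightarrow> real"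
  assumes "\<And>T::real. continuous_on ({0<..<T} \<times> I) F"
  shows "continuous_on ({0<..} \<times> I) F"
  unfolding continuous_on_eq_continuous_within
proof
  fix p :: "real \<times> real" assume p: "p \<in> {0<..} \<times> I"
  let ?S = "{0<..<fst p + 1} \<times> (UNIV :: real set)"
  have "at p within {0<..} \<times> I = at p within {0<..<fst p + 1} \<times> I"
    by (rule at_within_nhd[where S="?S"]) (use p in \<open>auto intro: open_Times\<close>)
  moreover have "continuous (at p within {0<..<fst p + 1} \<times> I) F"
    using assms[of "fst p + 1"] p unfolding continuous_on_eq_continuous_within by auto
  ultimately show "continuous (at p within {0<..} \<times> I) F" by simp
qed

lemma continuous_on_slice:
  assumes "continuous_on (A \<times> I) (\<lambda>(t, x). F t x)" "t \<in> A"
  shows "continuous_on I (F t)"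
proof -
  have "continuous_on I (\<lambda>x. case (t, x) of (t, x) \<Rightarrow> F t x)"
    by (rule continuous_on_compose2[OF assms(1)]) (use assms(2) in \<open>auto intro!: continuous_intros\<close>)
  then show ?thesis by simp
qed

lemma scoef_cong_AE:
  assumes "sq_int f" "sq_int g" "AE x in I01. f x = g x"
  shows "scoef f k = scoef g k"
proof -
  note [measurable] = assms(1,2)[THEN sq_int_measurable] sq_int_measurable[OF sq_int_sinb[of k]]
  show ?thesis unfolding scoef_def using assms(3) by (intro integral_cong_AE) auto
qed

lemma weak_derivI_C1:
  assumes d: "\<And>x. x \<in> {0..1} \<Longrightarrow> (u has_real_derivative u' x) (at x within {0..1})"
    and c: "continuous_on {0..1} u'"
  shows "weak_deriv u u'"
  unfolding weak_deriv_def
proof (intro conjI ballI)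
  show "sq_int u'" by (rule sq_int_continuous[OF c])
  fix x :: real assume x: "x \<in> {0..1}"
  have "(u' has_integral (u x - u 0)) {0..x}"
  proof (rule fundamental_theorem_of_calculus)
    fix z assume z: "z \<in> {0..x}"
    then have "(u has_real_derivative u' z) (at z within {0..x})"
      using x by (intro DERIV_subset[OF d]) auto
    then show "(u has_vector_derivative u' z) (at z within {0..x})"
      by (simp add: has_real_derivative_iff_has_vector_derivative)
  qed (use x in auto)
  then show "u x = u 0 + integral {0..x} u'" by (simp add: integral_unique)
qed

context osgood
begin

lemma deriv_f: "deriv f x = f1 x"
  by (rule DERIV_imp_deriv[OF f1])

text \<open>The value 0 at negative times is the normalisation in \<open>is_solution\<close>; only
  with it is the solution unique as a function on the whole plane.\<close>

definition flow :: "ell2 \<Rightarrow> real \<Rightarrow> real \<Rightarrow> real" where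
  "flow c0 t x = (if t < 0 then 0 else val (curve c0 t) x)"

lemma is_solution_flow: "is_solution f r (val c0) (flow c0)"
proof -
  let ?c = "curve c0"
  note S = solves_curve[of c0]
  have cont: "continuous_on ({0<..} \<times> {0..1}) (\<lambda>(t, x). flow c0 t x)"
  proof (rule continuous_on_half_strip)
    fix T :: real
    have "continuous_on ({0<..<T} \<times> {0..1}) (\<lambda>(t, x). val (?c t) x)"
      by (rule continuous_on_subset[OF solves_val_continuous[OF S[of T]]]) auto
    then show "continuous_on ({0<..<T} \<times> {0..1}) (\<lambda>(t, x). flow c0 t x)"
      by (rule continuous_on_eq) (auto simp: flow_def)
  qed
  have lim: "((\<lambda>t. Vnorm (\<lambda>x. flow c0 t x - val c0 x)) \<longlongrightarrow> 0) (at_right 0)"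
  proof -
    have "(?c \<longlongrightarrow> ?c 0) (at 0 within {0..1})"
      using solves_continuous[OF S[of 1]] by (simp add: continuous_on_def)
    then have "(?c \<longlongrightarrow> c0) (at_right 0)"
      using at_within_Icc_at_right[of 0 "1::real"] by (simp add: curve_0)
    then have l: "((\<lambda>t. norm (?c t - c0)) \<longlongrightarrow> 0) (at_right 0)"
      by (intro tendsto_norm_zero LIM_zero)
    have "\<forall>\<^sub>F t::real in at_right 0. 0 < t" by (simp add: eventually_at_filter)
    then have "\<forall>\<^sub>F t in at_right 0. norm (?c t - c0) = Vnorm (\<lambda>x. flow c0 t x - val c0 x)"
    proof eventually_elim
      case (elim t)
      then have "(\<lambda>x. flow c0 t x - val c0 x) = val (?c t - c0)"
        by (auto simp: flow_def val_diff)
      then show ?case by (simp add: Vnorm_val)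
    qed
    from Lim_transform_eventually[OF l this] show ?thesis .
  qed
  have der: "(flow c0 t has_real_derivative yxfun ?c t x) (at x within {0..1})"
      "(yxfun ?c t has_real_derivative yxxfun ?c t x) (at x within {0..1})"
      "((\<lambda>s. flow c0 s x) has_real_derivative val (tder ?c t) x) (at t)"
      "val (tder ?c t) x + deriv f (flow c0 t x) * yxfun ?c t x = yxxfun ?c t x + r (flow c0 t x)"
    if t: "0 < t" and x: "x \<in> {0..1}" for t x
  proof -
    have tT: "t < t + 1" by simp
    have e: "flow c0 t = val (?c t)" using t by (auto simp: flow_def)
    show "(flow c0 t has_real_derivative yxfun ?c t x) (at x within {0..1})"
      "(yxfun ?c t has_real_derivative yxxfun ?c t x) (at x within {0..1})"
      unfolding e by (rule solves_val_x_deriv[OF S t tT x])+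
    have ev: "\<forall>\<^sub>F s in nhds t. val (?c s) x = flow c0 s x"
      using eventually_nhds_in_open[of "{0<..}" t] t by (auto simp: flow_def elim!: eventually_mono)
    show "((\<lambda>s. flow c0 s x) has_real_derivative val (tder ?c t) x) (at t)"
      using solves_val_deriv[OF S t tT x] DERIV_cong_ev[OF refl ev refl] by simp
    show "val (tder ?c t) x + deriv f (flow c0 t x) * yxfun ?c t x = yxxfun ?c t x + r (flow c0 t x)"
      unfolding e deriv_f by (simp add: yxxfun_def)
  qed
  have out: "flow c0 t x = 0" if "t < 0 \<or> x \<notin> {0..1}" for t x
    using that by (auto simp: flow_def val_outside)
  have "\<exists>yx yxx yt.
        continuous_on ({0<..} \<times> {0..1}) (\<lambda>(t,x). flow c0 t x) \<and>
        continuous_on ({0<..} \<times> {0..1}) (\<lambda>(t,x). yx t x) \<and>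
        continuous_on ({0<..} \<times> {0..1}) (\<lambda>(t,x). yxx t x) \<and>
        continuous_on ({0<..} \<times> {0..1}) (\<lambda>(t,x). yt t x) \<and>
        (\<forall>t>0. \<forall>x\<in>{0..1}.
           (flow c0 t has_real_derivative yx t x) (at x within {0..1}) \<and>
           (yx t has_real_derivative yxx t x) (at x within {0..1}) \<and>
           ((\<lambda>s. flow c0 s x) has_real_derivative yt t x) (at t) \<and>
           yt t x + deriv f (flow c0 t x) * yx t x = yxx t x + r (flow c0 t x))"
    by (intro exI[of _ "yxfun ?c"] exI[of _ "yxxfun ?c"] exI[of _ "\<lambda>t. val (tder ?c t)"] conjI cont
        continuous_on_half_strip solves_yxfun_continuous solves_yxxfun_continuous solves_tder_continuous S
        allI impI ballI der)
  moreover have "flow c0 0 x = val c0 x" for x by (simp add: flow_def curve_0)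
  moreover have "flow c0 t 0 = 0" "flow c0 t 1 = 0" for t by (simp_all add: flow_def)
  ultimately show ?thesis
    unfolding is_solution_def using out lim by blast
qed

text \<open>A classical solution is tested against the sine basis; two integrations by parts yield the
  coefficient equations.\<close>

lemma is_solution_imp_solves:
  assumes y: "is_solution f r (val c0) y"
  shows "\<exists>c. c 0 = c0 \<and> (\<forall>T. solves FF c T) \<and> (\<forall>t\<ge>0. y t = val (c t))"
proof -
  obtain yx yxx yt where
    cy: "continuous_on ({0<..} \<times> {0..1}) (\<lambda>(t,x). y t x)" and
    cyx: "continuous_on ({0<..} \<times> {0..1}) (\<lambda>(t,x). yx t x)" and
    cyxx: "continuous_on ({0<..} \<times> {0..1}) (\<lambda>(t,x). yxx t x)" and
    cyt: "continuous_on ({0<..} \<times> {0..1}) (\<lambda>(t,x). yt t x)" and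
    dx: "\<And>t x. t > 0 \<Longrightarrow> x \<in> {0..1} \<Longrightarrow> (y t has_real_derivative yx t x) (at x within {0..1})" and
    dxx: "\<And>t x. t > 0 \<Longrightarrow> x \<in> {0..1} \<Longrightarrow> (yx t has_real_derivative yxx t x) (at x within {0..1})" and
    dt: "\<And>t x. t > 0 \<Longrightarrow> x \<in> {0..1} \<Longrightarrow> ((\<lambda>s. y s x) has_real_derivative yt t x) (at t)" and
    pde: "\<And>t x. t > 0 \<Longrightarrow> x \<in> {0..1} \<Longrightarrow> yt t x + f1 (y t x) * yx t x = yxx t x + r (y t x)"
    using y unfolding is_solution_def deriv_f by blast
  have out: "\<And>t x. t < 0 \<or> x \<notin> {0..1} \<Longrightarrow> y t x = 0" and y0: "y 0 = val c0"
    and bc: "\<And>t. t > 0 \<Longrightarrow> y t 0 = 0" "\<And>t. t > 0 \<Longrightarrow> y t 1 = 0"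
    and lim: "((\<lambda>t. Vnorm (\<lambda>x. y t x - val c0 x)) \<longlongrightarrow> 0) (at_right 0)"
    using y unfolding is_solution_def by auto
  have cx: "continuous_on {0..1} (y t)" "continuous_on {0..1} (yx t)" "continuous_on {0..1} (yxx t)" "continuous_on {0..1} (yt t)"
    if "t > 0" for t
    using continuous_on_slice[OF cy] continuous_on_slice[OF cyx] continuous_on_slice[OF cyxx] continuous_on_slice[OF cyt] that
    by auto
  have wd: "weak_deriv (y t) (yx t)" if "t > 0" for t
    using dx[OF that] cx(2)[OF that] by (rule weak_derivI_C1)
  have "\<exists>d. y t = val d" if "t \<ge> 0" for t
  proof (cases "t = 0")
    case False
    then have "t > 0" using that by simp
    then have "y t \<in> H10"
      unfolding H10_def using out bc wd by (intro CollectI conjI exI[of _ "yx t"]) auto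
    then show ?thesis using H10_eq_range_val by auto
  qed (use y0 in auto)
  then obtain c where c: "\<And>t. t \<ge> 0 \<Longrightarrow> y t = val (c t)" by metis
  have c0: "c 0 = c0" by (rule val_inject) (use c[of 0] y0 in simp)
  have dera: "AE x in I01. der (c t) x = yx t x" if "t > 0" for t
    using weak_deriv_AE_unique[OF weak_deriv_val wd[OF that, unfolded c[OF less_imp_le[OF that]]]] .
  have nrm: "norm (c s - c t) \<le> L2norm (\<lambda>x. yx s x - yx t x)" if "s > 0" "t > 0" for s t
  proof -
    have "AE x in I01. der (c s) x - der (c t) x = yx s x - yx t x"
      using dera[OF that(1)] dera[OF that(2)] by eventually_elim simp
    then have "L2norm (\<lambda>x. der (c s) x - der (c t) x) = L2norm (\<lambda>x. yx s x - yx t x)"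
      using cx(2) that by (intro L2norm_cong_AE sq_int_diff sq_int_der sq_int_continuous)
    then show ?thesis by (simp add: L2norm_der_diff)
  qed
  \<comment> \<open>Continuity in V at positive times comes from uniform closeness of the slices of
    \<open>yx\<close>.\<close>
  have cont_pos: "(c \<longlongrightarrow> c t) (at t)" if t: "t > 0" for t
  proof (rule tendstoI)
    fix e :: real assume e: "0 < e"
    obtain d where d: "d > 0" "\<And>s. \<bar>s - t\<bar> < d \<Longrightarrow> s \<in> {0<..} \<and> (\<forall>x\<in>{0..1}. \<bar>yx s x - yx t x\<bar> < e / 2)"
      using continuous_on_slices_uniform[OF cyx, of t "e / 2"] t e by auto
    have "dist (c s) (c t) < e" if s: "\<bar>s - t\<bar> < d" for s
    proof -
      have "s > 0" using d(2)[OF s] by simp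
      then have "norm (c s - c t) \<le> L2norm (\<lambda>x. yx s x - yx t x)" by (rule nrm[OF _ t])
      also have "\<dots> \<le> e / 2"
        using d(2)[OF s] cx(2)[OF t] cx(2)[OF \<open>s > 0\<close>]
        by (intro L2norm_bounded sq_int_diff sq_int_continuous) (auto simp: less_imp_le)
      finally show ?thesis using e by (simp add: dist_norm)
    qed
    then show "\<forall>\<^sub>F s in at t. dist (c s) (c t) < e"
      unfolding eventually_at using d(1) by (intro exI[of _ d]) (auto simp: dist_real_def)
  qed
  \<comment> \<open>At time 0 no derivative is available; continuity in V is exactly the initial
    condition of \<open>is_solution\<close>.\<close>
  have cont_0: "(c \<longlongrightarrow> c 0) (at_right 0)"
  proof -
    have "\<forall>\<^sub>F t::real in at_right 0. 0 < t" by (simp add: eventually_at_filter)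
    then have "\<forall>\<^sub>F t in at_right 0. Vnorm (\<lambda>x. y t x - val c0 x) = norm (c t - c0)"
    proof eventually_elim
      case (elim t)
      then have "(\<lambda>x. y t x - val c0 x) = val (c t - c0)" using c[of t] by (auto simp: val_diff)
      then show ?case by (simp add: Vnorm_val)
    qed
    from Lim_transform_eventually[OF lim this] have "((\<lambda>t. norm (c t - c0)) \<longlongrightarrow> 0) (at_right 0)" .
    then show ?thesis unfolding c0 by (simp add: tendsto_norm_zero_iff LIM_zero_iff)
  qed
  have cc: "continuous_on {0..T} c" for T
    unfolding continuous_on_def
  proof
    fix t assume t: "t \<in> {0..T}"
    show "(c \<longlongrightarrow> c t) (at t within {0..T})"
    proof (cases "t = 0")
      case True
      have "(c \<longlongrightarrow> c 0) (at 0 within {0..})"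
        using cont_0 by (simp add: at_within_Ici_at_right)
      then show ?thesis unfolding True by (rule tendsto_within_subset) auto
    next
      case False
      then have "t > 0" using t by simp
      then show ?thesis using tendsto_within_subset[OF cont_pos subset_UNIV] by blast
    qed
  qed
  have dc: "((\<lambda>t. coord (c t) k) has_real_derivative (- (kap k)\<^sup>2 * coord (c t) k + kap k * coord (FF (c t)) k)) (at t)"
    if t: "t > 0" for t k
  proof -
    have coef: "coord (c s) k = kap k * integral {0..1} (\<lambda>x. y s x * sinb k x)" if s: "s > 0" for s
    proof -
      have "coord (c s) k = kap k * scoef (y s) k" using c[of s] s by (simp add: scoef_val)
      also have "scoef (y s) k = integral {0..1} (\<lambda>x. y s x * sinb k x)"
        unfolding scoef_def
        by (intro integral_I01_eq[symmetric] continuous_imp_integrable_real continuous_intros cx(1)[OF s])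
      finally show ?thesis .
    qed
    \<comment> \<open>Differentiation under the integral on the half-line of positive times, where
      \<open>yt\<close> is jointly continuous.\<close>
    have "((\<lambda>s. integral (cbox 0 1) (\<lambda>x. y s x * sinb k x)) has_real_derivative
        integral (cbox 0 1) (\<lambda>x. yt t x * sinb k x)) (at t within {0<..})"
    proof (rule leibniz_rule_field_derivative)
      show "((\<lambda>s. y s x * sinb k x) has_real_derivative yt s x * sinb k x) (at s within {0<..})"
        if "s \<in> {0<..}" "x \<in> cbox 0 1" for s x
        using that by (intro DERIV_cmult_right has_field_derivative_at_within[OF dt]) auto
      show "(\<lambda>x. y s x * sinb k x) integrable_on cbox 0 1" if "s \<in> {0<..}" for s
        using that unfolding cbox_interval by (intro integrable_continuous_real continuous_intros cx(1)) auto
      have "continuous_on ({0<..} \<times> {0..1}) (\<lambda>p. (case p of (s, x) \<Rightarrow> yt s x) * sinb k (snd p))"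
        by (intro continuous_intros cyt continuous_on_compose2[OF continuous_on_sinb[of UNIV k]]) auto
      then show "continuous_on ({0<..} \<times> cbox 0 1) (\<lambda>(s, x). yt s x * sinb k x)"
        by (simp add: case_prod_beta')
    qed (use t in \<open>auto simp: convex_real_interval\<close>)
    then have "((\<lambda>s. kap k * integral {0..1} (\<lambda>x. y s x * sinb k x)) has_real_derivative
        kap k * integral {0..1} (\<lambda>x. yt t x * sinb k x)) (at t)"
      using t by (intro DERIV_cmult) (simp add: at_within_open[of t "{0<..}"])
    moreover have ev: "\<forall>\<^sub>F s in nhds t. kap k * integral {0..1} (\<lambda>x. y s x * sinb k x) = coord (c s) k"
      using eventually_nhds_in_open[of "{0<..}" t] t by (auto simp: coef elim!: eventually_mono)
    ultimately have d: "((\<lambda>t. coord (c t) k) has_real_derivative kap k * integral {0..1} (\<lambda>x. yt t x * sinb k x)) (at t)"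
      using DERIV_cong_ev[OF refl ev refl] by simp
    have sN: "sq_int (\<lambda>x. - f1 (y t x) * yx t x + r (y t x))"
      by (intro sq_int_continuous continuous_intros cx[OF t]
          continuous_on_compose2[OF cont_f1[of UNIV] cx(1)[OF t]] continuous_on_compose2[OF cont_r[of UNIV] cx(1)[OF t]]) auto
    have "integral {0..1} (\<lambda>x. yt t x * sinb k x) = (LINT x|I01. yt t x * sinb k x)"
      by (intro integral_I01_eq continuous_imp_integrable_real continuous_intros cx[OF t])
    also have "\<dots> = (LINT x|I01. yxx t x * sinb k x + (- f1 (y t x) * yx t x + r (y t x)) * sinb k x)"
    proof (rule Bochner_Integration.integral_cong[OF refl])
      fix x assume "x \<in> space I01"
      then have "yt t x = yxx t x + (- f1 (y t x) * yx t x + r (y t x))" using pde[OF t, of x] by simp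
      then show "yt t x * sinb k x = yxx t x * sinb k x + (- f1 (y t x) * yx t x + r (y t x)) * sinb k x"
        by (simp only: distrib_right)
    qed
    also have "\<dots> = (LINT x|I01. yxx t x * sinb k x) + scoef (\<lambda>x. - f1 (y t x) * yx t x + r (y t x)) k"
      unfolding scoef_def
      by (intro Bochner_Integration.integral_add continuous_imp_integrable_real continuous_intros cx[OF t]
          integrable_sq_int_mult sN sq_int_sinb)
    also have "scoef (\<lambda>x. - f1 (y t x) * yx t x + r (y t x)) k = coord (FF (c t)) k"
    proof -
      have "AE x in I01. - f1 (y t x) * yx t x + r (y t x) = FFfun (c t) x"
        using dera[OF t] by eventually_elim (use c[of t] t in \<open>simp add: FFfun_def\<close>)
      then show ?thesis unfolding coord_FF by (intro scoef_cong_AE sN sq_int_FFfun)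
    qed
    \<comment> \<open>The first integration by parts is the fundamental theorem for
      \<open>yx * sinb\<close>, whose boundary terms vanish with the sine; the second is
      \<open>scoef_H10\<close>, whose boundary terms vanish with \<open>y\<close>.\<close>
    also have "(LINT x|I01. yxx t x * sinb k x) = - kap k * coord (c t) k"
    proof -
      have "(LINT x|I01. yxx t x * sinb k x + kap k * (yx t x * cosb k x)) = yx t 1 * sinb k 1 - yx t 0 * sinb k 0"
      proof (rule LINT_FTC)
        fix x :: real assume x: "x \<in> {0..1}"
        show "((\<lambda>x. yx t x * sinb k x) has_real_derivative yxx t x * sinb k x + kap k * (yx t x * cosb k x)) (at x within {0..1})"
          by (rule DERIV_cong[OF DERIV_mult[OF dxx[OF t x] sinb_deriv]]) (simp add: mult_ac)
      qed (intro continuous_intros cx[OF t])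
      moreover have "(LINT x|I01. yxx t x * sinb k x + kap k * (yx t x * cosb k x))
          = (LINT x|I01. yxx t x * sinb k x) + kap k * ccoef (yx t) k"
      proof -
        have "integrable I01 (\<lambda>x. yxx t x * sinb k x)" "integrable I01 (\<lambda>x. yx t x * cosb k x)"
          by (intro continuous_imp_integrable_real continuous_intros cx[OF t])+
        then show ?thesis unfolding ccoef_def by simp
      qed
      moreover have "ccoef (yx t) k = coord (c t) k"
        using scoef_H10[OF wd[OF t] bc(1)[OF t] bc(2)[OF t], of k] c[of t] t by (simp add: scoef_val)
      ultimately show ?thesis by simp
    qed
    finally have e: "integral {0..1} (\<lambda>x. yt t x * sinb k x) = - kap k * coord (c t) k + coord (FF (c t)) k" .
    have "kap k * integral {0..1} (\<lambda>x. yt t x * sinb k x) = - (kap k)\<^sup>2 * coord (c t) k + kap k * coord (FF (c t)) k"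
      unfolding e by (simp add: algebra_simps power2_eq_square)
    with d show ?thesis by (simp only:)
  qed
  have "solves FF c T" for T
    unfolding solves_def using cc dc by blast
  then show ?thesis using c0 c by blast
qed

text \<open>Discharges the definite description in \<open>sol\<close>: the coefficient equations and
  their uniqueness transfer to any classical solution.\<close>

theorem sol_eq_flow: "sol f r (val c0) = flow c0"
  unfolding sol_def
proof (rule the_equality[where P="is_solution f r (val c0)", OF is_solution_flow])
  fix y assume y: "is_solution f r (val c0) y"
  obtain c where c: "c 0 = c0" "\<And>T. solves FF c T" "\<And>t. t \<ge> 0 \<Longrightarrow> y t = val (c t)"
    using is_solution_imp_solves[OF y] by blast
  show "y = flow c0"
  proof (intro ext)
    fix t x
    show "y t x = flow c0 t x"
    proof (cases "t < 0")
      case True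
      then show ?thesis using y by (simp add: flow_def is_solution_def)
    next
      case False
      then have "c t = curve c0 t" by (intro solves_eq_curve[OF c(2)[of t] c(1)]) auto
      then show ?thesis using c(3)[of t] False by (simp add: flow_def)
    qed
  qed
qed

lemma sol_val: "0 \<le> t \<Longrightarrow> sol f r (val c0) t = val (curve c0 t)"
  unfolding sol_eq_flow by (auto simp: flow_def)

end

section \<open>Second-order midpoint estimate\<close>

text \<open>Parseval for the sines, exact for finite sections, which converge in V and hence in
  L^2.\<close>

lemma L2norm_val_sums: "(\<lambda>k. (coord c k / kap k)\<^sup>2) sums (L2norm (val c))\<^sup>2"
proof -
  have t: "val (ell2_trunc n c) x = (\<Sum>k<n. coord c k / kap k * sinb k x)" if "x \<in> {0..1}" for n x
    using that unfolding val_def coord_ell2_trunc by (subst suminf_finite[of "{..<n}"]) auto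
  have n: "(L2norm (val (ell2_trunc n c)))\<^sup>2 = (\<Sum>k<n. (coord c k / kap k)\<^sup>2)" for n
    using L2norm_orthonormal_sum[OF sq_int_sinb sinb_orthonormal, of "\<lambda>k. coord c k / kap k" n]
      L2norm_cong[of "val (ell2_trunc n c)" "\<lambda>x. \<Sum>k<n. coord c k / kap k * sinb k x", OF t] by simp
  have l: "(\<lambda>n. norm (ell2_trunc n c - c)) \<longlonglongrightarrow> 0"
    by (intro tendsto_norm_zero LIM_zero ell2_trunc_tendsto)
  have "(\<lambda>n. L2norm (\<lambda>x. val (ell2_trunc n c) x - val c x)) \<longlonglongrightarrow> 0"
  proof (rule Lim_null_comparison[OF always_eventually l], intro allI)
    fix n
    have "L2norm (\<lambda>x. val (ell2_trunc n c) x - val c x) \<le> norm (ell2_trunc n c - c)"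
      by (intro L2norm_bounded sq_int_diff sq_int_val) (metis abs_val_le val_diff)
    then show "norm (L2norm (\<lambda>x. val (ell2_trunc n c) x - val c x)) \<le> norm (ell2_trunc n c - c)" by simp
  qed
  then have "(\<lambda>n. (L2norm (val (ell2_trunc n c)))\<^sup>2) \<longlonglongrightarrow> (L2norm (val c))\<^sup>2"
    by (intro tendsto_power L2norm_tendsto sq_int_val)
  then show ?thesis by (simp add: sums_def n)
qed

lemma L2norm_val_le: "L2norm (val c) \<le> norm c"
  by (intro L2norm_bounded sq_int_val abs_val_le)

lemma L2norm_val_lipschitz: "\<bar>L2norm (val c) - L2norm (val d)\<bar> \<le> norm (c - d)"
proof -
  have "L2norm (val c) - L2norm (val d) \<le> norm (c - d)" for c d
  proof -
    have "L2norm (val c) = L2norm (\<lambda>x. val (c - d) x + val d x)" by (simp add: val_diff)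
    also have "\<dots> \<le> L2norm (val (c - d)) + L2norm (val d)" by (intro L2norm_triangle sq_int_val)
    finally show ?thesis using L2norm_val_le[of "c - d"] by simp
  qed
  from this[of c d] this[of d c] show ?thesis by (simp add: norm_minus_commute abs_le_iff)
qed

lemma continuous_on_L2norm_val:
  assumes "continuous_on S c"
  shows "continuous_on S (\<lambda>t. L2norm (val (c t)))"
proof -
  have "1-lipschitz_on UNIV (\<lambda>c. L2norm (val c))"
    using L2norm_val_lipschitz by (intro lipschitz_onI) (auto simp: dist_norm)
  then have "continuous_on UNIV (\<lambda>c. L2norm (val c))" by (rule lipschitz_on_continuous_on)
  from continuous_on_compose2[OF this assms] show ?thesis by simp
qed

section \<open>Second differences and continuity of nonlinear coefficients\<close>

context reaction
begin

text \<open>For the exact midpoint c, the even function \<open>g (c + s) + g (c - s)\<close> has a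
  derivative of size B times 2s, so it moves by O((x - y)^2) up to half the distance of the points.
  Replacing c by m costs a first-order term.\<close>

lemma midpoint_defect:
  assumes g: "\<And>x. (g has_real_derivative g1 x) (at x)" "\<And>x. (g1 has_real_derivative g2 x) (at x)"
    and b: "\<And>x. \<bar>x\<bar> \<le> rho \<Longrightarrow> \<bar>g1 x\<bar> \<le> B" "\<And>x. \<bar>x\<bar> \<le> rho \<Longrightarrow> \<bar>g2 x\<bar> \<le> B" and B: "0 \<le> B"
    and x: "\<bar>x\<bar> \<le> rho" and y: "\<bar>y\<bar> \<le> rho" and m: "\<bar>m\<bar> \<le> rho"
  shows "\<bar>g m - (g x + g y) / 2\<bar> \<le> B * \<bar>m - (x + y) / 2\<bar> + B * (x - y)\<^sup>2"
proof -
  define c where "c = (x + y) / 2"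
  define d where "d = \<bar>y - x\<bar> / 2"
  have d0: "0 \<le> d" by (simp add: d_def)
  have c: "\<bar>c\<bar> \<le> rho" using x y unfolding c_def by (simp add: abs_le_iff)
  have in1: "\<bar>c + s\<bar> \<le> rho" "\<bar>c - s\<bar> \<le> rho" if "s \<in> {0..d}" for s
  proof -
    have "2 * c = x + y" "2 * s \<le> \<bar>y - x\<bar>" "0 \<le> s" using that by (simp_all add: c_def d_def)
    then show "\<bar>c + s\<bar> \<le> rho" "\<bar>c - s\<bar> \<le> rho" using x y by linarith+
  qed
  define p where "p s = g (c + s) + g (c - s)" for s
  have dp: "(p has_real_derivative (g1 (c + s) - g1 (c - s))) (at s within {0..d})" for s
  proof -
    have "((\<lambda>s. g (c + s)) has_real_derivative g1 (c + s) * 1) (at s within {0..d})"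
      by (rule DERIV_chain2[OF g(1)]) (auto intro!: derivative_eq_intros)
    moreover have "((\<lambda>s. g (c - s)) has_real_derivative g1 (c - s) * (-1)) (at s within {0..d})"
      by (rule DERIV_chain2[OF g(1)]) (auto intro!: derivative_eq_intros)
    ultimately have "((\<lambda>s. g (c + s) + g (c - s)) has_real_derivative g1 (c + s) * 1 + g1 (c - s) * (-1)) (at s within {0..d})"
      by (rule DERIV_add)
    then show ?thesis by (simp add: p_def[abs_def])
  qed
  have bp: "norm (g1 (c + s) - g1 (c - s)) \<le> 2 * B * d" if s: "s \<in> {0..d}" for s
  proof -
    have "\<bar>g1 (c + s) - g1 (c - s)\<bar> \<le> B * \<bar>(c + s) - (c - s)\<bar>"
      by (rule lipschitz_bound[OF g(2) b(2) in1(1)[OF s] in1(2)[OF s]])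
    also have "\<dots> \<le> B * (2 * d)" using s B by (intro mult_left_mono) auto
    finally show ?thesis by simp
  qed
  have "norm (p d - p 0) \<le> 2 * B * d * norm (d - 0)"
    by (rule field_differentiable_bound[OF _ dp bp]) (use d0 in auto)
  then have "\<bar>p d - p 0\<bar> \<le> 2 * B * d\<^sup>2" using d0 by (simp add: power2_eq_square)
  moreover have "p d = g x + g y"
    unfolding p_def c_def d_def by (cases "x \<le> y") (auto simp: field_simps)
  moreover have "p 0 = 2 * g c" by (simp add: p_def)
  ultimately have "\<bar>g x + g y - 2 * g c\<bar> \<le> 2 * B * d\<^sup>2" by simp
  moreover have "B * d\<^sup>2 \<le> B * (x - y)\<^sup>2"
  proof (rule mult_left_mono[OF _ B])
    have "d\<^sup>2 = (x - y)\<^sup>2 / 4" by (simp add: d_def power_divide power2_commute)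
    then show "d\<^sup>2 \<le> (x - y)\<^sup>2" using zero_le_power2[of "x - y"] by linarith
  qed
  moreover have "\<bar>g m - g c\<bar> \<le> B * \<bar>m - c\<bar>" by (rule lipschitz_bound[OF g(1) b(1) m c])
  moreover define a where "a = (g x + g y) / 2"
  moreover have "g x + g y = 2 * a" by (simp add: a_def)
  ultimately have "\<bar>g m - a\<bar> \<le> B * \<bar>m - c\<bar> + B * (x - y)\<^sup>2" by linarith
  then show ?thesis unfolding c_def a_def .
qed

text \<open>Makes both sides of the divergence form continuous on V, so that the identity can be
  carried from smooth states to arbitrary ones.\<close>

lemma coefficient_continuous:
  assumes g: "\<And>x. (g has_real_derivative g1 x) (at x)" and g1: "continuous_on UNIV g1" and e: "sq_int e"
  shows "continuous_on UNIV (\<lambda>c. LINT x|I01. g (val c x) * e x)"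
proof -
  have cg: "continuous_on UNIV g"
    by (rule DERIV_continuous_on[OF has_field_derivative_at_within[OF g]])
  show ?thesis
  proof (rule continuous_on_if_lipschitz_on_balls)
    fix rho
    have "bounded (g1 ` {-rho..rho})"
      by (intro compact_imp_bounded compact_continuous_image continuous_on_subset[OF g1]) auto
    then obtain B where "\<forall>y\<in>g1 ` {-rho..rho}. norm y \<le> B" unfolding bounded_iff by blast
    then have B: "\<bar>g1 x\<bar> \<le> B" if "\<bar>x\<bar> \<le> rho" for x using that by (auto simp: abs_le_iff)
    have "dist (LINT x|I01. g (val c x) * e x) (LINT x|I01. g (val d x) * e x) \<le> \<bar>B\<bar> * L2norm e * norm (c - d)"
      if "norm c \<le> rho" "norm d \<le> rho" for c d
    proof -
      have v: "\<bar>val c x\<bar> \<le> rho" "\<bar>val d x\<bar> \<le> rho" for x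
        using abs_val_le[of c x] abs_val_le[of d x] that by auto
      have s: "sq_int (\<lambda>x. g (val c x))" "sq_int (\<lambda>x. g (val d x))"
        by (intro sq_int_continuous cont_val_comp cg)+
      have "(LINT x|I01. g (val c x) * e x) - (LINT x|I01. g (val d x) * e x) = (LINT x|I01. (g (val c x) - g (val d x)) * e x)"
        using s e by (simp add: left_diff_distrib integrable_sq_int_mult)
      also have "\<bar>\<dots>\<bar> \<le> L2norm (\<lambda>x. g (val c x) - g (val d x)) * L2norm e"
        by (intro L2_Cauchy_Schwarz sq_int_diff s e)
      also have "L2norm (\<lambda>x. g (val c x) - g (val d x)) \<le> \<bar>B\<bar> * norm (c - d)"
      proof (intro L2norm_bounded sq_int_diff s)
        fix x
        have "\<bar>g (val c x) - g (val d x)\<bar> \<le> B * \<bar>val c x - val d x\<bar>" by (rule lipschitz_bound[OF g B v])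
        also have "\<dots> \<le> \<bar>B\<bar> * norm (c - d)"
          using abs_val_le[of "c - d" x] by (intro mult_mono) (auto simp: val_diff)
        finally show "\<bar>g (val c x) - g (val d x)\<bar> \<le> \<bar>B\<bar> * norm (c - d)" .
      qed
      finally show ?thesis by (simp add: dist_real_def mult_right_mono mult_ac)
    qed
    then show "\<exists>L. \<forall>c d. norm c \<le> rho \<longrightarrow> norm d \<le> rho \<longrightarrow>
        dist (LINT x|I01. g (val c x) * e x) (LINT x|I01. g (val d x) * e x) \<le> L * norm (c - d)" by blast
  qed
qed

end

section \<open>Dependence of the flow on the initial datum\<close>

context osgood
begin

text \<open>The divergence form moves the derivative of \<open>f \<circ> val c\<close> onto the sine, so that only values of
  \<open>f\<close> enter. It is proved at positive times, where \<open>val (curve c t)\<close> is smooth, and extended by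
  continuity to time zero.\<close>

lemma FF_divergence_form:
  "coord (FF c) k = kap k * ccoef (\<lambda>x. f (val c x)) k + scoef (\<lambda>x. r (val c x)) k"
proof -
  let ?c = "curve c"
  define W where "W d = coord (FF d) k - (kap k * ccoef (\<lambda>x. f (val d x)) k + scoef (\<lambda>x. r (val d x)) k)" for d
  have cW: "continuous_on UNIV W"
    unfolding W_def ccoef_def scoef_def
    by (intro continuous_intros continuous_on_FF coefficient_continuous[OF f1 cont_f1] coefficient_continuous[OF r1 cont_r1]
        sq_int_sinb sq_int_cosb)
  have W0: "W (?c t) = 0" if t: "0 < t" for t
  proof -
    have tT: "t < t + 1" by simp
    note S = solves_curve[of c "t + 1"]
    have cf: "continuous_on {0..1} (\<lambda>x. f (val (?c t) x))" "continuous_on {0..1} (\<lambda>x. f1 (val (?c t) x))"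
      "continuous_on {0..1} (\<lambda>x. r (val (?c t) x))"
      by (intro cont_val_comp cont_f cont_f1 cont_r)+
    note cy = continuous_on_yxfun[of ?c t]
    have "AE x in I01. FFfun (?c t) x = - f1 (val (?c t) x) * yxfun ?c t x + r (val (?c t) x)"
      using der_eq_yxfun_AE[OF S t tT] by eventually_elim (simp add: FFfun_def)
    then have "coord (FF (?c t)) k = scoef (\<lambda>x. - f1 (val (?c t) x) * yxfun ?c t x + r (val (?c t) x)) k"
      unfolding coord_FF
      by (intro scoef_cong_AE sq_int_FFfun sq_int_continuous continuous_intros cf cy)
    also have "\<dots> = scoef (\<lambda>x. r (val (?c t) x)) k - (LINT x|I01. f1 (val (?c t) x) * yxfun ?c t x * sinb k x)"
    proof -
      have "integrable I01 (\<lambda>x. r (val (?c t) x) * sinb k x)" "integrable I01 (\<lambda>x. f1 (val (?c t) x) * yxfun ?c t x * sinb k x)"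
        by (intro continuous_imp_integrable_real continuous_intros cf cy)+
      then have "(LINT x|I01. r (val (?c t) x) * sinb k x - f1 (val (?c t) x) * yxfun ?c t x * sinb k x)
          = scoef (\<lambda>x. r (val (?c t) x)) k - (LINT x|I01. f1 (val (?c t) x) * yxfun ?c t x * sinb k x)"
        unfolding scoef_def by (rule Bochner_Integration.integral_diff)
      moreover have "(- f1 (val (?c t) x) * yxfun ?c t x + r (val (?c t) x)) * sinb k x
          = r (val (?c t) x) * sinb k x - f1 (val (?c t) x) * yxfun ?c t x * sinb k x" for x
        by (simp add: algebra_simps)
      ultimately show ?thesis unfolding scoef_def by presburger
    qed
    also have "(LINT x|I01. f1 (val (?c t) x) * yxfun ?c t x * sinb k x) = - kap k * ccoef (\<lambda>x. f (val (?c t) x)) k"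
    proof -
      have "(LINT x|I01. f1 (val (?c t) x) * yxfun ?c t x * sinb k x + kap k * (f (val (?c t) x) * cosb k x))
          = f (val (?c t) 1) * sinb k 1 - f (val (?c t) 0) * sinb k 0"
      proof (rule LINT_FTC)
        fix x :: real assume x: "x \<in> {0..1}"
        have "((\<lambda>x. f (val (?c t) x)) has_real_derivative f1 (val (?c t) x) * yxfun ?c t x) (at x within {0..1})"
          by (rule DERIV_chain2[OF f1 solves_val_x_deriv(1)[OF S t tT x]])
        then show "((\<lambda>x. f (val (?c t) x) * sinb k x) has_real_derivative
            f1 (val (?c t) x) * yxfun ?c t x * sinb k x + kap k * (f (val (?c t) x) * cosb k x)) (at x within {0..1})"
          by (rule DERIV_cong[OF DERIV_mult[OF _ sinb_deriv]]) (simp add: mult_ac)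
      qed (intro continuous_intros cf cy)
      moreover have "(LINT x|I01. f1 (val (?c t) x) * yxfun ?c t x * sinb k x + kap k * (f (val (?c t) x) * cosb k x))
          = (LINT x|I01. f1 (val (?c t) x) * yxfun ?c t x * sinb k x) + kap k * ccoef (\<lambda>x. f (val (?c t) x)) k"
      proof -
        have "integrable I01 (\<lambda>x. f1 (val (?c t) x) * yxfun ?c t x * sinb k x)" "integrable I01 (\<lambda>x. f (val (?c t) x) * cosb k x)"
          by (intro continuous_imp_integrable_real continuous_intros cf cy)+
        then show ?thesis unfolding ccoef_def by simp
      qed
      ultimately show ?thesis by simp
    qed
    finally show ?thesis by (simp add: W_def)
  qed
  have "continuous_on {0..1} (\<lambda>t. W (?c t))"
    by (rule continuous_on_compose2[OF cW solves_continuous[OF solves_curve]]) simp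
  then have "((\<lambda>t. W (?c t)) \<longlongrightarrow> W (?c 0)) (at 0 within {0..1})"
    by (simp add: continuous_on_def)
  then have "((\<lambda>t. W (?c t)) \<longlongrightarrow> W (?c 0)) (at_right 0)"
    by (simp add: at_within_Icc_at_right)
  moreover have "\<forall>\<^sub>F t::real in at_right 0. 0 < t" by (simp add: eventually_at_filter)
  then have "\<forall>\<^sub>F t in at_right 0. W (?c t) = 0" by eventually_elim (rule W0)
  then have "((\<lambda>t. W (?c t)) \<longlongrightarrow> 0) (at_right 0)" by (rule tendsto_eventually)
  ultimately have "W (?c 0) = 0" by (intro tendsto_unique[of "at_right (0::real)"]) auto
  then show ?thesis by (simp add: W_def curve_0)
qed

lemma curve_lipschitz:
  assumes M: "0 \<le> M"
  shows "\<exists>C\<ge>0. \<forall>c d t. norm c \<le> M \<longrightarrow> norm d \<le> M \<longrightarrow> t \<in> {0..T} \<longrightarrow>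
    norm (curve c t - curve d t) \<le> C * norm (c - d)"
proof -
  obtain rho where rho: "\<And>c tau t. tau \<le> T \<Longrightarrow> solves FF c tau \<Longrightarrow> norm (c 0) \<le> M \<Longrightarrow> t \<in> {0..tau} \<Longrightarrow> norm (c t) \<le> rho"
    using apriori_bound[OF M, of T] by blast
  obtain L where L: "\<And>c d. norm c \<le> rho \<Longrightarrow> norm d \<le> rho \<Longrightarrow> norm (FF c - FF d) \<le> L * norm (c - d)"
    using FF_lipschitz[of rho] by blast
  \<comment> \<open>The energy bound concerns squared norms; this is more than the square root of
    its factor, which saves taking one, and the absolute value covers negative
    \<open>T\<close>.\<close>
  define C where "C = exp (L\<^sup>2 * \<bar>T\<bar>)"
  have "norm (curve c t - curve d t) \<le> C * norm (c - d)"
    if c: "norm c \<le> M" and d: "norm d \<le> M" and t: "t \<in> {0..T}" for c d t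
  proof (rule power2_le_imp_le)
    have b: "norm (curve c s) \<le> rho" "norm (curve d s) \<le> rho" if "s \<in> {0..T}" for s
      by (rule rho[OF order_refl solves_curve]; use c d that in \<open>simp add: curve_0\<close>)+
    have "(norm (curve c t - curve d t))\<^sup>2 \<le> (norm (curve c 0 - curve d 0))\<^sup>2 * exp (L\<^sup>2 * t)"
      by (rule solves_difference_bound[OF solves_curve solves_curve continuous_on_FF L[OF b] t])
    also have "\<dots> \<le> (norm (c - d))\<^sup>2 * (exp (L\<^sup>2 * \<bar>T\<bar>) * exp (L\<^sup>2 * \<bar>T\<bar>))"
    proof -
      have "exp (L\<^sup>2 * t) * 1 \<le> exp (L\<^sup>2 * \<bar>T\<bar>) * exp (L\<^sup>2 * \<bar>T\<bar>)"
        using t by (intro mult_mono) (auto intro!: mult_left_mono)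
      then show ?thesis by (simp add: curve_0 mult_left_mono)
    qed
    also have "\<dots> = (C * norm (c - d))\<^sup>2" by (simp add: C_def power_mult_distrib power2_eq_square)
    finally show "(norm (curve c t - curve d t))\<^sup>2 \<le> (C * norm (c - d))\<^sup>2" .
  qed (simp add: C_def)
  then show ?thesis by (intro exI[of _ C]) (simp add: C_def)
qed

text \<open>The error vanishes at time 0, and its equation is forced by the defects of
  \<open>f\<close> and \<open>r\<close>, each of which is linear in the error plus quadratic in the
  distance of the two curves. The Lipschitz bound turns the latter into
  \<open>norm (c - d)^2\<close>, and Gronwall absorbs the former.\<close>

lemma curve_midpoint:
  assumes M: "0 \<le> M" and T: "0 \<le> T"
  shows "\<exists>K\<ge>0. \<forall>c d t. norm c \<le> M \<longrightarrow> norm d \<le> M \<longrightarrow> t \<in> {0..T} \<longrightarrow>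
    L2norm (val (curve ((1/2) *\<^sub>R (c + d)) t - (1/2) *\<^sub>R (curve c t + curve d t))) \<le> K * (norm (c - d))\<^sup>2"
proof -
  obtain rho where rho: "\<And>c tau t. tau \<le> T \<Longrightarrow> solves FF c tau \<Longrightarrow> norm (c 0) \<le> M \<Longrightarrow> t \<in> {0..tau} \<Longrightarrow> norm (c t) \<le> rho"
    using apriori_bound[OF M, of T] by blast
  obtain C where C0: "0 \<le> C" and C: "\<And>c d t. norm c \<le> M \<Longrightarrow> norm d \<le> M \<Longrightarrow> t \<in> {0..T} \<Longrightarrow>
      norm (curve c t - curve d t) \<le> C * norm (c - d)"
    using curve_lipschitz[OF M, of T] by blast
  obtain B where B0: "B \<ge> 0" and B: "\<And>x. \<bar>x\<bar> \<le> rho \<Longrightarrow> \<bar>f1 x\<bar> \<le> B" "\<And>x. \<bar>x\<bar> \<le> rho \<Longrightarrow> \<bar>f2 x\<bar> \<le> B"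
    "\<And>x. \<bar>x\<bar> \<le> rho \<Longrightarrow> \<bar>r1 x\<bar> \<le> B" "\<And>x. \<bar>x\<bar> \<le> rho \<Longrightarrow> \<bar>r2 x\<bar> \<le> B"
    using bounds_exist[of rho] by blast
  \<comment> \<open>Both defects are at most X = \<open>B * E s + B * (C * delta)^2\<close> in L^2,
    so the squared forcing is at most 4 X^2, and splitting the square doubles this to
    \<open>8 * B^2\<close>.\<close>
  define A where "A = 8 * B\<^sup>2"
  \<comment> \<open>\<open>K^2 * delta^4\<close> is the Gronwall bound for the squared
    error.\<close>
  define K where "K = sqrt (A * C^4 * T * exp (A * T))"
  have A0: "0 \<le> A" by (simp add: A_def)
  have "L2norm (val (curve ((1/2) *\<^sub>R (c + d)) t - (1/2) *\<^sub>R (curve c t + curve d t))) \<le> K * (norm (c - d))\<^sup>2"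
    if c: "norm c \<le> M" and d: "norm d \<le> M" and t: "t \<in> {0..T}" for c d t
  proof -
    define m where "m = (1/2) *\<^sub>R (c + d)"
    have m: "norm m \<le> M" using norm_triangle_ineq[of c d] c d by (simp add: m_def)
    define delta where "delta = norm (c - d)"
    define e where "e s = curve m s - (1/2) *\<^sub>R (curve c s + curve d s)" for s
    define E where "E s = L2norm (val (e s))" for s
    have b: "norm (curve c s) \<le> rho" "norm (curve d s) \<le> rho" "norm (curve m s) \<le> rho" if "s \<in> {0..T}" for s
      by (rule rho[OF order_refl solves_curve]; use c d m that in \<open>simp add: curve_0\<close>)+
    have cc: "continuous_on {0..T} (curve u)" for u by (rule solves_continuous[OF solves_curve])
    have cF: "continuous_on {0..T} (\<lambda>s. FF (curve u s))" for u
      by (intro continuous_on_compose2[OF continuous_on_FF[of UNIV] cc] subset_UNIV)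
    have ce: "continuous_on {0..T} e" unfolding e_def by (intro continuous_intros cc)
    have cE: "continuous_on {0..T} E" unfolding E_def by (rule continuous_on_L2norm_val[OF ce])
    define FD where "FD s = FF (curve m s) - (1/2) *\<^sub>R (FF (curve c s) + FF (curve d s))" for s
    have cFD: "continuous_on {0..T} FD" unfolding FD_def by (intro continuous_intros cF)
    \<comment> \<open>Division by \<open>kap k\<close> passes from V to L^2: these are the sine
      coefficients of \<open>val (e s)\<close>, with square sum \<open>(E s)^2\<close>, and they
      solve the same diagonal system.\<close>
    define a where "a k s = coord (e s) k / kap k" for k s
    define g where "g k s = coord (FD s) k / kap k" for k s
    have ca: "continuous_on {0..T} (a k)" and cg: "continuous_on {0..T} (g k)" for k
      unfolding a_def g_def by (intro continuous_intros ce cFD; simp)+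
    have da: "(a k has_real_derivative (- (kap k)\<^sup>2 * a k s + kap k * g k s)) (at s)" if s: "0 < s" "s < T" for k s
    proof -
      note D = solves_deriv[OF solves_curve s, of _ k]
      have "((\<lambda>s. (coord (curve m s) k - (1/2) * (coord (curve c s) k + coord (curve d s) k)) / kap k) has_real_derivative
          ((- (kap k)\<^sup>2 * coord (curve m s) k + kap k * coord (FF (curve m s)) k)
          - (1/2) * ((- (kap k)\<^sup>2 * coord (curve c s) k + kap k * coord (FF (curve c s)) k)
            + (- (kap k)\<^sup>2 * coord (curve d s) k + kap k * coord (FF (curve d s)) k))) / kap k) (at s)"
        by (intro DERIV_cdivide DERIV_diff DERIV_cmult DERIV_add D)
      moreover have "((- (kap k)\<^sup>2 * coord (curve m s) k + kap k * coord (FF (curve m s)) k)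
          - (1/2) * ((- (kap k)\<^sup>2 * coord (curve c s) k + kap k * coord (FF (curve c s)) k)
            + (- (kap k)\<^sup>2 * coord (curve d s) k + kap k * coord (FF (curve d s)) k))) / kap k
          = - (kap k)\<^sup>2 * a k s + kap k * g k s"
        unfolding a_def g_def e_def FD_def by (simp add: field_simps)
      ultimately show ?thesis unfolding a_def[abs_def] e_def by simp
    qed
    have gle: "(\<Sum>k<n. (g k s)\<^sup>2) \<le> A * (E s)\<^sup>2 + A * C^4 * delta^4" if s: "s \<in> {0..T}" for s n
    proof -
      let ?h = "\<lambda>q x. q (val (curve m s) x) - (1/2) * (q (val (curve c s) x) + q (val (curve d s) x))"
      have sh: "sq_int (?h q)" if "continuous_on UNIV q" for q :: "real \<Rightarrow> real"
        by (intro sq_int_continuous continuous_intros cont_val_comp that)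
      have lin: "(LINT x|I01. q (val (curve m s) x) * p x) - (1/2) * ((LINT x|I01. q (val (curve c s) x) * p x)
          + (LINT x|I01. q (val (curve d s) x) * p x)) = (LINT x|I01. ?h q x * p x)"
        if q: "continuous_on UNIV q" and p: "sq_int p" for q p :: "real \<Rightarrow> real"
      proof -
        have i: "integrable I01 (\<lambda>x. q (val u x) * p x)" for u
          by (intro integrable_sq_int_mult sq_int_continuous cont_val_comp q p)
        have "(LINT x|I01. ?h q x * p x) = (LINT x|I01. q (val (curve m s) x) * p x
            - (1/2) * (q (val (curve c s) x) * p x + q (val (curve d s) x) * p x))"
          by (simp add: algebra_simps)
        then show ?thesis using i by simp
      qed
      \<comment> \<open>The division cancels the factor \<open>kap k\<close> of the divergence form,
        so the defect of \<open>f\<close> enters undifferentiated through its cosine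
        coefficients.\<close>
      have gk: "g k s = ccoef (?h f) k + scoef (?h r) k / kap k" for k
      proof -
        have "coord (FD s) k = kap k * ccoef (?h f) k + scoef (?h r) k"
          unfolding FD_def coord_diff coord_scaleR coord_add FF_divergence_form ccoef_def scoef_def
            lin[OF cont_f sq_int_cosb, symmetric] lin[OF cont_r sq_int_sinb, symmetric]
          by (simp add: algebra_simps)
        then show ?thesis by (simp add: g_def add_divide_distrib)
      qed
      have "(\<Sum>k<n. (g k s)\<^sup>2) \<le> (\<Sum>k<n. 2 * (ccoef (?h f) k)\<^sup>2 + 2 * (scoef (?h r) k)\<^sup>2)"
      proof (rule sum_mono)
        fix k
        have "(scoef (?h r) k / kap k)\<^sup>2 \<le> (scoef (?h r) k)\<^sup>2"
        proof -
          have "\<bar>scoef (?h r) k\<bar> / kap k \<le> \<bar>scoef (?h r) k\<bar> / 1"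
            using kap_ge_1[of k] by (intro divide_left_mono) auto
          then show ?thesis by (simp add: abs_le_square_iff[symmetric] abs_of_pos[OF kap_pos])
        qed
        then show "(g k s)\<^sup>2 \<le> 2 * (ccoef (?h f) k)\<^sup>2 + 2 * (scoef (?h r) k)\<^sup>2"
          unfolding gk using sum_squares_bound[of "ccoef (?h f) k" "scoef (?h r) k / kap k"]
          by (simp add: power2_sum)
      qed
      also have "\<dots> = 2 * (\<Sum>k<n. (ccoef (?h f) k)\<^sup>2) + 2 * (\<Sum>k<n. (scoef (?h r) k)\<^sup>2)"
        by (simp add: sum.distrib sum_distrib_left)
      also have "\<dots> \<le> 2 * (L2norm (?h f))\<^sup>2 + 2 * (L2norm (?h r))\<^sup>2"
        by (intro add_mono mult_left_mono cosb_Bessel sinb_Bessel sh cont_f cont_r) auto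
      also have "\<dots> \<le> 2 * (B * E s + B * (C * delta)\<^sup>2)\<^sup>2 + 2 * (B * E s + B * (C * delta)\<^sup>2)\<^sup>2"
      proof -
        have "L2norm (?h q) \<le> B * E s + B * (C * delta)\<^sup>2"
          if q: "\<And>x. (q has_real_derivative q1 x) (at x)" "\<And>x. (q1 has_real_derivative q2 x) (at x)"
            and bq: "\<And>x. \<bar>x\<bar> \<le> rho \<Longrightarrow> \<bar>q1 x\<bar> \<le> B" "\<And>x. \<bar>x\<bar> \<le> rho \<Longrightarrow> \<bar>q2 x\<bar> \<le> B" for q q1 q2
        proof -
          have cq: "continuous_on UNIV q" by (rule DERIV_continuous_on[OF has_field_derivative_at_within[OF q(1)]])
          have sB: "sq_int (\<lambda>x. B * val (e s) x)" by (intro sq_int_scale sq_int_val)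
          have se: "sq_int (\<lambda>x. \<bar>B * val (e s) x\<bar>)"
            by (intro sq_int_continuous continuous_intros continuous_on_val)
          have "L2norm (?h q) \<le> L2norm (\<lambda>x. \<bar>B * val (e s) x\<bar> + B * (C * delta)\<^sup>2)"
          proof (rule L2norm_mono[OF sh[OF cq] sq_int_add[OF se sq_int_continuous]])
            show "continuous_on {0..1} (\<lambda>x. B * (C * delta)\<^sup>2)" by simp
            fix x :: real
            let ?m = "val (curve m s) x" and ?c = "val (curve c s) x" and ?d = "val (curve d s) x"
            have v: "\<bar>?c\<bar> \<le> rho" "\<bar>?d\<bar> \<le> rho" "\<bar>?m\<bar> \<le> rho"
              using abs_val_le b[OF s] order_trans by blast+
            have "\<bar>q ?m - (q ?c + q ?d) / 2\<bar> \<le> B * \<bar>?m - (?c + ?d) / 2\<bar> + B * (?c - ?d)\<^sup>2"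
              by (rule midpoint_defect[OF q bq B0 v])
            moreover have "?m - (?c + ?d) / 2 = val (e s) x"
              by (simp add: e_def val_diff val_scaleR val_add)
            moreover have "B * (?c - ?d)\<^sup>2 \<le> B * (C * delta)\<^sup>2"
            proof (rule mult_left_mono[OF _ B0])
              have "\<bar>?c - ?d\<bar> \<le> norm (curve c s - curve d s)"
                using abs_val_le[of "curve c s - curve d s" x] by (simp add: val_diff)
              also have "\<dots> \<le> C * delta" unfolding delta_def by (rule C[OF c d s])
              finally have "\<bar>?c - ?d\<bar>\<^sup>2 \<le> (C * delta)\<^sup>2" by (intro power_mono) auto
              then show "(?c - ?d)\<^sup>2 \<le> (C * delta)\<^sup>2" by simp
            qed
            ultimately show "\<bar>?h q x\<bar> \<le> \<bar>\<bar>B * val (e s) x\<bar> + B * (C * delta)\<^sup>2\<bar>"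
              using B0 by (simp add: abs_mult)
          qed
          also have "\<dots> \<le> L2norm (\<lambda>x. \<bar>B * val (e s) x\<bar>) + L2norm (\<lambda>x. B * (C * delta)\<^sup>2)"
            by (intro L2norm_triangle se sq_int_continuous) simp
          also have "L2norm (\<lambda>x. \<bar>B * val (e s) x\<bar>) = L2norm (\<lambda>x. B * val (e s) x)"
            by (simp add: L2norm_def)
          finally show ?thesis using B0 by (simp add: L2norm_scale L2norm_const E_def)
        qed
        from this[OF f1 f2 B(1,2)] this[OF r1 r2 B(3,4)] show ?thesis
          by (intro add_mono mult_left_mono power_mono) auto
      qed
      also have "\<dots> \<le> A * (E s)\<^sup>2 + A * C^4 * delta^4"
        using sum_squares_bound[of "B * E s" "B * (C * delta)\<^sup>2"]
        by (simp add: A_def power2_sum power_mult_distrib power_mult[symmetric] mult_ac)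
      finally show ?thesis .
    qed
    have step: "(E s)\<^sup>2 \<le> A * C^4 * delta^4 * T + A * integral {0..s} (\<lambda>s. (E s)\<^sup>2)" if s: "s \<in> {0..T}" for s
    proof (rule LIMSEQ_le_const2)
      show "(\<lambda>n. \<Sum>k<n. (a k s)\<^sup>2) \<longlonglongrightarrow> (E s)\<^sup>2"
        using L2norm_val_sums[of "e s"] by (simp add: sums_def a_def E_def)
      have sub: "{0..s} \<subseteq> {0..T}" using s by auto
      have "(\<Sum>k<n. (a k s)\<^sup>2) \<le> A * C^4 * delta^4 * T + A * integral {0..s} (\<lambda>s. (E s)\<^sup>2)" for n
      proof -
        have e0: "e 0 = 0" by (simp add: e_def curve_0 m_def)
        have nn: "0 \<le> (\<Sum>k<n. (kap k)\<^sup>2 * integral {0..s} (\<lambda>s. (a k s)\<^sup>2))"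
          by (intro sum_nonneg mult_nonneg_nonneg Henstock_Kurzweil_Integration.integral_nonneg
              integrable_continuous_real continuous_intros continuous_on_subset[OF ca sub]) auto
        have "(\<Sum>k<n. (a k s)\<^sup>2) \<le> integral {0..s} (\<lambda>s. \<Sum>k<n. (g k s)\<^sup>2)"
          using energy_sum[of T a g s n, OF ca cg da s] nn by (simp add: a_def e0)
        also have "\<dots> \<le> integral {0..s} (\<lambda>s. A * (E s)\<^sup>2 + A * C^4 * delta^4)"
          using sub by (intro integral_le integrable_continuous_real continuous_intros gle
              continuous_on_subset[OF cg sub] continuous_on_subset[OF cE sub]) auto
        also have "\<dots> = A * integral {0..s} (\<lambda>s. (E s)\<^sup>2) + A * C^4 * delta^4 * s"
        proof (rule integral_unique)
          have "((\<lambda>s. A * C^4 * delta^4) has_integral A * C^4 * delta^4 * s) {0..s}"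
            using has_integral_const_real[of "A * C^4 * delta^4" 0 s] s by (simp add: mult.commute)
          then show "((\<lambda>s. A * (E s)\<^sup>2 + A * C^4 * delta^4) has_integral
              A * integral {0..s} (\<lambda>s. (E s)\<^sup>2) + A * C^4 * delta^4 * s) {0..s}"
            by (intro has_integral_add has_integral_mult_right integrable_integral integrable_continuous_real
                continuous_intros continuous_on_subset[OF cE sub])
        qed
        also have "A * C^4 * delta^4 * s \<le> A * C^4 * delta^4 * T"
          using s A0 by (intro mult_left_mono) (auto simp: C0 delta_def)
        finally show ?thesis by simp
      qed
      then show "\<exists>N. \<forall>n\<ge>N. (\<Sum>k<n. (a k s)\<^sup>2) \<le> A * C^4 * delta^4 * T + A * integral {0..s} (\<lambda>s. (E s)\<^sup>2)" by blast
    qed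
    have P0: "0 \<le> A * C^4 * T" using A0 T C0 by simp
    have "(E t)\<^sup>2 \<le> A * C^4 * delta^4 * T * exp (A * t)"
      by (rule gronwall_integral[OF _ A0 step t]) (intro continuous_intros cE)
    also have "\<dots> \<le> A * C^4 * delta^4 * T * exp (A * T)"
      using t A0 T C0 by (intro mult_left_mono) (auto intro!: mult_left_mono simp: delta_def)
    also have "\<dots> = (K * delta\<^sup>2)\<^sup>2"
    proof -
      have "K\<^sup>2 = A * C^4 * T * exp (A * T)" unfolding K_def using P0 by (intro real_sqrt_pow2) simp
      then show ?thesis by (simp add: power_mult_distrib power_mult[symmetric])
    qed
    finally have "E t \<le> K * delta\<^sup>2"
      by (rule power2_le_imp_le) (use P0 in \<open>simp add: K_def\<close>)
    then show ?thesis by (simp add: E_def e_def m_def delta_def)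
  qed
  moreover have "0 \<le> K" using A0 T C0 by (simp add: K_def)
  ultimately show ?thesis by blast
qed

end

section \<open>Existence and uniqueness of the minimizer\<close>

text \<open>Strong midpoint convexity makes every minimising sequence Cauchy, since the value at a
  midpoint cannot fall below the infimum; the same inequality identifies any two minimisers.\<close>

lemma midpoint_minimizer:
  fixes J :: "'a::{real_inner, complete_space} \<Rightarrow> real"
  assumes S: "closed S" "S \<noteq> {}" "\<And>x y. x \<in> S \<Longrightarrow> y \<in> S \<Longrightarrow> (1/2) *\<^sub>R (x + y) \<in> S"
    and J: "continuous_on S J" "\<And>x. x \<in> S \<Longrightarrow> 0 \<le> J x"
    and mid: "\<And>x y. x \<in> S \<Longrightarrow> y \<in> S \<Longrightarrow> J ((1/2) *\<^sub>R (x + y)) \<le> (J x + J y) / 2 - (norm (x - y))\<^sup>2"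
  shows "\<exists>!x. x \<in> S \<and> (\<forall>y\<in>S. J x \<le> J y)"
proof -
  define I where "I = Inf (J ` S)"
  have bdd: "bdd_below (J ` S)" using J(2) by (intro bdd_belowI[of _ 0]) auto
  have I: "I \<le> J x" if "x \<in> S" for x unfolding I_def using that bdd by (intro cInf_lower) auto
  \<comment> \<open>The infimum bounds \<open>J\<close> at the midpoint from below, so
    near-optimality of both points limits their distance.\<close>
  have gap: "2 * (norm (x - y))\<^sup>2 \<le> (J x - I) + (J y - I)" if "x \<in> S" "y \<in> S" for x y
    using mid[OF that] I[OF S(3)[OF that]] by (simp add: field_simps)
  have "\<exists>x\<in>S. J x < I + 1 / (real n + 1)" for n
  proof -
    have "Inf (J ` S) < I + 1 / (real n + 1)" by (simp add: I_def)
    then show ?thesis using cInf_lessD[of "J ` S"] S(2) by blast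
  qed
  then obtain X where X: "\<And>n. X n \<in> S" "\<And>n. J (X n) < I + 1 / (real n + 1)" by metis
  have "Cauchy X"
  proof (rule metric_CauchyI)
    fix e :: real assume e: "0 < e"
    obtain N :: nat where N: "1 / e\<^sup>2 < real N" using reals_Archimedean2 by blast
    have small: "J (X n) - I < e\<^sup>2" if "n \<ge> N" for n
    proof -
      have "1 / e\<^sup>2 < real n + 1" using N that by linarith
      then have "1 / (real n + 1) < e\<^sup>2" using e by (simp add: field_simps)
      then show ?thesis using X(2)[of n] by linarith
    qed
    have "dist (X m) (X n) < e" if "m \<ge> N" "n \<ge> N" for m n
    proof -
      have "(norm (X m - X n))\<^sup>2 < e\<^sup>2"
        using gap[OF X(1) X(1), of m n] small[OF that(1)] small[OF that(2)] by linarith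
      then show ?thesis using e by (simp add: dist_norm power2_less_imp_less)
    qed
    then show "\<exists>M. \<forall>m\<ge>M. \<forall>n\<ge>M. dist (X m) (X n) < e" by blast
  qed
  then obtain x where x: "X \<longlonglongrightarrow> x" using Cauchy_convergent convergent_def by blast
  have xS: "x \<in> S" using closed_sequentially[OF S(1) X(1) x] .
  have "(\<lambda>n. J (X n)) \<longlonglongrightarrow> J x"
    using continuous_on_tendsto_compose[OF J(1) x xS] X(1) by simp
  moreover have "(\<lambda>n. I + 1 / (real n + 1)) \<longlonglongrightarrow> I + 0"
    using LIMSEQ_inverse_real_of_nat by (intro tendsto_intros) (simp add: inverse_eq_divide add.commute)
  ultimately have "J x \<le> I + 0"
    by (rule LIMSEQ_le) (use X(2) in \<open>auto intro: less_imp_le\<close>)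
  then have Jx: "J x = I" using I[OF xS] by simp
  show ?thesis
  proof (rule ex1I[of _ x])
    show "x \<in> S \<and> (\<forall>y\<in>S. J x \<le> J y)" using xS I Jx by simp
    fix y assume y: "y \<in> S \<and> (\<forall>z\<in>S. J y \<le> J z)"
    then have "J y = I" using xS Jx I by force
    then have "(norm (y - x))\<^sup>2 \<le> 0" using gap[of y x] y xS Jx by simp
    then show "y = x" by simp
  qed
qed

section \<open>The weighted quadratic data misfit\<close>

lemma wsq_nonneg:
  fixes R :: "real^'q^'q"
  assumes pd: "\<And>w. w \<noteq> 0 \<Longrightarrow> w \<bullet> (R *v w) > 0"
  shows "0 \<le> wsq R w"
proof -
  have "\<forall>x. R *v x = 0 \<longrightarrow> x = 0" using pd by (metis inner_zero_right less_irrefl)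
  then have "invertible R" by (simp add: invertible_left_inverse matrix_left_invertible_ker)
  then have "R ** matrix_inv R = mat 1"
    unfolding invertible_def matrix_inv_def by (metis (mono_tags, lifting) someI_ex)
  then have "R *v (matrix_inv R *v w) = w"
    by (simp add: matrix_vector_mul_assoc)
  then have "wsq R w = (matrix_inv R *v w) \<bullet> (R *v (matrix_inv R *v w))"
    by (simp add: wsq_def inner_commute)
  also have "\<dots> \<ge> 0" using pd[of "matrix_inv R *v w"] by (cases "matrix_inv R *v w = 0") auto
  finally show ?thesis .
qed

text \<open>Parallelogram identity: the gap is one quarter of \<open>wsq R (a - b)\<close>.\<close>

lemma wsq_midpoint:
  assumes "\<And>w. 0 \<le> wsq R w"
  shows "wsq R ((1/2) *\<^sub>R (a + b)) \<le> (wsq R a + wsq R b) / 2"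
proof -
  have "2 * (wsq R a + wsq R b) - 4 * wsq R ((1/2) *\<^sub>R (a + b)) = wsq R (a - b)"
    unfolding wsq_def
    by (simp add: matrix_vector_right_distrib matrix_vector_mult_diff_distrib matrix_vector_mult_scaleR
        inner_add_left inner_add_right inner_diff_left inner_diff_right field_simps)
  moreover define w where "w = wsq R ((1/2) *\<^sub>R (a + b))"
  ultimately have "2 * w \<le> wsq R a + wsq R b" using assms[of "a - b"] by simp
  then show ?thesis unfolding w_def by simp
qed

lemma wsq_diff_le:
  shows "\<exists>Q\<ge>0. \<forall>a b. \<bar>wsq R a - wsq R b\<bar> \<le> Q * (norm a + norm b) * norm (a - b)"
proof -
  let ?A = "matrix_inv R"
  obtain Q where Q: "Q \<ge> 0" "\<And>v. norm (?A *v v) \<le> norm v * Q"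
    using bounded_linear.nonneg_bounded[OF matrix_vector_mul_bounded_linear[of ?A]] by auto
  have "\<bar>wsq R a - wsq R b\<bar> \<le> Q * (norm a + norm b) * norm (a - b)" for a b
  proof -
    have "wsq R a - wsq R b = (a - b) \<bullet> (?A *v a) + b \<bullet> (?A *v (a - b))"
      unfolding wsq_def by (simp add: inner_diff_left inner_diff_right matrix_vector_mult_diff_distrib)
    moreover have "\<bar>(a - b) \<bullet> (?A *v a)\<bar> \<le> norm (a - b) * (norm a * Q)"
      by (rule order_trans[OF Cauchy_Schwarz_ineq2 mult_left_mono[OF Q(2)]]) simp
    moreover have "\<bar>b \<bullet> (?A *v (a - b))\<bar> \<le> norm b * (norm (a - b) * Q)"
      by (rule order_trans[OF Cauchy_Schwarz_ineq2 mult_left_mono[OF Q(2)]]) simp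
    moreover have "norm (a - b) * (norm a * Q) + norm b * (norm (a - b) * Q) = Q * (norm a + norm b) * norm (a - b)"
      by (simp add: algebra_simps)
    ultimately show ?thesis by linarith
  qed
  then show ?thesis using Q(1) by blast
qed

lemma midpoint_dist_sq:
  fixes x y u :: "'a::real_inner"
  shows "(norm ((1/2) *\<^sub>R (x + y) - u))\<^sup>2 = ((norm (x - u))\<^sup>2 + (norm (y - u))\<^sup>2) / 2 - (norm (x - y))\<^sup>2 / 4"
  by (simp add: power2_norm_eq_inner inner_add_left inner_add_right inner_diff_left inner_diff_right
      inner_commute field_simps)

section \<open>Balancing the data misfit against the penalty\<close>

context osgood
begin

theorem unique_minimizer:
  fixes H :: "(real \<Rightarrow> real) \<Rightarrow> real^'q" and R :: "real^'q^'q" and N :: nat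
  assumes H_add: "\<And>v w. sq_int v \<Longrightarrow> sq_int w \<Longrightarrow> H (\<lambda>x. v x + w x) = H v + H w"
    and H_scale: "\<And>c v. sq_int v \<Longrightarrow> H (\<lambda>x. c * v x) = c *\<^sub>R H v"
    and H_bounded: "\<exists>C. \<forall>v. sq_int v \<longrightarrow> norm (H v) \<le> C * L2norm v"
    and R_pd: "\<And>w. w \<noteq> 0 \<Longrightarrow> w \<bullet> (R *v w) > 0"
    and D: "D \<ge> 0" and M: "M \<ge> 0" and T: "T \<ge> 0"
  shows "\<exists>\<sigma>0>0. \<forall>\<sigma> u0 t z. 0 < \<sigma> \<and> \<sigma> < \<sigma>0 \<and> u0 \<in> H10 \<and> Vnorm u0 \<le> M \<and>
           (\<forall>i\<in>{1..N}. t i \<in> {0..T}) \<and> (\<forall>i\<in>{1..N}. norm (z i) \<le> D)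
           \<longrightarrow> (\<exists>!u. u \<in> H10 \<and> (\<forall>v\<in>H10. cost f r H R \<sigma> u0 N t z u \<le> cost f r H R \<sigma> u0 N t z v))"
proof -
  \<comment> \<open>All comparisons take place in the unit ball around \<open>u0\<close>, whose
    elements have norm at most \<open>M + 1\<close>.\<close>
  define M' where "M' = M + 1"
  have M': "0 \<le> M'" using M by (simp add: M'_def)
  obtain CH0 where CH0: "\<And>v. sq_int v \<Longrightarrow> norm (H v) \<le> CH0 * L2norm v" using H_bounded by blast
  define CH where "CH = \<bar>CH0\<bar>"
  have CH: "0 \<le> CH" "\<And>v. sq_int v \<Longrightarrow> norm (H v) \<le> CH * L2norm v"
    using order_trans[OF CH0 mult_right_mono[OF abs_ge_self L2norm_nonneg]] by (auto simp: CH_def)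
  define h where "h c = H (val c)" for c
  have h_add: "h (c + d) = h c + h d" for c d
  proof -
    have "val (c + d) = (\<lambda>x. val c x + val d x)" by (rule ext) (rule val_add)
    then show ?thesis by (simp add: h_def H_add sq_int_val)
  qed
  have h_scale: "h (a *\<^sub>R c) = a *\<^sub>R h c" for a c
  proof -
    have "val (a *\<^sub>R c) = (\<lambda>x. a * val c x)" by (rule ext) (rule val_scaleR)
    then show ?thesis by (simp add: h_def H_scale sq_int_val)
  qed
  have h_diff: "h (c - d) = h c - h d" for c d
    using h_add[of c "(-1) *\<^sub>R d"] h_scale[of "-1" d] by simp
  have h_L2: "norm (h c) \<le> CH * L2norm (val c)" for c unfolding h_def by (rule CH(2)[OF sq_int_val])
  have h_le: "norm (h c) \<le> CH * norm c" for c
    by (rule order_trans[OF h_L2 mult_left_mono[OF L2norm_val_le CH(1)]])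
  obtain rho where rho: "rho \<ge> 0" "\<And>c tau t. tau \<le> T \<Longrightarrow> solves FF c tau \<Longrightarrow> norm (c 0) \<le> M' \<Longrightarrow> t \<in> {0..tau} \<Longrightarrow> norm (c t) \<le> rho"
    using apriori_bound[OF M', of T] by blast
  have cbd: "norm (curve c t) \<le> rho" if "norm c \<le> M'" "t \<in> {0..T}" for c t
    by (rule rho(2)[OF order_refl solves_curve]) (use that in \<open>simp_all add: curve_0\<close>)
  obtain C where C: "0 \<le> C" "\<And>c d t. norm c \<le> M' \<Longrightarrow> norm d \<le> M' \<Longrightarrow> t \<in> {0..T} \<Longrightarrow>
      norm (curve c t - curve d t) \<le> C * norm (c - d)"
    using curve_lipschitz[OF M', of T] by blast
  obtain K where K: "0 \<le> K" "\<And>c d t. norm c \<le> M' \<Longrightarrow> norm d \<le> M' \<Longrightarrow> t \<in> {0..T} \<Longrightarrow>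
      L2norm (val (curve ((1/2) *\<^sub>R (c + d)) t - (1/2) *\<^sub>R (curve c t + curve d t))) \<le> K * (norm (c - d))\<^sup>2"
    using curve_midpoint[OF M' T] by blast
  obtain Q where Q: "0 \<le> Q" "\<And>a b. \<bar>wsq R a - wsq R b\<bar> \<le> Q * (norm a + norm b) * norm (a - b)"
    using wsq_diff_le[of R] by blast
  have pos: "0 \<le> wsq R w" for w by (rule wsq_nonneg[OF R_pd])
  \<comment> \<open>A bound for every residual \<open>H y(t_i) - z_i\<close> when the datum lies in
    that ball.\<close>
  define W where "W = CH * rho + D"
  have W0: "0 \<le> W" using CH(1) rho(1) D by (simp add: W_def)
  \<comment> \<open>Bounds the cost at \<open>u0\<close>, where the penalty vanishes; competitors
    outside the ball are compared with it.\<close>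
  define P where "P = real N * (Q * W * W) / 2"
  \<comment> \<open>The total convexity defect of the data term: each squared residual varies with
    Lipschitz constant \<open>Q * (2 * W)\<close>, and the midpoint error of the observations is
    \<open>CH * K\<close> times the squared distance.\<close>
  define B where "B = real N * (Q * (2 * W) * (CH * K)) / 2"
  have P0: "0 \<le> P" and B0: "0 \<le> B" using Q(1) W0 CH(1) K(1) by (simp_all add: P_def B_def)
  \<comment> \<open>Below this threshold \<open>1 / \<sigma>\<^sup>2\<close> is at least
    \<open>8 * (P + B + 1)\<close>. Outside the unit ball the penalty is then at least
    \<open>4 * (P + B + 1)\<close>, more than P; inside, its convexity gain of one eighth exceeds
    \<open>B\<close> by at least 1, as \<open>midpoint_minimizer\<close> demands.\<close>
  define \<sigma>0 where "\<sigma>0 = 1 / sqrt (8 * (P + B + 1))"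
  have s0: "0 < \<sigma>0" using P0 B0 by (simp add: \<sigma>0_def)
  have main: "\<exists>!u. u \<in> H10 \<and> (\<forall>v\<in>H10. cost f r H R \<sigma> u0 N t z u \<le> cost f r H R \<sigma> u0 N t z v)"
    if \<sigma>: "0 < \<sigma>" "\<sigma> < \<sigma>0" and u0: "u0 \<in> H10" "Vnorm u0 \<le> M" and t: "\<And>i. i \<in> {1..N} \<Longrightarrow> t i \<in> {0..T}"
      and z: "\<And>i. i \<in> {1..N} \<Longrightarrow> norm (z i) \<le> D" for \<sigma> u0 t z
  proof -
    have big: "8 * (P + B + 1) \<le> 1 / \<sigma>\<^sup>2"
    proof -
      have "\<sigma>\<^sup>2 \<le> \<sigma>0\<^sup>2" using \<sigma> by (intro power_mono) auto
      also have "\<sigma>0\<^sup>2 = 1 / (8 * (P + B + 1))" using P0 B0 by (simp add: \<sigma>0_def power_divide)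
      finally show ?thesis using \<sigma>(1) P0 B0 by (simp add: field_simps)
    qed
    obtain b where b: "u0 = val b" using u0(1) H10_eq_range_val by auto
    have bM: "norm b \<le> M" using u0(2) by (simp add: b Vnorm_val)
    define J where "J c = (1/2) * (\<Sum>i=1..N. wsq R (h (curve c (t i)) - z i)) + (norm (c - b))\<^sup>2 / (2 * \<sigma>\<^sup>2)" for c
    have cost_J: "cost f r H R \<sigma> u0 N t z (val c) = J c" for c
    proof -
      have "sol f r (val c) (t i) = val (curve c (t i))" if "i \<in> {1..N}" for i
        using t[OF that] by (intro sol_val) simp
      moreover have "(\<lambda>x. val c x - u0 x) = val (c - b)" by (rule ext) (simp add: b val_diff)
      ultimately show ?thesis unfolding cost_def J_def by (simp add: h_def Vnorm_val)
    qed
    define S where "S = cball b 1"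
    have SM: "norm c \<le> M'" if "c \<in> S" for c
    proof -
      have "norm c \<le> norm b + norm (c - b)" using norm_triangle_ineq[of b "c - b"] by simp
      then show ?thesis using that bM by (simp add: S_def M'_def dist_norm norm_minus_commute)
    qed
    have bS: "b \<in> S" by (simp add: S_def)
    have res: "norm (h (curve c (t i)) - z i) \<le> W" if "c \<in> S" "i \<in> {1..N}" for c i
    proof -
      have "norm (h (curve c (t i)) - z i) \<le> norm (h (curve c (t i))) + norm (z i)" by (rule norm_triangle_ineq4)
      also have "\<dots> \<le> CH * rho + D"
        using h_le[of "curve c (t i)"] cbd[OF SM[OF that(1)] t[OF that(2)]] z[OF that(2)] CH(1)
        by (intro add_mono order_trans[OF h_le mult_left_mono]) auto
      finally show ?thesis by (simp add: W_def)
    qed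
    have J_nonneg: "0 \<le> J c" for c unfolding J_def by (intro add_nonneg_nonneg mult_nonneg_nonneg sum_nonneg pos) auto
    have Jb: "J b \<le> P"
    proof -
      have "wsq R (h (curve b (t i)) - z i) \<le> Q * W * W" if i: "i \<in> {1..N}" for i
      proof -
        let ?a = "h (curve b (t i)) - z i"
        have "\<bar>wsq R ?a - wsq R 0\<bar> \<le> Q * (norm ?a + norm (0::real^'q)) * norm (?a - 0)" by (rule Q(2))
        then have "wsq R ?a \<le> Q * norm ?a * norm ?a" by (simp add: wsq_def)
        also have "\<dots> \<le> Q * W * W"
          using res[OF bS i] Q(1) W0 by (intro mult_mono) auto
        finally show ?thesis .
      qed
      then have "(\<Sum>i=1..N. wsq R (h (curve b (t i)) - z i)) \<le> (\<Sum>i=1..N. Q * W * W)" by (intro sum_mono) auto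
      then show ?thesis by (simp add: J_def P_def)
    qed
    have outside: "J b < J c" if "c \<notin> S" for c
    proof -
      have "1 < norm (c - b)" using that by (simp add: S_def dist_norm norm_minus_commute)
      then have n1: "1 \<le> (norm (c - b))\<^sup>2" by (simp add: one_le_power)
      have "P < (8 * (P + B + 1)) / 2 * 1" using P0 B0 by simp
      also have "\<dots> \<le> (1 / \<sigma>\<^sup>2) / 2 * (norm (c - b))\<^sup>2"
        using big n1 by (intro mult_mono) auto
      also have "(1 / \<sigma>\<^sup>2) / 2 * (norm (c - b))\<^sup>2 = (norm (c - b))\<^sup>2 / (2 * \<sigma>\<^sup>2)" by simp
      also have "\<dots> \<le> J c" unfolding J_def by (simp add: sum_nonneg pos)
      finally show ?thesis using Jb by simp
    qed
    have mid: "J ((1/2) *\<^sub>R (c + d)) \<le> (J c + J d) / 2 - (norm (c - d))\<^sup>2" if c: "c \<in> S" and d: "d \<in> S" for c d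
    proof -
      define m where "m = (1/2) *\<^sub>R (c + d)"
      have mS: "m \<in> S"
        using convexD_alt[of S c d "1/2"] c d by (simp add: m_def S_def scaleR_add_right)
      have q: "wsq R (h (curve m (t i)) - z i)
          \<le> (wsq R (h (curve c (t i)) - z i) + wsq R (h (curve d (t i)) - z i)) / 2 + Q * (2 * W) * (CH * K) * (norm (c - d))\<^sup>2"
        if i: "i \<in> {1..N}" for i
      proof -
        let ?a = "h (curve c (t i)) - z i" and ?b = "h (curve d (t i)) - z i" and ?m = "h (curve m (t i)) - z i"
        define ab where "ab = (1/2) *\<^sub>R (?a + ?b)"
        have "?m - ab = h (curve m (t i) - (1/2) *\<^sub>R (curve c (t i) + curve d (t i)))"
          unfolding ab_def h_diff h_scale h_add by (simp add: algebra_simps scaleR_2[symmetric])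
        then have "norm (?m - ab) \<le> CH * L2norm (val (curve m (t i) - (1/2) *\<^sub>R (curve c (t i) + curve d (t i))))"
          using h_L2 by simp
        also have "\<dots> \<le> CH * (K * (norm (c - d))\<^sup>2)"
          unfolding m_def by (intro mult_left_mono K(2) SM c d t[OF i] CH(1))
        finally have dm: "norm (?m - ab) \<le> CH * K * (norm (c - d))\<^sup>2" by (simp add: mult.assoc)
        have nab: "norm ab \<le> W"
          unfolding ab_def using norm_triangle_ineq[of ?a ?b] res[OF c i] res[OF d i] by simp
        have "wsq R ?m - wsq R ab \<le> Q * (norm ?m + norm ab) * norm (?m - ab)"
          using Q(2)[of ?m ab] by linarith
        also have "\<dots> \<le> Q * (2 * W) * (CH * K * (norm (c - d))\<^sup>2)"
        proof (rule mult_mono[OF _ dm])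
          show "Q * (norm ?m + norm ab) \<le> Q * (2 * W)"
            using res[OF mS i] nab by (intro mult_left_mono Q(1)) linarith
          show "0 \<le> Q * (2 * W)" using Q(1) W0 by simp
        qed simp
        finally have "wsq R ?m \<le> wsq R ab + Q * (2 * W) * (CH * K) * (norm (c - d))\<^sup>2"
          by (simp add: mult.assoc)
        also have "\<dots> \<le> (wsq R ?a + wsq R ?b) / 2 + Q * (2 * W) * (CH * K) * (norm (c - d))\<^sup>2"
          unfolding ab_def by (intro add_right_mono wsq_midpoint pos)
        finally show ?thesis .
      qed
      have "(\<Sum>i=1..N. wsq R (h (curve m (t i)) - z i))
          \<le> (\<Sum>i=1..N. (wsq R (h (curve c (t i)) - z i) + wsq R (h (curve d (t i)) - z i)) / 2 + Q * (2 * W) * (CH * K) * (norm (c - d))\<^sup>2)"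
        by (intro sum_mono q) simp
      also have "\<dots> = ((\<Sum>i=1..N. wsq R (h (curve c (t i)) - z i)) + (\<Sum>i=1..N. wsq R (h (curve d (t i)) - z i))) / 2
          + real N * (Q * (2 * W) * (CH * K) * (norm (c - d))\<^sup>2)"
        by (simp add: sum.distrib sum_divide_distrib[symmetric])
      finally have 1: "(1/2) * (\<Sum>i=1..N. wsq R (h (curve m (t i)) - z i))
          \<le> ((1/2) * (\<Sum>i=1..N. wsq R (h (curve c (t i)) - z i)) + (1/2) * (\<Sum>i=1..N. wsq R (h (curve d (t i)) - z i))) / 2
          + B * (norm (c - d))\<^sup>2"
        by (simp add: B_def)
      have 2: "(norm (m - b))\<^sup>2 / (2 * \<sigma>\<^sup>2) = ((norm (c - b))\<^sup>2 / (2 * \<sigma>\<^sup>2) + (norm (d - b))\<^sup>2 / (2 * \<sigma>\<^sup>2)) / 2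
          - (1 / \<sigma>\<^sup>2) * (norm (c - d))\<^sup>2 / 8"
        unfolding m_def midpoint_dist_sq using \<sigma>(1) by (simp add: field_simps)
      have 3: "(8 * (P + B + 1)) * (norm (c - d))\<^sup>2 \<le> (1 / \<sigma>\<^sup>2) * (norm (c - d))\<^sup>2"
        by (intro mult_right_mono big) simp
      have 4: "0 \<le> P * (norm (c - d))\<^sup>2" using P0 by simp
      \<comment> \<open>The final inequality is linear in these quantities; abstracting them to
        variables leaves pure arithmetic.\<close>
      have comb: "sm + nm \<le> ((sc + nc) + (sd + nd)) / 2 - del"
        if "sm \<le> (sc + sd) / 2 + B * del" "nm = (nc + nd) / 2 - s * del / 8"
          "(8 * (P + B + 1)) * del \<le> s * del" "0 \<le> P * del" for sm sc sd nm nc nd s del :: real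
        using that by (simp add: field_simps)
      show ?thesis unfolding m_def[symmetric] J_def by (rule comb[OF 1 2 3 4])
    qed
    have contJ: "continuous_on S J"
    proof -
      have "continuous_on S (\<lambda>c. wsq R (h (curve c (t i)) - z i))" if i: "i \<in> {1..N}" for i
      proof (rule lipschitz_on_continuous_on, rule lipschitz_onI)
        fix c d assume c: "c \<in> S" and d: "d \<in> S"
        let ?a = "h (curve c (t i)) - z i" and ?b = "h (curve d (t i)) - z i"
        have "?a - ?b = h (curve c (t i) - curve d (t i))" by (simp add: h_diff)
        then have "norm (?a - ?b) \<le> CH * norm (curve c (t i) - curve d (t i))" using h_le by simp
        also have "\<dots> \<le> CH * (C * norm (c - d))" by (intro mult_left_mono C(2) SM c d t[OF i] CH(1))
        finally have ab: "norm (?a - ?b) \<le> CH * (C * norm (c - d))" .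
        have "\<bar>wsq R ?a - wsq R ?b\<bar> \<le> Q * (norm ?a + norm ?b) * norm (?a - ?b)" by (rule Q(2))
        also have "\<dots> \<le> Q * (W + W) * (CH * (C * norm (c - d)))"
          using Q(1) W0 CH(1) C(1) by (intro mult_mono ab add_mono res c d i mult_left_mono) auto
        finally show "dist (wsq R ?a) (wsq R ?b) \<le> Q * (W + W) * (CH * C) * dist c d"
          by (simp add: dist_real_def dist_norm mult.assoc)
      qed (use Q(1) W0 CH(1) C(1) in simp)
      then show ?thesis unfolding J_def using \<sigma>(1) by (intro continuous_intros) auto
    qed
    have "\<exists>!x. x \<in> S \<and> (\<forall>y\<in>S. J x \<le> J y)"
    proof (rule midpoint_minimizer[OF _ _ _ contJ J_nonneg mid])
      show "closed S" "S \<noteq> {}" by (simp_all add: S_def)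
      show "(1/2) *\<^sub>R (x + y) \<in> S" if "x \<in> S" "y \<in> S" for x y
        using convexD_alt[of S x y "1/2"] that by (simp add: S_def scaleR_add_right)
    qed
    then obtain x where x: "x \<in> S" "\<And>y. y \<in> S \<Longrightarrow> J x \<le> J y"
      and xu: "\<And>x'. x' \<in> S \<Longrightarrow> (\<And>y. y \<in> S \<Longrightarrow> J x' \<le> J y) \<Longrightarrow> x' = x" by blast
    \<comment> \<open>Outside the ball every value exceeds the one at the centre \<open>b\<close>,
      so the minimum over the ball is global.\<close>
    have glob: "J x \<le> J y" for y
      using x(2)[of y] x(2)[OF bS] outside[of y] by (cases "y \<in> S") auto
    show ?thesis
    proof (rule ex1I[of _ "val x"])
      show "val x \<in> H10 \<and> (\<forall>v\<in>H10. cost f r H R \<sigma> u0 N t z (val x) \<le> cost f r H R \<sigma> u0 N t z v)"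
        unfolding H10_eq_range_val using glob by (auto simp: cost_J)
      fix u assume u: "u \<in> H10 \<and> (\<forall>v\<in>H10. cost f r H R \<sigma> u0 N t z u \<le> cost f r H R \<sigma> u0 N t z v)"
      then obtain c where c: "u = val c" using H10_eq_range_val by auto
      have Jc: "J c \<le> J y" for y
        using u val_in_H10[of y] unfolding c by (auto simp: cost_J)
      \<comment> \<open>A global minimiser cannot lie outside the ball, where the cost is larger
        than at \<open>b\<close>; inside, uniqueness is already known.\<close>
      then have "c \<in> S" using outside[of c] Jc[of b] by force
      then have "c = x" by (intro xu Jc)
      then show "u = val x" by (simp add: c)
    qed
  qed
  show ?thesis
    by (intro exI[of _ \<sigma>0] conjI s0 allI impI main) auto
qed

end

lemma increasing_times:
  fixes t :: "nat \<Rightarrow> real"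
  assumes "0 < t 1" "\<And>i. 1 \<le> i \<Longrightarrow> i < N \<Longrightarrow> t i < t (Suc i)" "i \<in> {1..N}"
  shows "t i \<in> {0..t N}"
proof -
  have up: "t j \<le> t k" if "1 \<le> j" "j \<le> k" "k \<le> N" for j k
    using that(2,3,1)
  proof (induction k rule: dec_induct)
    case (step k)
    then show ?case using assms(2)[of k] by fastforce
  qed simp
  show ?thesis using up[of 1 i] up[of i N] assms by auto
qed

theorem theorem3:
  fixes f r :: "real \<Rightarrow> real"
    and H :: "(real \<Rightarrow> real) \<Rightarrow> real^'q"
    and R :: "real^'q^'q"
    and N :: nat and D M T :: real
  assumes f_C2: "C2 f" and r_C2: "C2 r"
    and r_neg: "filterlim (\<lambda>a. integral {-a..0} (\<lambda>y. 1 / (\<bar>r y\<bar> + 1))) at_top at_top"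
    and r_pos: "filterlim (\<lambda>a. integral {0..a} (\<lambda>y. 1 / (\<bar>r y\<bar> + 1))) at_top at_top"
    and H_add: "\<And>v w. sq_int v \<Longrightarrow> sq_int w \<Longrightarrow> H (\<lambda>x. v x + w x) = H v + H w"
    and H_scale: "\<And>c v. sq_int v \<Longrightarrow> H (\<lambda>x. c * v x) = c *\<^sub>R H v"
    and H_bounded: "\<exists>C. \<forall>v. sq_int v \<longrightarrow> norm (H v) \<le> C * L2norm v"
    and R_sym: "transpose R = R"
    and R_pd: "\<And>w. w \<noteq> 0 \<Longrightarrow> w \<bullet> (R *v w) > 0"
    and N_pos: "N \<ge> 1" and D_nonneg: "D \<ge> 0" and M_nonneg: "M \<ge> 0" and T_pos: "T > 0"
  shows "\<exists>\<sigma>0>0. \<forall>\<sigma> u0 t z.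
           0 < \<sigma> \<and> \<sigma> < \<sigma>0 \<and> u0 \<in> H10 \<and> Vnorm u0 \<le> M \<and>
           0 < t 1 \<and> (\<forall>i. 1 \<le> i \<and> i < N \<longrightarrow> t i < t (Suc i)) \<and> t N = T \<and>
           (\<forall>i\<in>{1..N}. norm (z i) \<le> D)
           \<longrightarrow> (\<exists>!u. u \<in> H10 \<and> (\<forall>v\<in>H10. cost f r H R \<sigma> u0 N t z u \<le> cost f r H R \<sigma> u0 N t z v))"
proof -
  obtain f1 f2 where f: "\<And>x. (f has_real_derivative f1 x) (at x)" "\<And>x. (f1 has_real_derivative f2 x) (at x)"
    "continuous_on UNIV f2" using f_C2 unfolding C2_def by blast
  obtain r1 r2 where r: "\<And>x. (r has_real_derivative r1 x) (at x)" "\<And>x. (r1 has_real_derivative r2 x) (at x)"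
    "continuous_on UNIV r2" using r_C2 unfolding C2_def by blast
  interpret osgood f f1 f2 r r1 r2
    by unfold_locales (rule f r r_neg r_pos)+
  obtain \<sigma>0 where \<sigma>0: "\<sigma>0 > 0" "\<And>\<sigma> u0 t z. 0 < \<sigma> \<and> \<sigma> < \<sigma>0 \<and> u0 \<in> H10 \<and> Vnorm u0 \<le> M \<and>
      (\<forall>i\<in>{1..N}. t i \<in> {0..T}) \<and> (\<forall>i\<in>{1..N}. norm (z i) \<le> D) \<Longrightarrow>
      \<exists>!u. u \<in> H10 \<and> (\<forall>v\<in>H10. cost f r H R \<sigma> u0 N t z u \<le> cost f r H R \<sigma> u0 N t z v)"
    using unique_minimizer[where H=H and R=R and N=N and D=D and M=M and T=T,
        OF H_add H_scale H_bounded R_pd D_nonneg M_nonneg less_imp_le[OF T_pos]] by blast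
  show ?thesis
  proof (intro exI[of _ \<sigma>0] conjI \<sigma>0(1) allI impI)
    fix \<sigma> :: real and u0 :: "real \<Rightarrow> real" and t :: "nat \<Rightarrow> real" and z :: "nat \<Rightarrow> real^'q"
    assume a: "0 < \<sigma> \<and> \<sigma> < \<sigma>0 \<and> u0 \<in> H10 \<and> Vnorm u0 \<le> M \<and>
           0 < t 1 \<and> (\<forall>i. 1 \<le> i \<and> i < N \<longrightarrow> t i < t (Suc i)) \<and> t N = T \<and>
           (\<forall>i\<in>{1..N}. norm (z i) \<le> D)"
    then have "\<forall>i\<in>{1..N}. t i \<in> {0..T}" using increasing_times[of t N] by blast
    with a show "\<exists>!u. u \<in> H10 \<and> (\<forall>v\<in>H10. cost f r H R \<sigma> u0 N t z u \<le> cost f r H R \<sigma> u0 N t z v)"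
      by (intro \<sigma>0(2)) blast
  qed
qed

end
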